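(* Let $n=7$ and let $\mathcal{W}\subset(\mathbb{R}^{28})^{\otimes5}$ be the set defined below. Let $\mathcal{C}\in(\mathbb{R}^2)^{\otimes6}$ be the symmetric tensor of $x^6-3y^6$ and $\mathcal{C}_c\in(\mathbb{R}^{28})^{\otimes6}$ its $14$ clone. Then $\mathcal{W}$ has $5152$ elements, $\operatorname{SAdj}(\mathcal{C}_c,\mathcal{W})\in(\mathbb{R}^{5180})^{\otimes6}$ is a symmetric tensor, its real rank is $30913$ and its real symmetric rank is $30914$.
   Context: All tensors are real; rank = minimal number of decomposable summands $v_1\otimes\cdots\otimes v_6$, symmetric rank = minimal number of summands $\lambda v^{\otimes6}$. Symmetric tensors correspond to forms via $\mathcal{T}\leftrightarrow\sum_k\mathcal{T}(k_1|\dots|k_m)x_{k_1}\cdots x_{k_m}$ ($x_1=x,x_2=y$). Clone: with $E=\{1,\dots,2n\}$, $\mathcal{E}=\{2n+1,\dots,4n\}$, the $2n$ clone of $\mathcal{U}\in(\mathbb{R}^2)^{\otimes m}$ is $\mathcal{U}_c\in(\mathbb{R}^{4n})^{\otimes m}$ with $\mathcal{U}_c(k_1|\dots|k_m)=\mathcal{U}(h_1|\dots|h_m)$, $h_i=1$ if $k_i\in E$, $h_i=2$ if $k_i\in\mathcal{E}$. The set $\mathcal{W}$ (for general $n\ge5$): for $i\in\{1,\dots,n\}$ let $\alpha_i\in\mathbb{R}^{2n}$ have entries $1$ at positions $2i-1$ and $2i$ and $0$ elsewhere. For $a,b\in\mathbb{R}^{2n}$ write $(a|b)\in\mathbb{R}^{4n}$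 for the concatenation. With $1\le i_1<i_2<i_3<i_4\le n$ and $1\le k_1<k_2\le n$ ranging over all choices, let $U$ be the set of vectors of the following 16 types: $(\alpha_{i_1}+\alpha_{i_2}+\alpha_{i_3}+\alpha_{i_4}|0)$, $(\alpha_{i_1}+\alpha_{i_2}+\alpha_{i_3}|0)$, $(\alpha_{i_1}+\alpha_{i_2}|0)$, $(\alpha_{i_1}|0)$, $(\alpha_{i_1}+\alpha_{i_2}+\alpha_{i_3}+\alpha_{i_4}|\alpha_{k_1})$, $(\alpha_{i_1}+\alpha_{i_2}|\tfrac{(n-2)^2}{(n-3)(n-1)}\alpha_{k_1})$, $(\alpha_{i_1}|\tfrac{n-2}{n-3}\alpha_{k_1})$, $(\alpha_{i_1}|\tfrac{n-1}{n-4}\alpha_{k_1})$, $(\alpha_{i_1}+\alpha_{i_2}+\alpha_{i_3}|\alpha_{k_1}+\alpha_{k_2})$, $(\alpha_{i_1}+\alpha_{i_2}|\tfrac{n-2}{n-3}(\alpha_{k_1}+\alpha_{k_2}))$, $(\alpha_{i_1}+\alpha_{i_2}|\tfrac{n-2}{n-4}\alpha_{k_1})$, $(0|\alpha_{k_1})$, $(\alpha_{i_1}+\alpha_{i_2}+\alpha_{i_3}|\tfrac{n-3}{n-4}\alpha_{k_1})$, $(\alpha_{i_1}+\alpha_{i_2}+\alpha_{i_3}|\tfrac{n-2}{n-1}\alpha_{k_1})$, $(\alpha_{i_1}|\tfrac{n-1}{n-3}(\alpha_{k_1}+\alpha_{k_2}))$, $(0|\alpha_{k_1}+\alpha_{k_2})$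 (in types using only $i_1$, or only $k_1$, the other indices are absent; $k_1$ alone ranges over $\{1,\dots,n\}$). Let $\pi:\mathbb{R}^{4n}\to\mathbb{R}^{4n}$, $\pi(a_1,\dots,a_{2n},b_1,\dots,b_{2n})=(b_2,\dots,b_{2n},b_1,a_2,\dots,a_{2n},a_1)$. Set $\mathcal{W}_1=\{u^{\otimes5}:u\in U\}$, $\mathcal{W}_2=\{(\pi u)^{\otimes5}:u\in U\}$, $\mathcal{W}=\mathcal{W}_1\cup\mathcal{W}_2\subset(\mathbb{R}^{4n})^{\otimes5}$. Symmetric adjoining: index $\mathcal{W}$ by itself, a set disjoint from $I=\{1,\dots,4n\}$; $\operatorname{SAdj}(\mathcal{C}_c,\mathcal{W})\in(\mathbb{R}^{I\cup\mathcal{W}})^{\otimes6}$ has entry $\mathcal{C}_c(k_1|\dots|k_6)$ when all $k_i\in I$, entry $w(k_1|\dots|\widehat{k_j}|\dots|k_6)$ when exactly the $j$th index is an element $w\in\mathcal{W}$ and all others lie in $I$, and $0$ otherwise. *)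

theory Defs
  imports Complex_Main "HOL-Library.Multiset"
begin

text \<open>A tensor of order m over a finite index set S (i.e. an element of
 (R^S)^{\<otimes> m}) is represented by a function on lists of indices; only its
 values on lists of length m with entries in S matter.\<close>

definition symmetric_tensor :: "'a set \<Rightarrow> nat \<Rightarrow> ('a list \<Rightarrow> real) \<Rightarrow> bool" where
  "symmetric_tensor S m T \<longleftrightarrow>
     (\<forall>ks ks'. length ks = m \<and> set ks \<subseteq> S \<and> mset ks' = mset ks \<longrightarrow> T ks = T ks')"

definition tensor_rank :: "'a set \<Rightarrow> nat \<Rightarrow> ('a list \<Rightarrow> real) \<Rightarrow> nat" where
  "tensor_rank S m T = (LEAST r. \<exists>v :: nat \<Rightarrow> nat \<Rightarrow> 'a \<Rightarrow> real.
      \<forall>ks. length ks = m \<and> set ks \<subseteq> S \<longrightarrow>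
        T ks = (\<Sum>i<r. \<Prod>j<m. v i j (ks ! j)))"

definition symmetric_rank :: "'a set \<Rightarrow> nat \<Rightarrow> ('a list \<Rightarrow> real) \<Rightarrow> nat" where
  "symmetric_rank S m T = (LEAST r. \<exists>(c :: nat \<Rightarrow> real) (v :: nat \<Rightarrow> 'a \<Rightarrow> real).
      \<forall>ks. length ks = m \<and> set ks \<subseteq> S \<longrightarrow>
        T ks = (\<Sum>i<r. c i * (\<Prod>j<m. v i (ks ! j))))"

definition form_of :: "nat \<Rightarrow> nat \<Rightarrow> (nat list \<Rightarrow> real) \<Rightarrow> (nat \<Rightarrow> real) \<Rightarrow> real" where
  "form_of d m T x = (\<Sum>ks \<in> {ks. length ks = m \<and> set ks \<subseteq> {1..d}}.
      T ks * (\<Prod>j<m. x (ks ! j)))"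

definition clone :: "nat \<Rightarrow> (nat list \<Rightarrow> real) \<Rightarrow> nat list \<Rightarrow> real" where
  "clone n U ks = U (map (\<lambda>k. if k \<le> 2 * n then 1 else 2) ks)"

definition tpow :: "nat \<Rightarrow> nat \<Rightarrow> (nat \<Rightarrow> real) \<Rightarrow> nat list \<Rightarrow> real" where
  "tpow m d u ks = (if length ks = m \<and> set ks \<subseteq> {1..d} then (\<Prod>j<m. u (ks ! j)) else 0)"

definition alpha :: "nat \<Rightarrow> nat \<Rightarrow> real" where
  "alpha i p = (if p = 2 * i - 1 \<or> p = 2 * i then 1 else 0)"

definition vadd :: "(nat \<Rightarrow> real) \<Rightarrow> (nat \<Rightarrow> real) \<Rightarrow> nat \<Rightarrow> real" where
  "vadd a b = (\<lambda>p. a p + b p)"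

definition vscale :: "real \<Rightarrow> (nat \<Rightarrow> real) \<Rightarrow> nat \<Rightarrow> real" where
  "vscale c a = (\<lambda>p. c * a p)"

definition vzero :: "nat \<Rightarrow> real" where
  "vzero = (\<lambda>p. 0)"

definition cat :: "nat \<Rightarrow> (nat \<Rightarrow> real) \<Rightarrow> (nat \<Rightarrow> real) \<Rightarrow> nat \<Rightarrow> real" where
  "cat n a b p = (if 1 \<le> p \<and> p \<le> 2 * n then a p
                  else if 2 * n < p \<and> p \<le> 4 * n then b (p - 2 * n) else 0)"

abbreviation a2 where "a2 i j \<equiv> vadd (alpha i) (alpha j)"
abbreviation a3 where "a3 i j k \<equiv> vadd (a2 i j) (alpha k)"
abbreviation a4 where "a4 i j k l \<equiv> vadd (a3 i j k) (alpha l)"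

definition Uset :: "nat \<Rightarrow> (nat \<Rightarrow> real) set" where
  "Uset n = (let N = real n in
     {cat n (a4 i1 i2 i3 i4) vzero | i1 i2 i3 i4. 1 \<le> i1 \<and> i1 < i2 \<and> i2 < i3 \<and> i3 < i4 \<and> i4 \<le> n}
   \<union> {cat n (a3 i1 i2 i3) vzero | i1 i2 i3. 1 \<le> i1 \<and> i1 < i2 \<and> i2 < i3 \<and> i3 \<le> n}
   \<union> {cat n (a2 i1 i2) vzero | i1 i2. 1 \<le> i1 \<and> i1 < i2 \<and> i2 \<le> n}
   \<union> {cat n (alpha i1) vzero | i1. 1 \<le> i1 \<and> i1 \<le> n}
   \<union> {cat n (a4 i1 i2 i3 i4) (alpha k1) | i1 i2 i3 i4 k1.
        1 \<le> i1 \<and> i1 < i2 \<and> i2 < i3 \<and> i3 < i4 \<and> i4 \<le> n \<and> 1 \<le> k1 \<and> k1 \<le> n}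
   \<union> {cat n (a2 i1 i2) (vscale ((N - 2)^2 / ((N - 3) * (N - 1))) (alpha k1)) | i1 i2 k1.
        1 \<le> i1 \<and> i1 < i2 \<and> i2 \<le> n \<and> 1 \<le> k1 \<and> k1 \<le> n}
   \<union> {cat n (alpha i1) (vscale ((N - 2) / (N - 3)) (alpha k1)) | i1 k1.
        1 \<le> i1 \<and> i1 \<le> n \<and> 1 \<le> k1 \<and> k1 \<le> n}
   \<union> {cat n (alpha i1) (vscale ((N - 1) / (N - 4)) (alpha k1)) | i1 k1.
        1 \<le> i1 \<and> i1 \<le> n \<and> 1 \<le> k1 \<and> k1 \<le> n}
   \<union> {cat n (a3 i1 i2 i3) (a2 k1 k2) | i1 i2 i3 k1 k2.
        1 \<le> i1 \<and> i1 < i2 \<and> i2 < i3 \<and> i3 \<le> n \<and> 1 \<le> k1 \<and> k1 < k2 \<and> k2 \<le> n}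
   \<union> {cat n (a2 i1 i2) (vscale ((N - 2) / (N - 3)) (a2 k1 k2)) | i1 i2 k1 k2.
        1 \<le> i1 \<and> i1 < i2 \<and> i2 \<le> n \<and> 1 \<le> k1 \<and> k1 < k2 \<and> k2 \<le> n}
   \<union> {cat n (a2 i1 i2) (vscale ((N - 2) / (N - 4)) (alpha k1)) | i1 i2 k1.
        1 \<le> i1 \<and> i1 < i2 \<and> i2 \<le> n \<and> 1 \<le> k1 \<and> k1 \<le> n}
   \<union> {cat n vzero (alpha k1) | k1. 1 \<le> k1 \<and> k1 \<le> n}
   \<union> {cat n (a3 i1 i2 i3) (vscale ((N - 3) / (N - 4)) (alpha k1)) | i1 i2 i3 k1.
        1 \<le> i1 \<and> i1 < i2 \<and> i2 < i3 \<and> i3 \<le> n \<and> 1 \<le> k1 \<and> k1 \<le> n}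
   \<union> {cat n (a3 i1 i2 i3) (vscale ((N - 2) / (N - 1)) (alpha k1)) | i1 i2 i3 k1.
        1 \<le> i1 \<and> i1 < i2 \<and> i2 < i3 \<and> i3 \<le> n \<and> 1 \<le> k1 \<and> k1 \<le> n}
   \<union> {cat n (alpha i1) (vscale ((N - 1) / (N - 3)) (a2 k1 k2)) | i1 k1 k2.
        1 \<le> i1 \<and> i1 \<le> n \<and> 1 \<le> k1 \<and> k1 < k2 \<and> k2 \<le> n}
   \<union> {cat n vzero (a2 k1 k2) | k1 k2. 1 \<le> k1 \<and> k1 < k2 \<and> k2 \<le> n})"

text \<open>pi(a_1..a_2n, b_1..b_2n) = (b_2,...,b_2n,b_1,a_2,...,a_2n,a_1), where
  a_i = u i and b_i = u (2n+i).\<close>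
definition piv :: "nat \<Rightarrow> (nat \<Rightarrow> real) \<Rightarrow> nat \<Rightarrow> real" where
  "piv n u p = (if 1 \<le> p \<and> p \<le> 2 * n - 1 then u (2 * n + p + 1)
               else if p = 2 * n then u (2 * n + 1)
               else if 2 * n < p \<and> p \<le> 4 * n - 1 then u (p - 2 * n + 1)
               else if p = 4 * n then u 1 else 0)"

definition Wset :: "nat \<Rightarrow> (nat list \<Rightarrow> real) set" where
  "Wset n = (\<lambda>u. tpow 5 (4 * n) u) ` Uset n \<union> (\<lambda>u. tpow 5 (4 * n) (piv n u)) ` Uset n"

definition adj_index :: "nat \<Rightarrow> (nat list \<Rightarrow> real) set \<Rightarrow> (nat + (nat list \<Rightarrow> real)) set" where
  "adj_index d W = Inl ` {1..d} \<union> Inr ` W"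

definition SAdj :: "(nat list \<Rightarrow> real) \<Rightarrow> (nat list \<Rightarrow> real) set
                    \<Rightarrow> (nat + (nat list \<Rightarrow> real)) list \<Rightarrow> real" where
  "SAdj Cc W ks =
    (if list_all isl ks then Cc (map projl ks)
     else if length (filter (\<lambda>k. \<not> isl k) ks) = 1
             \<and> projr (hd (filter (\<lambda>k. \<not> isl k) ks)) \<in> W
          then projr (hd (filter (\<lambda>k. \<not> isl k) ks)) (map projl (filter isl ks))
     else 0)"

end

theory Submission
  imports Defs "HOL-Combinatorics.Permutations"
begin

text \<open>
  Call a tensor \<open>x \<otimes>\<^sub>j w\<close> with \<open>w \<in> W\<close> and \<open>x\<close> in slot \<open>j\<close> a modification. Since the elements of \<open>W\<close> are
  linearly independent, the substitution method removes \<open>\<bar>W\<bar>\<close> terms of a decomposition in each of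
  the six slots and leaves a decomposition of \<open>C\<^sub>c\<close> plus modifications. Every element of \<open>W\<close> has a zero
  entry at five indices of one half lying in different pairs, so modifications do not change the entries of
  \<open>X\<^sup>6\<close> and \<open>Y\<^sup>6\<close> at six different pairs, and at least one term is left. One is enough: the
  symmetrisations of \<open>X\<^sup>4 Y\<close>, \<open>X\<^sup>3 Y\<^sup>2\<close>, \<open>X\<^sup>2 Y\<^sup>3\<close>, \<open>X Y\<^sup>4\<close> lie in the span of \<open>W\<close>, hence
  \<open>(X - 3 Y) \<otimes> (X + Y)\<^sup>\<otimes>\<^sup>5\<close> is congruent to \<open>X\<^sup>6 - 3 Y\<^sup>6\<close> modulo modifications.

  A symmetric decomposition with only one surplus term \<open>i\<close> splits the other terms into six bases, and
  the reduced tensor is a product of six factors \<open>X + t\<^sub>j Y\<close>. Antisymmetrising shows that all \<open>t\<^sub>j\<close> but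
  one are equal, to \<open>\<tau>\<close> say, while the product of the \<open>t\<^sub>j\<close> is \<open>-3\<close>. Exchanging \<open>i\<close> with a term of the
  exceptional basis keeps the exceptional factor and changes all others, so that \<open>\<tau>\<close> becomes
  \<open>-3 / \<tau>\<^sup>5\<close>. Iterating gives infinitely many values of \<open>\<tau>\<close>, although there are only finitely many
  partitions.
\<close>

section \<open>Independence of the fifth powers\<close>

text \<open>The 14 positions of a half form a cycle, and \<open>pair_cls\<close> and
  \<open>shift_cls\<close> describe its two perfect matchings. The shift in \<open>\<pi>\<close>
  separates the two families of vectors: a mere swap of the halves would send (0|\<alpha>_k) to
  (\<alpha>_k|0), which belongs to U again. Since the two positions of a class in one matching lie
  in different classes of the other, index tuples can be chosen that suit one family and miss the
  other.

  Seven classes leave room to replace one of six positions in general position by a seventh, which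
  is what makes the reduced factors constant on each half.

  The sign of -3 enters twice: six equal ratios would satisfy \<tau>^6 = -3, and a surplus term
  without any part on W would have the entries 1 and -3 as multiples of sixth powers by one scalar.

  That an exchange changes the common ratio rests on a count. Among 6s + 1 relevant terms, a
  modified row of the form Y - \<tau> X vanishes on at most s + 1, while an unchanged ratio would
  give s + 2 zeros.\<close>

definition pair_cls :: "nat \<Rightarrow> nat" where "pair_cls p = (p + 1) div 2"
text \<open>The entry of \<open>piv\<close> at a position is read one step further along the cycle
  of 14, so this is \<open>pair_cls\<close> of the cyclic successor; position 14 wraps round to
  class 1.\<close>

definition shift_cls :: "nat \<Rightarrow> nat" where "shift_cls p = (p div 2) mod 7 + 1"

text \<open>The sixteen types at n = 7. For 0 < s, one family with k = 1 has the scale (7-s)/3, the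
  family with k = 2 has (7-s)/4, and the other family with k = 1 has 5/6 of the latter. Scales
  linear in s let alternating sums over s cancel for several powers of the scale at once. The factor
  r = 5/6 solves c r = -6 and c r^2 = -5: every k lies in six 2-subsets, and singletons have to
  reduce this weight 6 to 0 for one entry in the half of K and to 1 for two. The types with k = 0 or
  s = 0 correct the entries with all five positions in one half.\<close>

definition types :: "(nat \<times> nat \<times> real) set" where
  "types = {(4,0,1), (3,0,1), (2,0,1), (1,0,1), (4,1,1), (2,1,25/24), (1,1,5/4), (1,1,2),
            (3,2,1), (2,2,5/4), (2,1,5/3), (0,1,1), (3,1,4/3), (3,1,5/6), (1,2,3/2), (0,2,1)}"

definition params :: "(nat set \<times> nat set \<times> real) set" where
  "params = {(S, K, t). S \<subseteq> {1..7} \<and> K \<subseteq> {1..7} \<and> (card S, card K, t) \<in> types}"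

definition cls :: "bool \<Rightarrow> nat \<Rightarrow> nat" where
  "cls b = (if b then shift_cls else pair_cls)"

text \<open>\<open>uvec False (S, K, t)\<close> is \<open>(\<Sum>\<^sub>i\<^sub>\<in>\<^sub>S \<alpha>\<^sub>i | t \<Sum>\<^sub>k\<^sub>\<in>\<^sub>K \<alpha>\<^sub>k)\<close> and \<open>uvec True (S, K, t)\<close> its image under
  \<open>\<pi>\<close>. The maps \<open>pos1 b\<close> and \<open>pos2 b\<close> place \<open>{1..14}\<close> on the half carrying \<open>S\<close> and \<open>K\<close>, respectively.\<close>

fun uvec :: "bool \<Rightarrow> nat set \<times> nat set \<times> real \<Rightarrow> nat \<Rightarrow> real" where
  "uvec b (S, K, t) p =
     (if 1 \<le> p \<and> p \<le> 14 then (if b then t * of_bool (cls b p \<in> K) else of_bool (cls b p \<in> S))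
      else if 15 \<le> p \<and> p \<le> 28 then
        (if b then of_bool (cls b (p - 14) \<in> S) else t * of_bool (cls b (p - 14) \<in> K))
      else 0)"

declare uvec.simps [simp del]

definition pos1 :: "bool \<Rightarrow> nat \<Rightarrow> nat" where "pos1 b p = (if b then p + 14 else p)"
definition pos2 :: "bool \<Rightarrow> nat \<Rightarrow> nat" where "pos2 b p = (if b then p else p + 14)"

lemma uvec_own:
  assumes "p \<in> {1..14}"
  shows "uvec b (S, K, t) (pos1 b p) = of_bool (cls b p \<in> S)"
    and "uvec b (S, K, t) (pos2 b p) = t * of_bool (cls b p \<in> K)"
  using assms by (auto simp: uvec.simps pos1_def pos2_def)

lemma uvec_other:
  assumes "p \<in> {1..14}"
  shows "uvec (\<not> b) (S, K, t) (pos1 b p) = t * of_bool (cls (\<not> b) p \<in> K)"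
    and "uvec (\<not> b) (S, K, t) (pos2 b p) = of_bool (cls (\<not> b) p \<in> S)"
  using assms by (auto simp: uvec.simps pos1_def pos2_def)

lemma types_bounds:
  assumes "(s, k, t) \<in> types"
  shows "0 < t" "s \<le> 4" "k \<le> 2" "s + k \<le> 5" "0 < s + k" "s + k = 5 \<Longrightarrow> 3 \<le> s"
  using assms by (auto simp: types_def)

lemma prod_list_eq_0_real: "prod_list (xs :: real list) = 0 \<longleftrightarrow> 0 \<in> set xs"
  by (induction xs) auto

lemma uvec_own_prod:
  assumes "set L1 \<subseteq> {1..14}" "set L2 \<subseteq> {1..14}" "cls b ` set L1 \<subseteq> S" "cls b ` set L2 \<subseteq> K"
  shows "prod_list (map (uvec b (S, K, t)) (map (pos1 b) L1 @ map (pos2 b) L2)) = t ^ length L2"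
proof -
  have 1: "prod_list (map (uvec b (S, K, t)) (map (pos1 b) L1)) = 1"
    using assms(1,3) by (induction L1) (auto simp: uvec_own)
  have 2: "prod_list (map (uvec b (S, K, t)) (map (pos2 b) L2)) = t ^ length L2"
    using assms(2,4) by (induction L2) (auto simp: uvec_own)
  show ?thesis using 1 2 by (simp del: map_map)
qed

lemma uvec_own_prod_0:
  assumes "set L1 \<subseteq> {1..14}" "set L2 \<subseteq> {1..14}"
    "\<not> (cls b ` set L1 \<subseteq> S \<and> cls b ` set L2 \<subseteq> K)"
  shows "prod_list (map (uvec b (S, K, t)) (map (pos1 b) L1 @ map (pos2 b) L2)) = 0"
proof -
  have "0 \<in> uvec b (S, K, t) ` pos1 b ` set L1 \<or> 0 \<in> uvec b (S, K, t) ` pos2 b ` set L2"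
    using assms by (force simp: uvec_own image_iff subset_iff)
  then show ?thesis by (auto simp: prod_list_eq_0_real image_image)
qed

lemma uvec_other_prod_0:
  assumes "set L1 \<subseteq> {1..14}" "set L2 \<subseteq> {1..14}"
    "\<not> (cls (\<not> b) ` set L1 \<subseteq> K \<and> cls (\<not> b) ` set L2 \<subseteq> S)"
  shows "prod_list (map (uvec (\<not> b) (S, K, t)) (map (pos1 b) L1 @ map (pos2 b) L2)) = 0"
proof -
  have "0 \<in> uvec (\<not> b) (S, K, t) ` pos1 b ` set L1 \<or> 0 \<in> uvec (\<not> b) (S, K, t) ` pos2 b ` set L2"
    using assms by (force simp: uvec_other image_iff subset_iff)
  then show ?thesis by (auto simp: prod_list_eq_0_real image_image)
qed

lemma finite_types: "finite types"
  by (simp add: types_def)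

lemma finite_params: "finite params"
proof (rule finite_subset)
  show "params \<subseteq> Pow {1..7} \<times> Pow {1..7} \<times> (\<lambda>(s, k, t). t) ` types"
    by (force simp: params_def)
  show "finite (Pow {1..7::nat} \<times> Pow {1..7::nat} \<times> (\<lambda>(s, k, t). t) ` types)"
    by (simp add: finite_types)
qed

definition scales :: "nat \<Rightarrow> nat \<Rightarrow> real set" where
  "scales s k = {t. (s, k, t) \<in> types}"

definition level :: "nat set \<times> nat set \<times> real \<Rightarrow> nat" where
  "level P = card (fst P) + card (fst (snd P))"

text \<open>The relation is evaluated at a tuple whose classes on the two halves are exactly S and
  K. A vector of the same orientation survives only if its sets contain S and K, and at maximal
  level this forces equality, so only the scales remain to be separated. The opposite orientation
  reads the halves with exchanged roles; \<open>oth\<close> says that it contributes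
  nothing.\<close>

lemma support_relation:
  fixes x :: "(nat set \<times> nat set \<times> real) \<times> bool \<Rightarrow> real"
  assumes rel: "\<And>ks. \<lbrakk>length ks = 5; set ks \<subseteq> {1..28}\<rbrakk> \<Longrightarrow>
      (\<Sum>q\<in>params \<times> UNIV. x q * prod_list (map (uvec (snd q) (fst q)) ks)) = 0"
    and max: "\<And>q. \<lbrakk>q \<in> params \<times> UNIV; x q \<noteq> 0\<rbrakk> \<Longrightarrow> level (fst q) \<le> card S + card K"
    and S: "S \<subseteq> {1..7}" and K: "K \<subseteq> {1..7}"
    and L: "set L1 \<subseteq> {1..14}" "set L2 \<subseteq> {1..14}" "length L1 + length L2 = 5"
    and cl: "cls b ` set L1 = S" "cls b ` set L2 = K"
    and oth: "\<And>S' K' t'. \<lbrakk>(S', K', t') \<in> params; card S' + card K' \<le> card S + card K\<rbrakk> \<Longrightarrow>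
       \<not> (cls (\<not> b) ` set L1 \<subseteq> K' \<and> cls (\<not> b) ` set L2 \<subseteq> S')"
  shows "(\<Sum>t\<in>scales (card S) (card K). x ((S, K, t), b) * t ^ length L2) = 0"
proof -
  let ?ks = "map (pos1 b) L1 @ map (pos2 b) L2"
  let ?f = "\<lambda>q. x q * prod_list (map (uvec (snd q) (fst q)) ?ks)"
  let ?A = "(\<lambda>t. ((S, K, t), b)) ` scales (card S) (card K)"
  have fin: "finite S" "finite K" using S K finite_subset by auto
  have "set ?ks \<subseteq> {1..28}"
    using L by (force simp: pos1_def pos2_def)
  then have "sum ?f (params \<times> UNIV) = 0" using L by (intro rel) auto
  also have "sum ?f (params \<times> UNIV) = sum ?f ?A"
  proof (rule sum.mono_neutral_right)
    show "finite (params \<times> (UNIV :: bool set))" by (simp add: finite_params)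
    show "?A \<subseteq> params \<times> UNIV" using S K by (auto simp: params_def scales_def)
    show "\<forall>q\<in>params \<times> UNIV - ?A. ?f q = 0"
    proof
      fix q assume q: "q \<in> params \<times> UNIV - ?A"
      obtain S' K' t' b' where qe: "q = ((S', K', t'), b')" by (metis surj_pair)
      have par: "(S', K', t') \<in> params" using q qe by auto
      have fin': "finite S'" "finite K'" using par finite_subset by (auto simp: params_def)
      show "?f q = 0"
      proof (cases "x q = 0")
        case False
        with max[of q] q qe have lev: "card S' + card K' \<le> card S + card K" by (auto simp: level_def)
        show ?thesis
        proof (cases "b' = b")
          case True
          have "\<not> (S \<subseteq> S' \<and> K \<subseteq> K')"
          proof
            assume sub: "S \<subseteq> S' \<and> K \<subseteq> K'"
            then have "card S \<le> card S'" "card K \<le> card K'" using fin' card_mono by auto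
            with lev have "card S = card S'" "card K = card K'" by auto
            with sub fin' have "S = S'" "K = K'" using card_subset_eq by metis+
            with q qe True par show False by (auto simp: scales_def params_def)
          qed
          then have "prod_list (map (uvec b (S', K', t')) ?ks) = 0"
            using uvec_own_prod_0[OF L(1,2), of b S' K' t'] cl by auto
          then show ?thesis by (simp add: qe True del: map_append)
        next
          case False
          then have "b' = (\<not> b)" by auto
          moreover have "prod_list (map (uvec (\<not> b) (S', K', t')) ?ks) = 0"
            using uvec_other_prod_0[OF L(1,2) oth[OF par lev]] by blast
          ultimately show ?thesis by (simp add: qe del: map_append)
        qed
      qed simp
    qed
  qed
  also have "\<dots> = (\<Sum>t\<in>scales (card S) (card K). x ((S, K, t), b) * t ^ length L2)"
    using uvec_own_prod[OF L(1,2), of b S K] cl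
    by (subst sum.reindex) (auto simp: inj_on_def simp del: map_append intro!: sum.cong)
  finally show ?thesis by simp
qed

lemma atLeastAtMost_1_7: "{1..7::nat} = {1, 2, 3, 4, 5, 6, 7}"
  by auto

text \<open>The two positions of a class of one matching lie in two cyclically consecutive classes
  of the other. Taking the same side for every class makes the opposite class an injective function
  of \<open>i\<close>.\<close>

lemma cls_section:
  assumes "i \<in> {1..7}"
  shows "\<exists>p\<in>{1..14}. cls b p = i \<and> cls (\<not> b) p = (if b then i else i mod 7 + 1)"
proof (cases b)
  case True
  show ?thesis using True assms
    by (intro bexI[of _ "2 * i - 1"])
      (auto simp: cls_def shift_cls_def pair_cls_def atLeastAtMost_1_7)
next
  case False
  show ?thesis using False assms
    by (intro bexI[of _ "2 * i"]) (auto simp: cls_def shift_cls_def pair_cls_def)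
qed

lemma plain_list:
  assumes "A \<subseteq> {1..7}"
  shows "\<exists>L. set L \<subseteq> {1..14} \<and> cls b ` set L = A \<and> length L = card A \<and>
     cls (\<not> b) ` set L = (\<lambda>i. if b then i else i mod 7 + 1) ` A"
proof -
  have "\<forall>i\<in>{1..7}. \<exists>p. p \<in> {1..14} \<and> cls b p = i \<and>
      cls (\<not> b) p = (if b then i else i mod 7 + 1)"
    using cls_section by blast
  from bchoice[OF this] obtain f where f: "\<forall>i\<in>{1..7}. f i \<in> {1..14} \<and> cls b (f i) = i \<and>
      cls (\<not> b) (f i) = (if b then i else i mod 7 + 1)" ..
  have fin: "finite A" using assms finite_subset by auto
  define L where "L = map f (sorted_list_of_set A)"
  have "set L = f ` A" by (simp add: L_def fin)
  moreover have "length L = card A" by (simp add: L_def)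
  moreover have "cls b ` f ` A = A" using f assms by (force simp: image_iff)
  moreover have "cls (\<not> b) ` f ` A = (\<lambda>i. if b then i else i mod 7 + 1) ` A"
    unfolding image_image using f assms by (intro image_cong) auto
  moreover have "f ` A \<subseteq> {1..14}" using f assms by blast
  ultimately show ?thesis by metis
qed

lemma inj_rotate: "inj_on (\<lambda>i. if b then i else i mod 7 + 1) {1..7::nat}"
  unfolding atLeastAtMost_1_7 by simp

lemma card_rotate:
  assumes "A \<subseteq> {1..7::nat}"
  shows "card ((\<lambda>i. if b then i else i mod 7 + 1) ` A) = card A"
  by (rule card_image) (rule inj_on_subset[OF inj_rotate assms])

text \<open>A nonempty set closed under cyclic predecessors is all of \<open>{1..7}\<close>.\<close>

lemma cyclic_gap:
  assumes "A \<subseteq> {1..7::nat}" "A \<noteq> {}" "card A < 7"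
  shows "\<exists>j\<in>{1..7}. j \<notin> A \<and> j mod 7 + 1 \<in> A"
proof (rule ccontr)
  assume "\<not> ?thesis"
  then have *: "\<And>j. j \<in> {1..7} \<Longrightarrow> j mod 7 + 1 \<in> A \<Longrightarrow> j \<in> A" by blast
  have "2 \<in> A \<Longrightarrow> 1 \<in> A" using *[of 1] by (simp add: numeral_2_eq_2)
  moreover have "3 \<in> A \<Longrightarrow> 2 \<in> A" "4 \<in> A \<Longrightarrow> 3 \<in> A" "5 \<in> A \<Longrightarrow> 4 \<in> A"
    "6 \<in> A \<Longrightarrow> 5 \<in> A" "7 \<in> A \<Longrightarrow> 6 \<in> A" "1 \<in> A \<Longrightarrow> 7 \<in> A"
    using *[of 2] *[of 3] *[of 4] *[of 5] *[of 6] *[of 7] by simp_all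
  moreover note imp = calculation
  obtain a where a: "a \<in> A" using assms by auto
  then have "a \<in> {1..7}" using assms by auto
  then have "a = 1 \<or> a = 2 \<or> a = 3 \<or> a = 4 \<or> a = 5 \<or> a = 6 \<or> a = 7" by auto
  then have "1 \<in> A \<and> 2 \<in> A \<and> 3 \<in> A \<and> 4 \<in> A \<and> 5 \<in> A \<and> 6 \<in> A \<and> 7 \<in> A"
    using a imp by metis
  then have "{1..7} \<subseteq> A" unfolding atLeastAtMost_1_7 by simp
  then have "card {1..7::nat} \<le> card A" using assms(1) by (intro card_mono) (auto intro: finite_subset)
  then show False using assms(3) by simp
qed

text \<open>At a gap of the cycle, the second position of a class already present lies in a new
  class of the opposite matching. Padding with it lengthens the list without changing its own
  classes, yet the opposite orientation now has to cover one class more than the maximal level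
  allows.\<close>

lemma padded_list:
  assumes A: "A \<subseteq> {1..7}" "A \<noteq> {}" "card A < 7" and m: "0 < m"
  shows "\<exists>L. set L \<subseteq> {1..14} \<and> cls b ` set L = A \<and> length L = card A + m \<and>
     card (cls (\<not> b) ` set L) = card A + 1"
proof -
  let ?r = "\<lambda>i::nat. if b then i else i mod 7 + 1"
  obtain L where L: "set L \<subseteq> {1..14}" "cls b ` set L = A" "length L = card A"
    "cls (\<not> b) ` set L = ?r ` A"
    using plain_list[OF A(1)] by blast
  obtain j where j: "j \<in> {1..7}" "j \<notin> A" "j mod 7 + 1 \<in> A" using cyclic_gap[OF A] by blast
  define q where "q = (if b then 2 * j else if j = 7 then 1 else 2 * j + 1)"
  have q: "q \<in> {1..14}" "cls b q = j mod 7 + 1" "cls (\<not> b) q = ?r j"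
    using j(1) by (auto simp: q_def cls_def shift_cls_def pair_cls_def atLeastAtMost_1_7)
  let ?L = "L @ replicate m q"
  have "cls (\<not> b) ` set ?L = ?r ` insert j A" using L q m by auto
  then have "card (cls (\<not> b) ` set ?L) = card (insert j A)"
    using card_rotate[of "insert j A" b] j A by auto
  also have "\<dots> = card A + 1" using j A finite_subset by (subst card_insert_disjoint) auto
  finally show ?thesis
    using L q m j by (intro exI[of _ ?L]) auto
qed

text \<open>Two scales compete only where both sets are nonempty and the level is below five, which
  is exactly where the padding may be placed on either half.\<close>

lemma scales_cases:
  assumes "t \<in> scales s k"
  shows "scales s k = {t} \<or>
    (0 < s \<and> 0 < k \<and> s + k < 5 \<and> (\<exists>t'. t' \<noteq> t \<and> 0 < t' \<and> scales s k = {t, t'}))"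
proof -
  have two: "scales 3 1 = {4/3, 5/6}" "scales 2 1 = {25/24, 5/3}" "scales 1 1 = {5/4, 2}"
    by (auto simp: scales_def types_def)
  consider "(s, k) \<notin> {(3,1),(2,1),(1,1)}" | "s = 3" "k = 1" | "s = 2" "k = 1" | "s = 1" "k = 1" by blast
  then show ?thesis
  proof cases
    case 1
    then show ?thesis using assms by (auto simp: scales_def types_def)
  qed (use assms in \<open>simp_all only: two insert_iff empty_iff simp_thms, auto intro: exI[of _ "4/3"] exI[of _ "5/6"] exI[of _ "25/24"] exI[of _ "5/3"] exI[of _ "5/4"] exI[of _ 2]\<close>)
qed

text \<open>Take a nonzero coefficient of maximal level. Below level five, padding on the half of S
  leaves the exponent \<open>card K\<close> for the scale, and padding on the half of K raises it to
  \<open>5 - card S\<close>; together the two relations separate two positive scales. At level five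
  there is neither room for padding nor a second scale.\<close>

lemma uvec_powers_independent:
  fixes x :: "(nat set \<times> nat set \<times> real) \<times> bool \<Rightarrow> real"
  assumes rel: "\<And>ks. \<lbrakk>length ks = 5; set ks \<subseteq> {1..28}\<rbrakk> \<Longrightarrow>
      (\<Sum>q\<in>params \<times> UNIV. x q * prod_list (map (uvec (snd q) (fst q)) ks)) = 0"
    and q0: "q0 \<in> params \<times> UNIV"
  shows "x q0 = 0"
proof (rule ccontr)
  assume "x q0 \<noteq> 0"
  let ?Z = "{q \<in> params \<times> UNIV. x q \<noteq> 0}"
  have "finite ?Z" by (simp add: finite_params)
  moreover have "?Z \<noteq> {}" using \<open>x q0 \<noteq> 0\<close> q0 by blast
  ultimately have "Max ((\<lambda>q. level (fst q)) ` ?Z) \<in> (\<lambda>q. level (fst q)) ` ?Z"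
    by (intro Max_in) auto
  then obtain q where q: "q \<in> ?Z" "level (fst q) = Max ((\<lambda>q. level (fst q)) ` ?Z)"
    by (metis (no_types, lifting) imageE)
  have q_max: "level (fst q') \<le> level (fst q)" if "q' \<in> ?Z" for q'
    unfolding q(2) using that \<open>finite ?Z\<close> by (intro Max_ge finite_imageI imageI)
  obtain S K t b where qe: "q = ((S, K, t), b)" by (metis surj_pair)
  have par: "(S, K, t) \<in> params" using q qe by auto
  then have S: "S \<subseteq> {1..7}" and K: "K \<subseteq> {1..7}" and ty: "(card S, card K, t) \<in> types"
    by (auto simp: params_def)
  have fin: "finite S" "finite K" using S K finite_subset by auto
  have max: "\<And>q'. \<lbrakk>q' \<in> params \<times> UNIV; x q' \<noteq> 0\<rbrakk> \<Longrightarrow> level (fst q') \<le> card S + card K"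
    using q_max qe by (auto simp: level_def)
  note bd = types_bounds[OF ty]
  have red: "(\<Sum>t\<in>scales (card S) (card K). x ((S, K, t), b) * t ^ length L2) = 0"
    if "set L1 \<subseteq> {1..14}" "set L2 \<subseteq> {1..14}" "length L1 + length L2 = 5"
      "cls b ` set L1 = S" "cls b ` set L2 = K"
      "\<And>S' K' t'. \<lbrakk>(S', K', t') \<in> params; card S' + card K' \<le> card S + card K\<rbrakk> \<Longrightarrow>
         \<not> (cls (\<not> b) ` set L1 \<subseteq> K' \<and> cls (\<not> b) ` set L2 \<subseteq> S')" for L1 L2
    by (rule support_relation[OF _ _ S K that]) (use rel max in blast)+
  have tS: "t \<in> scales (card S) (card K)" using ty by (simp add: scales_def)
  have xt: "x ((S, K, t), b) \<noteq> 0" using q qe by auto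
  obtain L1 where L1: "set L1 \<subseteq> {1..14}" "cls b ` set L1 = S" "length L1 = card S"
    "cls (\<not> b) ` set L1 = (\<lambda>i. if b then i else i mod 7 + 1) ` S"
    using plain_list[OF S] by blast
  obtain L2 where L2: "set L2 \<subseteq> {1..14}" "cls b ` set L2 = K" "length L2 = card K"
    "cls (\<not> b) ` set L2 = (\<lambda>i. if b then i else i mod 7 + 1) ` K"
    using plain_list[OF K] by blast
  have c1: "card (cls (\<not> b) ` set L1) = card S" using card_rotate[OF S] L1 by simp
  have c2: "card (cls (\<not> b) ` set L2) = card K" using card_rotate[OF K] L2 by simp
  have larger: "\<not> (A \<subseteq> K' \<and> B \<subseteq> S')"
    if "(S', K', t') \<in> params" "card S' + card K' \<le> card S + card K"
      "card A + card B = card S + card K + 1" for S' K' t' and A B :: "nat set"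
  proof
    assume "A \<subseteq> K' \<and> B \<subseteq> S'"
    moreover have "finite S'" "finite K'" using that finite_subset by (auto simp: params_def)
    ultimately have "card A \<le> card K'" "card B \<le> card S'" by (auto intro: card_mono)
    then show False using that by simp
  qed
  have bS: "(\<Sum>t\<in>scales (card S) (card K). x ((S, K, t), b) * t ^ card K) = 0"
    if hyp: "S \<noteq> {}" "card S + card K < 5"
  proof -
    obtain L where L: "set L \<subseteq> {1..14}" "cls b ` set L = S"
      "length L = card S + (5 - card S - card K)" "card (cls (\<not> b) ` set L) = card S + 1"
      using padded_list[OF S hyp(1), of "5 - card S - card K" b] bd hyp by auto
    have "length L + length L2 = 5" using L L2 hyp by auto
    moreover have "card (cls (\<not> b) ` set L) + card (cls (\<not> b) ` set L2) = card S + card K + 1"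
      using L(4) c2 by simp
    ultimately show ?thesis using red[OF L(1) L2(1) _ L(2) L2(2)] larger L2(3) by metis
  qed
  have bK: "(\<Sum>t\<in>scales (card S) (card K). x ((S, K, t), b) * t ^ (5 - card S)) = 0"
    if hyp: "K \<noteq> {}" "card S + card K < 5"
  proof -
    obtain L where L: "set L \<subseteq> {1..14}" "cls b ` set L = K"
      "length L = card K + (5 - card S - card K)" "card (cls (\<not> b) ` set L) = card K + 1"
      using padded_list[OF K hyp(1), of "5 - card S - card K" b] bd hyp by auto
    have "length L1 + length L = 5" using L L1 hyp by auto
    moreover have "card (cls (\<not> b) ` set L1) + card (cls (\<not> b) ` set L) = card S + card K + 1"
      using L(4) c1 by simp
    moreover have "length L = 5 - card S" using L(3) hyp by simp
    ultimately show ?thesis using red[OF L1(1) L(1) _ L1(2) L(2)] larger by metis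
  qed
  show False
  proof (cases "card S + card K = 5")
    case True
    have "length L1 + length L2 = 5" using True L1 L2 by simp
    \<comment> \<open>The classes coming from S number at least three, but in the opposite
      orientation they would have to fit into K', which has at most two elements.\<close>
    have nsub: "\<not> (cls (\<not> b) ` set L1 \<subseteq> K' \<and> cls (\<not> b) ` set L2 \<subseteq> S')"
      if "(S', K', t') \<in> params" for S' K' t'
    proof
      assume "cls (\<not> b) ` set L1 \<subseteq> K' \<and> cls (\<not> b) ` set L2 \<subseteq> S'"
      moreover have "finite K'" using that finite_subset by (auto simp: params_def)
      ultimately have "card S \<le> card K'" using c1 card_mono by metis
      moreover have "card K' \<le> 2" using that types_bounds by (auto simp: params_def)
      ultimately show False using bd True by simp
    qed
    have "(\<Sum>t\<in>scales (card S) (card K). x ((S, K, t), b) * t ^ length L2) = 0"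
      by (rule red[OF L1(1) L2(1) \<open>length L1 + length L2 = 5\<close> L1(2) L2(2)]) (rule nsub)
    moreover have "scales (card S) (card K) = {t}" using scales_cases[OF tS] True by auto
    ultimately show False using xt bd by simp
  next
    case False
    then have lt: "card S + card K < 5" using bd by simp
    from scales_cases[OF tS] show False
    proof (elim disjE conjE exE)
      assume 1: "scales (card S) (card K) = {t}"
      show False
      proof (cases "S = {}")
        case True
        then have "K \<noteq> {}" using bd by auto
        from bK[OF this lt] show False using 1 xt bd by simp
      next
        case False
        from bS[OF this lt] show False using 1 xt bd by simp
      qed
    next
      fix t' assume t': "t' \<noteq> t" "0 < t'" "scales (card S) (card K) = {t, t'}"
        and pos: "0 < card S" "0 < card K"
      then have ne: "S \<noteq> {}" "K \<noteq> {}" by auto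
      let ?a = "x ((S, K, t), b)" and ?b = "x ((S, K, t'), b)"
      define m where "m = 5 - card S - card K"
      have m: "5 - card S = card K + m" "0 < m" using lt by (auto simp: m_def)
      have e1: "?a * t ^ card K + ?b * t' ^ card K = 0" using bS[OF ne(1) lt] t' by simp
      have e2: "?a * t ^ card K * t ^ m + ?b * t' ^ card K * t' ^ m = 0"
        using bK[OF ne(2) lt] t' by (simp add: m power_add mult.assoc)
      have "?b * t' ^ card K = - (?a * t ^ card K)" using e1 by linarith
      then have "?a * t ^ card K * (t ^ m - t' ^ m) = 0" using e2 by (simp add: algebra_simps)
      then have "t ^ m = t' ^ m" using xt bd by simp
      then have "t = t'" using power_eq_imp_eq_base[of t m t'] bd t' m by simp
      then show False using t' by simp
    qed
  qed
qed

section \<open>The substitution method\<close>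

lemma minimal_subset:
  assumes "finite B" "D B"
  shows "\<exists>B'\<subseteq>B. D B' \<and> (\<forall>B''. B'' \<subset> B' \<longrightarrow> \<not> D B'')"
  using assms
proof (induction B rule: finite_psubset_induct)
  case (psubset B)
  show ?case
  proof (cases "\<exists>B'. B' \<subset> B \<and> D B'")
    case True
    then show ?thesis using psubset.IH by (meson psubset_imp_subset subset_trans)
  next
    case False
    then show ?thesis using psubset.prems by blast
  qed
qed

text \<open>In a minimal subset with the required property, every \<open>b\<close> has an x that
  vanishes on the other members and violates P, hence is nonzero at \<open>b\<close>. Scaled, these
  x form a dual family, which interpolates any values. P stays arbitrary because two instances are
  needed: that x vanishes on W, and that its form vanishes on a given set of terms.\<close>

lemma interpolating_subset:
  fixes m :: "'i \<Rightarrow> 'w \<Rightarrow> real"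
  assumes "finite B" "\<forall>x. (\<forall>i\<in>B. (\<Sum>w\<in>W. x w * m i w) = 0) \<longrightarrow> P x"
  shows "\<exists>B'\<subseteq>B. (\<forall>x. (\<forall>i\<in>B'. (\<Sum>w\<in>W. x w * m i w) = 0) \<longrightarrow> P x) \<and>
           (\<forall>g. \<exists>x. \<forall>i\<in>B'. (\<Sum>w\<in>W. x w * m i w) = g i)"
proof -
  define M where "M x i = (\<Sum>w\<in>W. x w * m i w)" for x i
  define D where "D B \<longleftrightarrow> (\<forall>x. (\<forall>i\<in>B. M x i = 0) \<longrightarrow> P x)" for B
  have "D B" using assms(2) by (simp add: D_def M_def)
  from minimal_subset[of B D, OF assms(1) this] obtain B' where
    B': "B' \<subseteq> B" "D B'" "\<And>B''. B'' \<subset> B' \<Longrightarrow> \<not> D B''" by blast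
  have fin: "finite B'" using B' assms(1) finite_subset by blast
  have "\<exists>x. M x b = 1 \<and> (\<forall>i\<in>B' - {b}. M x i = 0)" if "b \<in> B'" for b
  proof -
    have "B' - {b} \<subset> B'" using that by blast
    from B'(3)[OF this] obtain x where x: "\<forall>i\<in>B' - {b}. M x i = 0" "\<not> P x"
      unfolding D_def by blast
    have nz: "M x b \<noteq> 0"
    proof
      assume "M x b = 0"
      then have "\<forall>i\<in>B'. M x i = 0" using x(1) by blast
      then show False using B'(2) x(2) by (simp add: D_def)
    qed
    have eq: "M (\<lambda>w. x w / M x b) i = M x i / M x b" for i
      unfolding M_def by (simp add: sum_divide_distrib)
    show ?thesis using x(1) nz by (intro exI[of _ "\<lambda>w. x w / M x b"]) (simp add: eq)
  qed
  then have "\<forall>b\<in>B'. \<exists>x. M x b = 1 \<and> (\<forall>i\<in>B' - {b}. M x i = 0)" by blast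
  from bchoice[OF this] obtain d where
    d: "\<forall>b\<in>B'. M (d b) b = 1 \<and> (\<forall>i\<in>B' - {b}. M (d b) i = 0)" ..
  have "\<exists>x. \<forall>i\<in>B'. M x i = g i" for g :: "'i \<Rightarrow> real"
  proof (intro exI ballI)
    fix i assume i: "i \<in> B'"
    have "M (\<lambda>w. \<Sum>b\<in>B'. g b * d b w) i = (\<Sum>b\<in>B'. g b * M (d b) i)"
      unfolding M_def sum_distrib_left sum_distrib_right mult.assoc by (rule sum.swap)
    also have "\<dots> = (\<Sum>b\<in>B'. if b = i then g b else 0)"
      using d i by (intro sum.cong) auto
    also have "\<dots> = g i" using i fin by simp
    finally show "M (\<lambda>w. \<Sum>b\<in>B'. g b * d b w) i = g i" .
  qed
  then show ?thesis using B'(1,2) unfolding D_def M_def by (intro exI[of _ B']) simp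
qed

text \<open>The trace of the two-sided inverse counts both index sets.\<close>

lemma card_interpolating:
  fixes m :: "'i \<Rightarrow> 'w \<Rightarrow> real"
  assumes fin: "finite B" "finite W"
    and inj: "\<forall>x. (\<forall>i\<in>B. (\<Sum>w\<in>W. x w * m i w) = 0) \<longrightarrow> (\<forall>w\<in>W. x w = 0)"
    and intp: "\<forall>g. \<exists>x. \<forall>i\<in>B. (\<Sum>w\<in>W. x w * m i w) = g i"
  shows "card B = card W"
proof -
  define M where "M x i = (\<Sum>w\<in>W. x w * m i w)" for x i
  have "\<forall>b. \<exists>x. \<forall>i\<in>B. M x i = of_bool (i = b)" unfolding M_def using intp by simp
  from choice[OF this] obtain d where "\<forall>b. \<forall>i\<in>B. M (d b) i = of_bool (i = b)" ..
  then have d: "\<And>b i. i \<in> B \<Longrightarrow> M (d b) i = of_bool (i = b)" by blast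
  have diag: "(\<Sum>b\<in>B. m b w * d b w) = 1" if w: "w \<in> W" for w
  proof -
    define x where "x = (\<lambda>w'. of_bool (w' = w) - (\<Sum>b\<in>B. m b w * d b w'))"
    have "M x i = 0" if i: "i \<in> B" for i
    proof -
      have "M x i = (\<Sum>w'\<in>W. of_bool (w' = w) * m i w') - (\<Sum>w'\<in>W. (\<Sum>b\<in>B. m b w * d b w') * m i w')"
        by (simp add: M_def x_def left_diff_distrib sum_subtractf)
      also have "(\<Sum>w'\<in>W. of_bool (w' = w) * m i w') = (\<Sum>w'\<in>W. if w' = w then m i w' else 0)"
        by (intro sum.cong) auto
      also have "\<dots> = m i w" using w fin by simp
      also have "(\<Sum>w'\<in>W. (\<Sum>b\<in>B. m b w * d b w') * m i w') = (\<Sum>b\<in>B. m b w * M (d b) i)"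
        unfolding M_def sum_distrib_left sum_distrib_right mult.assoc by (rule sum.swap)
      also have "\<dots> = (\<Sum>b\<in>B. if b = i then m b w else 0)" using i d by (intro sum.cong) auto
      also have "\<dots> = m i w" using i fin by simp
      finally show ?thesis by simp
    qed
    then have "x w = 0" using inj w by (simp add: M_def)
    then show ?thesis by (simp add: x_def)
  qed
  have "real (card W) = (\<Sum>w\<in>W. \<Sum>b\<in>B. m b w * d b w)" using diag by simp
  also have "\<dots> = (\<Sum>b\<in>B. \<Sum>w\<in>W. m b w * d b w)" by (rule sum.swap)
  also have "\<dots> = (\<Sum>b\<in>B. M (d b) b)" by (simp only: M_def mult.commute)
  also have "\<dots> = real (card B)" by (simp add: d)
  finally show ?thesis by simp
qed

lemma card_injective_ge:
  fixes m :: "'i \<Rightarrow> 'w \<Rightarrow> real"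
  assumes "finite B" "finite W" "\<forall>x. (\<forall>i\<in>B. (\<Sum>w\<in>W. x w * m i w) = 0) \<longrightarrow> (\<forall>w\<in>W. x w = 0)"
  shows "card W \<le> card B"
proof -
  from interpolating_subset[where W = W and m = m and P = "\<lambda>x. \<forall>w\<in>W. x w = 0", OF assms(1,3)]
  obtain B' where B': "B' \<subseteq> B"
    "\<forall>x. (\<forall>i\<in>B'. (\<Sum>w\<in>W. x w * m i w) = 0) \<longrightarrow> (\<forall>w\<in>W. x w = 0)"
    "\<forall>g. \<exists>x. \<forall>i\<in>B'. (\<Sum>w\<in>W. x w * m i w) = g i" by (elim exE conjE)
  have "card B' = card W"
    by (rule card_interpolating[OF finite_subset[OF B'(1) assms(1)] assms(2) B'(2,3)])
  then show ?thesis using card_mono[OF assms(1) B'(1)] by simp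
qed

lemma interpolate_basis:
  fixes m :: "'i \<Rightarrow> 'w \<Rightarrow> real"
  assumes "finite B" "finite W" "\<forall>x. (\<forall>i\<in>B. (\<Sum>w\<in>W. x w * m i w) = 0) \<longrightarrow> (\<forall>w\<in>W. x w = 0)"
    "card B = card W"
  shows "\<exists>x. \<forall>i\<in>B. (\<Sum>w\<in>W. x w * m i w) = g i"
proof -
  from interpolating_subset[where W = W and m = m and P = "\<lambda>x. \<forall>w\<in>W. x w = 0", OF assms(1,3)]
  obtain B' where B': "B' \<subseteq> B"
    "\<forall>x. (\<forall>i\<in>B'. (\<Sum>w\<in>W. x w * m i w) = 0) \<longrightarrow> (\<forall>w\<in>W. x w = 0)"
    "\<forall>g. \<exists>x. \<forall>i\<in>B'. (\<Sum>w\<in>W. x w * m i w) = g i" by (elim exE conjE)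
  have "card B' = card W"
    by (rule card_interpolating[OF finite_subset[OF B'(1) assms(1)] assms(2) B'(2,3)])
  then have "B' = B" using card_subset_eq[OF assms(1) B'(1)] assms(4) by simp
  then show ?thesis using B'(3) by simp
qed

lemma greedy_disjoint:
  assumes "\<And>h B. \<lbrakk>h < n; \<And>j. j < h \<Longrightarrow> good j (B j)\<rbrakk> \<Longrightarrow> \<exists>B'. B' \<subseteq> Q - (\<Union>j<h. B j) \<and> good h B'"
  shows "\<exists>B. (\<forall>j<(n::nat). B j \<subseteq> Q \<and> good j (B j)) \<and> (\<forall>j<n. \<forall>h<n. j \<noteq> h \<longrightarrow> B j \<inter> B h = {})"
  using assms
proof (induction n)
  case (Suc n)
  from Suc.IH[OF Suc.prems] obtain B where
    B: "\<And>j. j < n \<Longrightarrow> B j \<subseteq> Q \<and> good j (B j)" "\<And>j h. \<lbrakk>j < n; h < n; j \<noteq> h\<rbrakk> \<Longrightarrow> B j \<inter> B h = {}"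
    by (metis less_SucI)
  obtain B' where B': "B' \<subseteq> Q - (\<Union>j<n. B j)" "good n B'"
    using Suc.prems[of n B] B(1) by auto
  have dis: "B' \<inter> B j = {}" "B j \<inter> B' = {}" if "j < n" for j using B'(1) that by auto
  show ?case
    using B B' dis by (intro exI[of _ "B(n := B')"]) (auto simp: less_Suc_eq)
qed simp

section \<open>Contractions of a decomposition of the adjoined tensor\<close>

definition head1 :: "nat + 'w \<Rightarrow> real" where
  "head1 s = (case s of Inl k \<Rightarrow> of_bool (k \<le> 14) | Inr _ \<Rightarrow> 0)"
definition head2 :: "nat + 'w \<Rightarrow> real" where
  "head2 s = (case s of Inl k \<Rightarrow> of_bool (14 < k) | Inr _ \<Rightarrow> 0)"
definition ext0 :: "(nat \<Rightarrow> real) \<Rightarrow> nat + 'w \<Rightarrow> real" where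
  "ext0 f s = (case s of Inl k \<Rightarrow> f k | Inr _ \<Rightarrow> 0)"

text \<open>Index tuples are functions on \<open>{..<6}\<close>; \<open>u w\<close> is the vector whose fifth power is \<open>w\<close>.\<close>

definition adjT :: "'w set \<Rightarrow> ('w \<Rightarrow> nat \<Rightarrow> real) \<Rightarrow> (nat \<Rightarrow> nat + 'w) \<Rightarrow> real" where
  "adjT W u \<kappa> = (\<Prod>j<6. head1 (\<kappa> j)) - 3 * (\<Prod>j<6. head2 (\<kappa> j)) +
     (\<Sum>j<6. \<Sum>w\<in>W. of_bool (\<kappa> j = Inr w) * (\<Prod>h\<in>{..<6} - {j}. ext0 (u w) (\<kappa> h)))"

text \<open>The scalars \<open>c i\<close> let one locale serve both ranks: they are 1 for an
  arbitrary decomposition, and the weights of the powers, with factors independent of the slot, for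
  a symmetric one. Of W, the lower bounds use only the independence of the fifth powers and the
  pattern of their zeros.\<close>

locale adj_decomposition =
  fixes W :: "'w set" and u :: "'w \<Rightarrow> nat \<Rightarrow> real"
    and c :: "nat \<Rightarrow> real" and v :: "nat \<Rightarrow> nat \<Rightarrow> nat + 'w \<Rightarrow> real" and r :: nat
  assumes finW: "finite W"
    and decomp: "\<And>\<kappa>. (\<forall>j<6. \<kappa> j \<in> Inl ` {1..28} \<union> Inr ` W) \<Longrightarrow>
      adjT W u \<kappa> = (\<Sum>i<r. c i * (\<Prod>j<6. v i j (\<kappa> j)))"
    and indep: "\<And>x. (\<And>\<kappa> :: nat \<Rightarrow> nat. (\<forall>j<5. \<kappa> j \<in> {1..28}) \<Longrightarrow> (\<Sum>w\<in>W. x w * (\<Prod>j<5. u w (\<kappa> j))) = 0)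
      \<Longrightarrow> \<forall>w\<in>W. x w = 0"
    and sparse: "\<And>w P. \<lbrakk>w \<in> W; P \<subseteq> {1..14}; card P = 5; inj_on pair_cls P; inj_on shift_cls P\<rbrakk>
      \<Longrightarrow> (\<exists>p\<in>P. u w p = 0) \<and> (\<exists>p\<in>P. u w (p + 14) = 0)"
begin

text \<open>\<open>L j y i + M j x i\<close> is slot \<open>j\<close> of the term \<open>i\<close>
  contracted with the vector that is \<open>y\<close> on the original indices and \<open>x\<close>
  on W. Adding the second summand is the row operation of the substitution method.\<close>

definition L :: "nat \<Rightarrow> (nat \<Rightarrow> real) \<Rightarrow> nat \<Rightarrow> real" where
  "L j y i = (\<Sum>k\<in>{1..28}. y k * v i j (Inl k))"
definition M :: "nat \<Rightarrow> ('w \<Rightarrow> real) \<Rightarrow> nat \<Rightarrow> real" where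
  "M j x i = (\<Sum>w\<in>W. x w * v i j (Inr w))"
definition U :: "'w \<Rightarrow> (nat \<Rightarrow> real) \<Rightarrow> real" where
  "U w y = (\<Sum>k\<in>{1..28}. y k * u w k)"
definition X1 :: "(nat \<Rightarrow> real) \<Rightarrow> real" where "X1 y = (\<Sum>k\<in>{1..14}. y k)"
definition X2 :: "(nat \<Rightarrow> real) \<Rightarrow> real" where "X2 y = (\<Sum>k\<in>{15..28}. y k)"
definition \<delta> :: "nat \<Rightarrow> nat \<Rightarrow> real" where "\<delta> k = (\<lambda>k'. of_bool (k' = k))"

text \<open>The decomposition is contracted in all six slots. A nonzero entry of the adjoined tensor
  has at most one index from W, so on the right the \<open>x j\<close> enter one slot at a time;
  this is where modifications come from.\<close>

lemma multilinear:
  "(\<Sum>i<r. c i * (\<Prod>j<6. L j (y j) i + M j (x j) i)) =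
     (\<Prod>j<6. X1 (y j)) - 3 * (\<Prod>j<6. X2 (y j)) +
     (\<Sum>j<6. \<Sum>w\<in>W. x j w * (\<Prod>h\<in>{..<6} - {j}. U w (y h)))"
proof -
  let ?S = "Inl ` {1..28::nat} \<union> Inr ` W"
  let ?e = "\<lambda>j. case_sum (y j) (x j)"
  let ?P = "{..<6::nat} \<rightarrow>\<^sub>E ?S"
  have finS: "finite ?S" using finW by simp
  have sumS: "(\<Sum>s\<in>?S. f s) = (\<Sum>k\<in>{1..28}. f (Inl k)) + (\<Sum>w\<in>W. f (Inr w))"
    for f :: "nat + 'w \<Rightarrow> real"
    by (subst sum.union_disjoint) (auto simp: finW sum.reindex)
  have sum_prod: "(\<Sum>\<kappa>\<in>?P. (\<Prod>j<6. ?e j (\<kappa> j)) * (\<Prod>j<6. f j (\<kappa> j))) =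
      (\<Prod>j<6. \<Sum>s\<in>?S. ?e j s * f j s)" for f :: "nat \<Rightarrow> nat + 'w \<Rightarrow> real"
    using finS by (subst prod_sum_PiE) (auto simp: prod.distrib)
  have h1: "(\<Sum>s\<in>?S. ?e j s * head1 s) = X1 (y j)" for j
  proof -
    have "(\<Sum>k\<in>{1..28}. y j k * of_bool (k \<le> 14)) = (\<Sum>k\<in>{1..14}. y j k)"
      by (rule sum.mono_neutral_cong_right) auto
    then show ?thesis unfolding sumS by (simp add: head1_def X1_def)
  qed
  have h2: "(\<Sum>s\<in>?S. ?e j s * head2 s) = X2 (y j)" for j
  proof -
    have "(\<Sum>k\<in>{1..28}. y j k * of_bool (14 < k)) = (\<Sum>k\<in>{15..28}. y j k)"
      by (rule sum.mono_neutral_cong_right) auto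
    then show ?thesis unfolding sumS by (simp add: head2_def X2_def)
  qed
  have h3: "(\<Sum>s\<in>?S. ?e j s * ext0 (u w) s) = U w (y j)" for j w
    unfolding sumS by (simp add: ext0_def U_def)
  have h4: "(\<Sum>s\<in>?S. ?e j s * of_bool (s = Inr w)) = x j w" if "w \<in> W" for j w
  proof -
    have "(\<Sum>w'\<in>W. x j w' * of_bool (w' = w)) = (\<Sum>w'\<in>W. if w' = w then x j w' else 0)"
      by (intro sum.cong) auto
    then show ?thesis unfolding sumS using that finW by simp
  qed
  have row: "(\<Sum>s\<in>?S. ?e j s * v i j s) = L j (y j) i + M j (x j) i" for i j
    unfolding sumS by (simp add: L_def M_def)
  have mixed: "(\<Sum>\<kappa>\<in>?P. (\<Prod>j<6. ?e j (\<kappa> j)) *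
      (of_bool (\<kappa> j = Inr w) * (\<Prod>h\<in>{..<6} - {j}. ext0 (u w) (\<kappa> h))))
      = x j w * (\<Prod>h\<in>{..<6} - {j}. U w (y h))" if j: "j < 6" and w: "w \<in> W" for j w
  proof -
    let ?f = "\<lambda>h s. if h = j then of_bool (s = Inr w) else ext0 (u w) s"
    have split: "(\<Prod>h<6. g h) = g j * (\<Prod>h\<in>{..<6} - {j}. g h)" for g :: "nat \<Rightarrow> real"
      using j by (subst prod.remove[of _ j]) auto
    have "of_bool (\<kappa> j = Inr w) * (\<Prod>h\<in>{..<6} - {j}. ext0 (u w) (\<kappa> h)) = (\<Prod>h<6. ?f h (\<kappa> h))" for \<kappa>
      unfolding split by simp
    then have "(\<Sum>\<kappa>\<in>?P. (\<Prod>j<6. ?e j (\<kappa> j)) *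
      (of_bool (\<kappa> j = Inr w) * (\<Prod>h\<in>{..<6} - {j}. ext0 (u w) (\<kappa> h))))
      = (\<Prod>h<6. \<Sum>s\<in>?S. ?e h s * ?f h s)" by (simp only: sum_prod[of ?f])
    also have "\<dots> = x j w * (\<Prod>h\<in>{..<6} - {j}. U w (y h))"
      unfolding split using h4[OF w] h3 by simp
    finally show ?thesis .
  qed
  have "(\<Sum>i<r. c i * (\<Prod>j<6. L j (y j) i + M j (x j) i)) =
      (\<Sum>i<r. c i * (\<Sum>\<kappa>\<in>?P. (\<Prod>j<6. ?e j (\<kappa> j)) * (\<Prod>j<6. v i j (\<kappa> j))))"
    by (simp only: sum_prod row)
  also have "\<dots> = (\<Sum>\<kappa>\<in>?P. (\<Prod>j<6. ?e j (\<kappa> j)) * (\<Sum>i<r. c i * (\<Prod>j<6. v i j (\<kappa> j))))"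
    by (simp add: sum_distrib_left mult_ac) (rule sum.swap)
  also have "\<dots> = (\<Sum>\<kappa>\<in>?P. (\<Prod>j<6. ?e j (\<kappa> j)) * adjT W u \<kappa>)"
    using decomp by (intro sum.cong refl) (auto simp: PiE_iff)
  also have "\<dots> = (\<Sum>\<kappa>\<in>?P. (\<Prod>j<6. ?e j (\<kappa> j)) * (\<Prod>j<6. head1 (\<kappa> j)))
      - 3 * (\<Sum>\<kappa>\<in>?P. (\<Prod>j<6. ?e j (\<kappa> j)) * (\<Prod>j<6. head2 (\<kappa> j)))
      + (\<Sum>\<kappa>\<in>?P. \<Sum>j<6. \<Sum>w\<in>W. (\<Prod>j<6. ?e j (\<kappa> j)) *
          (of_bool (\<kappa> j = Inr w) * (\<Prod>h\<in>{..<6} - {j}. ext0 (u w) (\<kappa> h))))"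
    unfolding adjT_def
    by (simp only: distrib_left right_diff_distrib sum.distrib sum_subtractf sum_distrib_left mult.left_commute)
  also have "(\<Sum>\<kappa>\<in>?P. \<Sum>j<6. \<Sum>w\<in>W. (\<Prod>j<6. ?e j (\<kappa> j)) *
          (of_bool (\<kappa> j = Inr w) * (\<Prod>h\<in>{..<6} - {j}. ext0 (u w) (\<kappa> h))))
     = (\<Sum>j<6. \<Sum>w\<in>W. \<Sum>\<kappa>\<in>?P. (\<Prod>j<6. ?e j (\<kappa> j)) *
          (of_bool (\<kappa> j = Inr w) * (\<Prod>h\<in>{..<6} - {j}. ext0 (u w) (\<kappa> h))))"
    by (subst sum.swap, intro sum.cong refl, rule sum.swap)
  also have "\<dots> = (\<Sum>j<6. \<Sum>w\<in>W. x j w * (\<Prod>h\<in>{..<6} - {j}. U w (y h)))"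
    using mixed by (intro sum.cong refl) auto
  finally show ?thesis
    by (simp only: sum_prod[of "\<lambda>_. head1"] sum_prod[of "\<lambda>_. head2"] h1 h2)
qed

lemma M_zero: "\<forall>w\<in>W. x w = 0 \<Longrightarrow> M j x i = 0"
  by (simp add: M_def)

lemma M_add: "M j (\<lambda>w. x w + x' w) i = M j x i + M j x' i"
  by (simp add: M_def distrib_right sum.distrib)

lemma M_diff: "M j (\<lambda>w. x w - x' w) i = M j x i - M j x' i"
  by (simp add: M_def left_diff_distrib sum_subtractf)

lemma M_scale: "M j (\<lambda>w. a * x w) i = a * M j x i"
  by (simp add: M_def sum_distrib_left mult.assoc)

lemma L_diff: "L j (\<lambda>k. y k - y' k) i = L j y i - L j y' i"
  by (simp add: L_def left_diff_distrib sum_subtractf)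

lemma L_scale: "L j (\<lambda>k. a * y k) i = a * L j y i"
  by (simp add: L_def sum_distrib_left mult.assoc)

lemma U_diff: "U w (\<lambda>k. y k - y' k) = U w y - U w y'"
  by (simp add: U_def left_diff_distrib sum_subtractf)

lemma U_scale: "U w (\<lambda>k. a * y k) = a * U w y"
  by (simp add: U_def sum_distrib_left mult.assoc)

lemma sum_delta_mult: "finite A \<Longrightarrow> (\<Sum>k\<in>A. \<delta> a k * f k) = (if a \<in> A then f a else 0)"
proof -
  assume "finite A"
  moreover have "(\<Sum>k\<in>A. \<delta> a k * f k) = (\<Sum>k\<in>A. if k = a then f k else 0)"
    by (intro sum.cong) (auto simp: \<delta>_def)
  ultimately show ?thesis by simp
qed

lemma U_delta: "k \<in> {1..28} \<Longrightarrow> U w (\<delta> k) = u w k"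
  unfolding U_def by (subst sum_delta_mult) auto

lemma U_zero: "U w (\<lambda>k. 0) = 0"
  by (simp add: U_def)

lemma X1_delta: "X1 (\<delta> k) = of_bool (k \<in> {1..14})"
  using sum_delta_mult[of "{1..14}" k "\<lambda>_. 1"] by (simp add: X1_def)

lemma X2_delta: "X2 (\<delta> k) = of_bool (k \<in> {15..28})"
  using sum_delta_mult[of "{15..28}" k "\<lambda>_. 1"] by (simp add: X2_def)

lemma X_zero: "X1 (\<lambda>k. 0) = 0" "X2 (\<lambda>k. 0) = 0"
  by (simp_all add: X1_def X2_def)

lemma indep_slot:
  fixes h :: nat
  assumes h: "h < 6"
    and rel: "\<And>\<kappa>. (\<And>j. j \<in> {..<6} - {h} \<Longrightarrow> \<kappa> j \<in> {1..28}) \<Longrightarrow>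
      (\<Sum>w\<in>W. x w * (\<Prod>j\<in>{..<6} - {h}. u w (\<kappa> j))) = 0"
  shows "\<forall>w\<in>W. x w = 0"
proof (rule indep)
  fix \<kappa> :: "nat \<Rightarrow> nat" assume \<kappa>: "\<forall>j<5. \<kappa> j \<in> {1..28}"
  have "card ({..<6} - {h}) = card {..<5::nat}" using h by simp
  then obtain e where e: "bij_betw e ({..<6} - {h}) {..<5::nat}"
    using finite_same_card_bij by blast
  have "(\<Prod>j\<in>{..<6} - {h}. u w (\<kappa> (e j))) = (\<Prod>j<5. u w (\<kappa> j))" for w
    by (rule prod.reindex_bij_betw[OF e])
  moreover have "\<kappa> (e j) \<in> {1..28}" if "j \<in> {..<6} - {h}" for j
    using \<kappa> bij_betw_apply[OF e that] by simp
  ultimately show "(\<Sum>w\<in>W. x w * (\<Prod>j<5. u w (\<kappa> j))) = 0"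
    using rel[of "\<lambda>j. \<kappa> (e j)"] by simp
qed

text \<open>Dropping one of the six positions leaves five in distinct classes of both matchings, and
  there every \<open>u w\<close> has a zero in each half. So whatever the \<open>x j\<close> are, no
  modification reaches these two entries.\<close>

lemma spread_form:
  assumes \<kappa>: "\<And>j. j < 6 \<Longrightarrow> \<kappa> j \<in> {1..14}"
    and inj: "inj_on (\<lambda>j. pair_cls (\<kappa> j)) {..<6}" "inj_on (\<lambda>j. shift_cls (\<kappa> j)) {..<6}"
  shows "(\<Sum>i<r. c i * (\<Prod>j<6. L j (\<delta> (\<kappa> j)) i + M j (x j) i)) = 1"
    and "(\<Sum>i<r. c i * (\<Prod>j<6. L j (\<delta> (\<kappa> j + 14)) i + M j (x j) i)) = -3"
proof -
  have zero: "(\<Prod>h\<in>{..<6} - {j}. u w (\<kappa> h)) = 0 \<and> (\<Prod>h\<in>{..<6} - {j}. u w (\<kappa> h + 14)) = 0"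
    if "j < 6" "w \<in> W" for j w
  proof -
    let ?A = "{..<6} - {j}"
    have i1: "inj_on (\<lambda>j. pair_cls (\<kappa> j)) ?A" and i2: "inj_on (\<lambda>j. shift_cls (\<kappa> j)) ?A"
      by (rule inj_on_subset[OF inj(1) Diff_subset], rule inj_on_subset[OF inj(2) Diff_subset])
    from i1 have "inj_on \<kappa> ?A" by (rule inj_on_imageI2[of pair_cls, unfolded comp_def])
    then have "card (\<kappa> ` ?A) = 5" using that by (simp add: card_image)
    moreover have "inj_on pair_cls (\<kappa> ` ?A)" "inj_on shift_cls (\<kappa> ` ?A)"
      using i1 i2 by (auto intro!: inj_on_imageI[unfolded comp_def])
    moreover have "\<kappa> ` ?A \<subseteq> {1..14}" using \<kappa> by blast
    ultimately have ex: "(\<exists>p\<in>\<kappa> ` ?A. u w p = 0) \<and> (\<exists>p\<in>\<kappa> ` ?A. u w (p + 14) = 0)"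
      by (intro sparse[OF that(2)])
    have "\<exists>h\<in>?A. u w (\<kappa> h) = 0" "\<exists>h\<in>?A. u w (\<kappa> h + 14) = 0" using ex by blast+
    then show ?thesis by (intro conjI prod_zero) simp_all
  qed
  have "(\<Prod>h\<in>{..<6} - {j}. U w (\<delta> (\<kappa> h))) = (\<Prod>h\<in>{..<6} - {j}. u w (\<kappa> h))" for j w
    using \<kappa> by (intro prod.cong refl U_delta) fastforce
  moreover have "(\<Prod>h\<in>{..<6} - {j}. U w (\<delta> (\<kappa> h + 14))) = (\<Prod>h\<in>{..<6} - {j}. u w (\<kappa> h + 14))" for j w
    using \<kappa> by (intro prod.cong refl U_delta) fastforce
  ultimately have m:
    "(\<Sum>j<6. \<Sum>w\<in>W. x j w * (\<Prod>h\<in>{..<6} - {j}. U w (\<delta> (\<kappa> h)))) = 0"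
    "(\<Sum>j<6. \<Sum>w\<in>W. x j w * (\<Prod>h\<in>{..<6} - {j}. U w (\<delta> (\<kappa> h + 14)))) = 0"
    using zero by (auto intro!: sum.neutral simp del: prod_zero_iff)
  have "X1 (\<delta> (\<kappa> j)) = 1" "X2 (\<delta> (\<kappa> j)) = 0" "X1 (\<delta> (\<kappa> j + 14)) = 0" "X2 (\<delta> (\<kappa> j + 14)) = 1"
    if "j < 6" for j
    using \<kappa>[OF that] by (auto simp: X1_delta X2_delta)
  then have p: "(\<Prod>j<6. X1 (\<delta> (\<kappa> j))) = 1" "(\<Prod>j<6. X2 (\<delta> (\<kappa> j))) = 0"
    "(\<Prod>j<6. X1 (\<delta> (\<kappa> j + 14))) = 0" "(\<Prod>j<6. X2 (\<delta> (\<kappa> j + 14))) = 1"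
    by (simp_all add: lessThan_nat_numeral lessThan_Suc)
  show "(\<Sum>i<r. c i * (\<Prod>j<6. L j (\<delta> (\<kappa> j)) i + M j (x j) i)) = 1"
    "(\<Sum>i<r. c i * (\<Prod>j<6. L j (\<delta> (\<kappa> j + 14)) i + M j (x j) i)) = -3"
    unfolding multilinear m p by simp_all
qed

text \<open>The linear forms on the real vector space over W that slot \<open>j\<close> of these
  terms induces constitute a basis of the dual space.\<close>

definition basis :: "nat \<Rightarrow> nat set \<Rightarrow> bool" where
  "basis j B \<longleftrightarrow> B \<subseteq> {..<r} \<and> (\<forall>x. (\<forall>i\<in>B. M j x i = 0) \<longrightarrow> (\<forall>w\<in>W. x w = 0)) \<and> card B = card W"

lemma basis_interpolate:
  assumes "basis j B"
  shows "\<exists>x. \<forall>i\<in>B. M j x i = g i"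
proof -
  have "finite B" using assms finite_subset by (auto simp: basis_def)
  then show ?thesis
    using interpolate_basis[of B W "\<lambda>i w. v i j (Inr w)" g] assms finW
    by (simp add: basis_def M_def)
qed

lemma basis_determines:
  assumes "basis j B" "\<And>i. i \<in> B \<Longrightarrow> M j x i = M j x' i"
  shows "M j x = M j x'"
proof -
  have "\<forall>i\<in>B. M j (\<lambda>w. x w - x' w) i = 0" using assms(2) by (simp add: M_diff)
  then have "\<forall>w\<in>W. x w - x' w = 0" using assms(1) unfolding basis_def by blast
  then show ?thesis by (auto simp: M_def)
qed

text \<open>To find a basis for slot \<open>h\<close>, switch off the terms of each earlier basis in
  its own slot by modifying the row \<open>\<delta> (\<kappa> j)\<close>. Slot \<open>h\<close>
  receives \<open>x\<close> alone, which annihilates the head of the tensor and all modifications in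
  other slots. If \<open>x\<close> also vanishes on the remaining terms, what is left is a relation
  between the fifth powers, so \<open>x\<close> is zero on W.\<close>

lemma bases_exist:
  "\<exists>B. (\<forall>j<6. B j \<subseteq> {..<r} \<and> basis j (B j)) \<and> (\<forall>j<6. \<forall>h<6. j \<noteq> h \<longrightarrow> B j \<inter> B h = {})"
proof (rule greedy_disjoint)
  fix h :: nat and B assume h: "h < 6" and B: "\<And>j. j < h \<Longrightarrow> basis j (B j)"
  let ?Q = "{..<r} - (\<Union>j<h. B j)"
  have det: "\<forall>w\<in>W. x w = 0" if x: "\<forall>i\<in>?Q. M h x i = 0" for x
  proof (rule indep_slot[OF h])
    fix \<kappa> :: "nat \<Rightarrow> nat" assume \<kappa>: "\<And>j. j \<in> {..<6} - {h} \<Longrightarrow> \<kappa> j \<in> {1..28}"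
    have "\<forall>j\<in>{..<h}. \<exists>x. \<forall>i\<in>B j. M j x i = - L j (\<delta> (\<kappa> j)) i"
      using B basis_interpolate by simp
    from bchoice[OF this] obtain e where e: "\<forall>j\<in>{..<h}. \<forall>i\<in>B j. M j (e j) i = - L j (\<delta> (\<kappa> j)) i" ..
    define y where "y j = (if j = h then (\<lambda>k. 0) else \<delta> (\<kappa> j))" for j
    define z where "z j = (if j = h then x else if j < h then e j else (\<lambda>w. 0))" for j
    have pz: "(\<Prod>j<6. L j (y j) i + M j (z j) i) = 0" if i: "i < r" for i
    proof (cases "i \<in> ?Q")
      case True
      then have "L h (y h) i + M h (z h) i = 0" using x by (simp add: y_def z_def L_def)
      then show ?thesis using h by (intro prod_zero) auto
    next
      case False
      then obtain j where j: "j < h" "i \<in> B j" using i by auto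
      then have "L j (y j) i + M j (z j) i = 0" using e by (auto simp: y_def z_def)
      then show ?thesis using h j by (intro prod_zero) auto
    qed
    have "(\<Sum>i<r. c i * (\<Prod>j<6. L j (y j) i + M j (z j) i)) = 0"
      by (rule sum.neutral, rule ballI, subst pz) simp_all
    moreover have "X1 (y h) = 0" "X2 (y h) = 0" by (simp_all add: y_def X_zero)
    then have "(\<Prod>j<6. X1 (y j)) = 0" "(\<Prod>j<6. X2 (y j)) = 0" using h by (auto intro!: prod_zero)
    moreover have "(\<Sum>w\<in>W. z j w * (\<Prod>h'\<in>{..<6} - {j}. U w (y h'))) =
        (if j = h then \<Sum>w\<in>W. x w * (\<Prod>j\<in>{..<6} - {h}. u w (\<kappa> j)) else 0)" for j
    proof (cases "j = h")
      case True
      have "(\<Prod>h'\<in>{..<6} - {h}. U w (y h')) = (\<Prod>j\<in>{..<6} - {h}. u w (\<kappa> j))" for w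
        using \<kappa> by (intro prod.cong refl) (auto simp: y_def U_delta)
      then show ?thesis using True by (simp add: z_def)
    next
      case False
      then have "(\<Prod>h'\<in>{..<6} - {j}. U w (y h')) = 0" for w
        using h by (intro prod_zero bexI[of _ h]) (auto simp: y_def U_zero)
      then show ?thesis using False by (simp only: mult_zero_right sum.neutral_const if_False)
    qed
    ultimately show "(\<Sum>w\<in>W. x w * (\<Prod>j\<in>{..<6} - {h}. u w (\<kappa> j))) = 0"
      using h unfolding multilinear by simp
  qed
  then have "\<forall>x. (\<forall>i\<in>?Q. (\<Sum>w\<in>W. x w * v i h (Inr w)) = 0) \<longrightarrow> (\<forall>w\<in>W. x w = 0)"
    unfolding M_def by blast
  from interpolating_subset[OF _ this] obtain B' where B': "B' \<subseteq> ?Q"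
    "\<forall>x. (\<forall>i\<in>B'. (\<Sum>w\<in>W. x w * v i h (Inr w)) = 0) \<longrightarrow> (\<forall>w\<in>W. x w = 0)"
    "\<forall>g. \<exists>x. \<forall>i\<in>B'. (\<Sum>w\<in>W. x w * v i h (Inr w)) = g i" by auto
  have "card B' = card W"
    by (rule card_interpolating[OF finite_subset[OF B'(1)] finW B'(2,3)]) simp
  then have "basis h B'" using B' by (auto simp: basis_def M_def)
  then show "\<exists>B'\<subseteq>?Q. basis h B'" using B'(1) by blast
qed

lemma card_bases_union:
  assumes "\<And>j. j < 6 \<Longrightarrow> basis j (B j)" "\<forall>j<6. \<forall>h<6. j \<noteq> h \<longrightarrow> B j \<inter> B h = {}"
  shows "card (\<Union>j<6. B j) = 6 * card W"
proof -
  have "finite (B j)" if "j \<in> {..<6}" for j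
    using assms(1)[of j] that by (auto simp: basis_def intro: finite_subset[of _ "{..<r}"])
  then have "card (\<Union>j<6. B j) = (\<Sum>j<6. card (B j))" using assms(2) by (intro card_UN_disjoint) auto
  also have "\<dots> = (\<Sum>j<6::nat. card W)" using assms(1) by (intro sum.cong) (auto simp: basis_def)
  finally show ?thesis by simp
qed

definition odds :: "nat \<Rightarrow> nat" where "odds j = 2 * j + 1"

lemma odds_spread:
  "j < 6 \<Longrightarrow> odds j \<in> {1..14}"
  "inj_on (\<lambda>j. pair_cls (odds j)) {..<6}" "inj_on (\<lambda>j. shift_cls (odds j)) {..<6}"
  by (auto simp: odds_def pair_cls_def shift_cls_def inj_on_def)

text \<open>If six disjoint bases exhausted the terms, every term could be switched off, although
  the contraction at six positions in different classes is 1.\<close>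

lemma num_terms_gt: "6 * card W < r"
proof -
  obtain B where B: "\<forall>j<6. B j \<subseteq> {..<r} \<and> basis j (B j)" "\<forall>j<6. \<forall>h<6. j \<noteq> h \<longrightarrow> B j \<inter> B h = {}"
    using bases_exist by (elim exE conjE)
  have card: "card (\<Union>j<6. B j) = 6 * card W" using B by (intro card_bases_union) simp_all
  have sub: "(\<Union>j<6. B j) \<subseteq> {..<r}" using B by blast
  have "(\<Union>j<6. B j) \<noteq> {..<r}"
  proof
    assume eq: "(\<Union>j<6. B j) = {..<r}"
    have "\<forall>j\<in>{..<6}. \<exists>x. \<forall>i\<in>B j. M j x i = - L j (\<delta> (odds j)) i"
      using B basis_interpolate by simp
    from bchoice[OF this] obtain e where e: "\<forall>j\<in>{..<6}. \<forall>i\<in>B j. M j (e j) i = - L j (\<delta> (odds j)) i" ..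
    have pz: "(\<Prod>j<6. L j (\<delta> (odds j)) i + M j (e j) i) = 0" if "i < r" for i
    proof -
      have "i \<in> (\<Union>j<6. B j)" using eq that by simp
      then obtain j where j: "j \<in> {..<6}" "i \<in> B j" by (rule UN_E)
      have "L j (\<delta> (odds j)) i + M j (e j) i = 0" using e[rule_format, OF j] by simp
      then show ?thesis by (intro prod_zero bexI[OF _ j(1)]) simp_all
    qed
    have "(\<Sum>i<r. c i * (\<Prod>j<6. L j (\<delta> (odds j)) i + M j (e j) i)) = 0"
      by (rule sum.neutral, rule ballI, subst pz) simp_all
    then show False using spread_form(1)[OF odds_spread] by simp
  qed
  with sub have "card (\<Union>j<6. B j) < card {..<r}" by (intro psubset_card_mono) auto
  then show ?thesis using card by simp
qed

end

section \<open>Symmetric decompositions with one surplus term\<close>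

text \<open>Both positions complete the same five to a tuple as in \<open>spread_form\<close>.
  Comparing the two instances compares their rows in a single slot. For two even positions this uses
  up all seven classes.\<close>

definition adjacent :: "nat \<Rightarrow> nat \<Rightarrow> bool" where
  "adjacent k k' \<longleftrightarrow> (\<exists>P \<subseteq> {1..14}. card P = 5 \<and> k \<notin> P \<and> k' \<notin> P \<and>
     inj_on pair_cls (insert k P) \<and> inj_on shift_cls (insert k P) \<and>
     inj_on pair_cls (insert k' P) \<and> inj_on shift_cls (insert k' P))"

lemma adjacent_evens:
  "adjacent 4 2"
  "adjacent 6 2"
  "adjacent 8 2"
  "adjacent 10 2"
  "adjacent 12 2"
  "adjacent 14 2"
  unfolding adjacent_def
  subgoal by (rule exI[of _ "{6, 8, 10, 12, 14}"], simp add: pair_cls_def shift_cls_def)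
  subgoal by (rule exI[of _ "{4, 8, 10, 12, 14}"], simp add: pair_cls_def shift_cls_def)
  subgoal by (rule exI[of _ "{4, 6, 10, 12, 14}"], simp add: pair_cls_def shift_cls_def)
  subgoal by (rule exI[of _ "{4, 6, 8, 12, 14}"], simp add: pair_cls_def shift_cls_def)
  subgoal by (rule exI[of _ "{4, 6, 8, 10, 14}"], simp add: pair_cls_def shift_cls_def)
  by (rule exI[of _ "{4, 6, 8, 10, 12}"], simp add: pair_cls_def shift_cls_def)

lemma adjacent_odds:
  "adjacent 1 2"
  "adjacent 3 4"
  "adjacent 5 6"
  "adjacent 7 8"
  "adjacent 9 10"
  "adjacent 11 12"
  "adjacent 13 14"
  unfolding adjacent_def
  subgoal by (rule exI[of _ "{4, 6, 8, 10, 12}"], simp add: pair_cls_def shift_cls_def)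
  subgoal by (rule exI[of _ "{6, 8, 10, 12, 14}"], simp add: pair_cls_def shift_cls_def)
  subgoal by (rule exI[of _ "{2, 8, 10, 12, 14}"], simp add: pair_cls_def shift_cls_def)
  subgoal by (rule exI[of _ "{2, 4, 10, 12, 14}"], simp add: pair_cls_def shift_cls_def)
  subgoal by (rule exI[of _ "{2, 4, 6, 12, 14}"], simp add: pair_cls_def shift_cls_def)
  subgoal by (rule exI[of _ "{2, 4, 6, 8, 14}"], simp add: pair_cls_def shift_cls_def)
  by (rule exI[of _ "{2, 4, 6, 8, 10}"], simp add: pair_cls_def shift_cls_def)

lemma adjacent_even: "e \<in> {4, 6, 8, 10, 12, 14} \<Longrightarrow> adjacent e 2"
  using adjacent_evens by (elim insertE emptyE) simp_all

lemma adjacent_odd: "k \<in> {1, 3, 5, 7, 9, 11, 13} \<Longrightarrow> adjacent k (k + 1)"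
  using adjacent_odds by (elim insertE emptyE) (simp_all add: numeral_2_eq_2)

locale sym_adj_decomposition = adj_decomposition W u c "\<lambda>i j. V i" r
  for W :: "'w set" and u :: "'w \<Rightarrow> nat \<Rightarrow> real" and c :: "nat \<Rightarrow> real"
    and V :: "nat \<Rightarrow> nat + 'w \<Rightarrow> real" and r :: nat +
  assumes r_eq: "r = 6 * card W + 1"
begin

lemma L_slot: "L j = L 0"
  by (simp add: L_def fun_eq_iff)

lemma M_slot: "M j = M 0"
  by (simp add: M_def fun_eq_iff)

lemma basis_slot: "basis j = basis 0"
  unfolding basis_def M_slot[of j] ..

text \<open>\<open>zval B i y\<close> is the value at the term \<open>i\<close> of the row \<open>y\<close> after adding the combination of rows
  of \<open>W\<close> that makes it vanish on the basis \<open>B\<close>.\<close>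

definition fit :: "nat set \<Rightarrow> (nat \<Rightarrow> real) \<Rightarrow> 'w \<Rightarrow> real" where
  "fit B y = (SOME x. \<forall>b\<in>B. M 0 x b = - L 0 y b)"
definition zval :: "nat set \<Rightarrow> nat \<Rightarrow> (nat \<Rightarrow> real) \<Rightarrow> real" where
  "zval B i y = L 0 y i + M 0 (fit B y) i"

lemma zval_zero:
  assumes "basis 0 B" "b \<in> B"
  shows "zval B b y = 0"
proof -
  have "\<forall>b\<in>B. M 0 (fit B y) b = - L 0 y b"
    unfolding fit_def by (rule someI_ex[OF basis_interpolate[OF assms(1), of "\<lambda>b. - L 0 y b"]])
  then show ?thesis using assms(2) by (simp add: zval_def)
qed

text \<open>A basis determines the form of \<open>x\<close> at every term, so the value does not
  depend on the choice made in \<open>fit\<close>.\<close>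

lemma zval_eq:
  assumes B: "basis 0 B" and x: "\<And>b. b \<in> B \<Longrightarrow> L 0 y b + M 0 x b = 0"
  shows "zval B i y = L 0 y i + M 0 x i"
proof -
  have "M 0 (fit B y) = M 0 x"
  proof (rule basis_determines[OF B])
    fix b assume b: "b \<in> B"
    show "M 0 (fit B y) b = M 0 x b" using x[OF b] zval_zero[OF B b, of y] by (simp add: zval_def)
  qed
  then show ?thesis by (simp add: zval_def)
qed

lemma zval_diff:
  assumes "basis 0 B"
  shows "zval B i (\<lambda>k. y k - y' k) = zval B i y - zval B i y'"
proof -
  have "zval B i (\<lambda>k. y k - y' k) =
      L 0 (\<lambda>k. y k - y' k) i + M 0 (\<lambda>w. fit B y w - fit B y' w) i"
  proof (rule zval_eq[OF assms])
    fix b assume b: "b \<in> B"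
    then show "L 0 (\<lambda>k. y k - y' k) b + M 0 (\<lambda>w. fit B y w - fit B y' w) b = 0"
      using zval_zero[OF assms b, of y] zval_zero[OF assms b, of y']
      by (simp add: zval_def L_diff M_diff)
  qed
  then show ?thesis by (simp add: zval_def L_diff M_diff)
qed

lemma zval_scale:
  assumes "basis 0 B"
  shows "zval B i (\<lambda>k. a * y k) = a * zval B i y"
proof -
  have "zval B i (\<lambda>k. a * y k) = L 0 (\<lambda>k. a * y k) i + M 0 (\<lambda>w. a * fit B y w) i"
  proof (rule zval_eq[OF assms])
    fix b assume b: "b \<in> B"
    have "a * (L 0 y b + M 0 (fit B y) b) = 0"
      using zval_zero[OF assms b, of y] by (simp add: zval_def)
    then show "L 0 (\<lambda>k. a * y k) b + M 0 (\<lambda>w. a * fit B y w) b = 0"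
      by (simp add: L_scale M_scale distrib_left)
  qed
  then show ?thesis by (simp add: zval_def L_scale M_scale distrib_left)
qed

definition config :: "nat \<Rightarrow> (nat \<Rightarrow> nat set) \<Rightarrow> bool" where
  "config i I \<longleftrightarrow> i < r \<and> (\<forall>j<6. basis 0 (I j)) \<and> (\<forall>j<6. \<forall>h<6. j \<noteq> h \<longrightarrow> I j \<inter> I h = {}) \<and>
     (\<forall>j<6. i \<notin> I j) \<and> {..<r} = insert i (\<Union>j<6. I j)"

lemma configD:
  assumes "config i I"
  shows "i < r" "j < 6 \<Longrightarrow> basis 0 (I j)" "\<lbrakk>j < 6; h < 6; j \<noteq> h\<rbrakk> \<Longrightarrow> I j \<inter> I h = {}"
    "j < 6 \<Longrightarrow> i \<notin> I j" "{..<r} = insert i (\<Union>j<6. I j)"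
  using assms unfolding config_def by simp_all

lemma config_exists: "\<exists>i I. config i I"
proof -
  obtain B where B: "\<forall>j<6. B j \<subseteq> {..<r} \<and> basis j (B j)"
    and dis: "\<forall>j<6. \<forall>h<6. j \<noteq> h \<longrightarrow> B j \<inter> B h = {}"
    using bases_exist by (elim exE conjE)
  have bas: "basis 0 (B j)" if "j < 6" for j
  proof -
    have "basis j (B j)" using B that by simp
    then show ?thesis by (simp only: basis_slot[of j])
  qed
  have card: "card (\<Union>j<6. B j) = 6 * card W" by (rule card_bases_union[OF _ dis]) (use B in simp)
  have sub: "(\<Union>j<6. B j) \<subseteq> {..<r}" using B by (intro UN_least) simp
  have "card ({..<r} - (\<Union>j<6. B j)) = 1"
    using card r_eq sub finite_subset[OF sub] by (subst card_Diff_subset) simp_all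
  then obtain i where "{..<r} - (\<Union>j<6. B j) = {i}" by (rule card_1_singletonE)
  then have i: "i < r" "i \<notin> (\<Union>j<6. B j)" "{..<r} = insert i (\<Union>j<6. B j)" using sub by auto
  then have "config i B" unfolding config_def using bas dis by simp
  then show ?thesis by (intro exI)
qed

text \<open>Each term other than \<open>i\<close> lies in one of the bases and is annihilated in the
  corresponding slot.\<close>

lemma config_form:
  assumes conf: "config i I"
  shows "c i * (\<Prod>j<6. zval (I j) i (y j)) =
     (\<Prod>j<6. X1 (y j)) - 3 * (\<Prod>j<6. X2 (y j)) +
     (\<Sum>j<6. \<Sum>w\<in>W. fit (I j) (y j) w * (\<Prod>h\<in>{..<6} - {j}. U w (y h)))"
proof -
  have "(\<Sum>i'<r. c i' * (\<Prod>j<6. zval (I j) i' (y j))) = (\<Sum>i'\<in>{i}. c i' * (\<Prod>j<6. zval (I j) i' (y j)))"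
  proof (rule sum.mono_neutral_right)
    show "{i} \<subseteq> {..<r}" using configD[OF conf] by simp
    show "\<forall>i'\<in>{..<r} - {i}. c i' * (\<Prod>j<6. zval (I j) i' (y j)) = 0"
    proof
      fix i' assume "i' \<in> {..<r} - {i}"
      then have "i' \<in> (\<Union>j<6. I j)" using configD(5)[OF conf] by auto
      then obtain j where j: "j \<in> {..<6}" "i' \<in> I j" by (rule UN_E)
      then have "zval (I j) i' (y j) = 0" using configD(2)[OF conf, of j] zval_zero by simp
      then have "(\<Prod>j<6. zval (I j) i' (y j)) = 0" using j(1) by (intro prod_zero) auto
      then show "c i' * (\<Prod>j<6. zval (I j) i' (y j)) = 0" by (simp only: mult_zero_right)
    qed
  qed simp
  moreover have "(\<Sum>i'<r. c i' * (\<Prod>j<6. zval (I j) i' (y j))) =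
      (\<Sum>i<r. c i * (\<Prod>j<6. L j (y j) i + M j (fit (I j) (y j)) i))"
    by (intro sum.cong prod.cong arg_cong2[of _ _ _ _ "(*)"] refl)
      (simp add: zval_def L_def M_def)
  ultimately show ?thesis unfolding multilinear by simp
qed

lemma config_spread:
  assumes conf: "config i I" and \<kappa>: "\<And>j. j < 6 \<Longrightarrow> \<kappa> j \<in> {1..14}"
    and inj: "inj_on (\<lambda>j. pair_cls (\<kappa> j)) {..<6}" "inj_on (\<lambda>j. shift_cls (\<kappa> j)) {..<6}"
  shows "c i * (\<Prod>j<6. zval (I j) i (\<delta> (\<kappa> j))) = 1"
    and "c i * (\<Prod>j<6. zval (I j) i (\<delta> (\<kappa> j + 14))) = -3"
  unfolding config_form[OF conf] multilinear[symmetric]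
  by (rule spread_form[OF \<kappa> inj], simp)+

text \<open>Distribute the common five positions over the slots other than \<open>j\<close>. The
  rest of the product is then a number independent of the position put into slot \<open>j\<close>,
  and it is nonzero because the whole product is 1 or -3.\<close>

lemma zval_adjacent:
  assumes conf: "config i I" and j: "j < 6" and k: "k \<in> {1..14}" "k' \<in> {1..14}" and adj: "adjacent k k'"
  shows "zval (I j) i (\<delta> k) = zval (I j) i (\<delta> k')"
    and "zval (I j) i (\<delta> (k + 14)) = zval (I j) i (\<delta> (k' + 14))"
proof -
  let ?A = "{..<6} - {j}"
  obtain P where P: "P \<subseteq> {1..14}" "card P = 5" "k \<notin> P" "k' \<notin> P"
     "inj_on pair_cls (insert k P)" "inj_on shift_cls (insert k P)"
     "inj_on pair_cls (insert k' P)" "inj_on shift_cls (insert k' P)"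
    using adj unfolding adjacent_def by (elim exE conjE)
  have "finite P" using P(1) finite_subset by (metis finite_atLeastAtMost)
  moreover have "card ?A = card P" using j P(2) by simp
  ultimately obtain e where e: "bij_betw e ?A P" using finite_same_card_bij[of ?A P] by auto
  have split: "(\<Prod>h<6. f h) = f j * (\<Prod>h\<in>?A. f h)" for f :: "nat \<Rightarrow> real"
    using j by (subst prod.remove[of _ j]) auto
  have spread: "c i * (\<Prod>h<6. zval (I h) i (\<delta> ((e(j := a)) h))) = 1"
    "c i * (\<Prod>h<6. zval (I h) i (\<delta> ((e(j := a)) h + 14))) = -3"
    if a: "a \<in> {1..14}" "a \<notin> P" "inj_on pair_cls (insert a P)" "inj_on shift_cls (insert a P)" for a
  proof -
    have im: "(e(j := a)) ` {..<6} = insert a P"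
      using bij_betw_imp_surj_on[OF e] j by (auto simp: image_iff)
    have inj: "inj_on (e(j := a)) {..<6}"
    proof (rule eq_card_imp_inj_on)
      show "card ((e(j := a)) ` {..<6}) = card {..<6::nat}"
        unfolding im using a(2) P(2) \<open>finite P\<close> by simp
    qed simp
    have rng: "(e(j := a)) h \<in> {1..14}" if "h < 6" for h
    proof -
      have "(e(j := a)) h \<in> (e(j := a)) ` {..<6}" using that by (intro imageI) simp
      then show ?thesis unfolding im using P(1) a(1) by (metis insertE subsetD)
    qed
    have "inj_on (pair_cls \<circ> (e(j := a))) {..<6}" "inj_on (shift_cls \<circ> (e(j := a))) {..<6}"
      using a(3,4) inj by (intro comp_inj_on; simp only: im)+
    then have i: "inj_on (\<lambda>h. pair_cls ((e(j := a)) h)) {..<6}" "inj_on (\<lambda>h. shift_cls ((e(j := a)) h)) {..<6}"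
      by (simp_all only: comp_def)
    show "c i * (\<Prod>h<6. zval (I h) i (\<delta> ((e(j := a)) h))) = 1"
      "c i * (\<Prod>h<6. zval (I h) i (\<delta> ((e(j := a)) h + 14))) = -3"
      by (rule config_spread[OF conf rng i], assumption)+
  qed
  define R where "R = c i * (\<Prod>h\<in>?A. zval (I h) i (\<delta> (e h)))"
  define R' where "R' = c i * (\<Prod>h\<in>?A. zval (I h) i (\<delta> (e h + 14)))"
  have pR: "(\<Prod>h\<in>?A. zval (I h) i (\<delta> ((e(j := a)) h))) = (\<Prod>h\<in>?A. zval (I h) i (\<delta> (e h)))" for a
    by (intro prod.cong) auto
  have pR': "(\<Prod>h\<in>?A. zval (I h) i (\<delta> ((e(j := a)) h + 14))) = (\<Prod>h\<in>?A. zval (I h) i (\<delta> (e h + 14)))" for a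
    by (intro prod.cong) auto
  have s1: "zval (I j) i (\<delta> a) * R = 1 \<and> zval (I j) i (\<delta> (a + 14)) * R' = -3"
    if "a \<in> {1..14}" "a \<notin> P" "inj_on pair_cls (insert a P)" "inj_on shift_cls (insert a P)" for a
    using spread[OF that] unfolding split pR pR' R_def R'_def by (simp add: mult_ac)
  have nz: "R \<noteq> 0" "R' \<noteq> 0" using s1[OF k(1) P(3,5,6)] by auto
  have "zval (I j) i (\<delta> k) * R = zval (I j) i (\<delta> k') * R"
    "zval (I j) i (\<delta> (k + 14)) * R' = zval (I j) i (\<delta> (k' + 14)) * R'"
    using s1[OF k(1) P(3,5,6)] s1[OF k(2) P(4,7,8)] by simp_all
  then show "zval (I j) i (\<delta> k) = zval (I j) i (\<delta> k')"
    "zval (I j) i (\<delta> (k + 14)) = zval (I j) i (\<delta> (k' + 14))"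
    using nz by simp_all
qed

lemma zval_const_2:
  assumes conf: "config i I" and j: "j < 6" and k: "k \<in> {1..14}"
  shows "zval (I j) i (\<delta> k) = zval (I j) i (\<delta> 2) \<and> zval (I j) i (\<delta> (k + 14)) = zval (I j) i (\<delta> 16)"
proof -
  have ev: "zval (I j) i (\<delta> e) = zval (I j) i (\<delta> 2) \<and> zval (I j) i (\<delta> (e + 14)) = zval (I j) i (\<delta> 16)"
    if "e \<in> {2, 4, 6, 8, 10, 12, 14}" for e
    using zval_adjacent[OF conf j _ _ adjacent_even, of e] that by auto
  have "k \<in> set [1..<15]" using k by simp
  then have "k \<in> {2, 4, 6, 8, 10, 12, 14} \<or> k \<in> {1, 3, 5, 7, 9, 11, 13}"
    by (simp add: upt_rec) (elim disjE, simp_all)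
  then show ?thesis
  proof
    assume k: "k \<in> {1, 3, 5, 7, 9, 11, 13}"
    then have "k \<in> {1..14}" "k + 1 \<in> {1..14}" "k + 1 \<in> {2, 4, 6, 8, 10, 12, 14}" by auto
    then show ?thesis
      using zval_adjacent[OF conf j _ _ adjacent_odd[OF k]] ev[of "k + 1"] by simp
  qed (rule ev)
qed

text \<open>Hence each slot of the surplus term reduces to a combination a X + b Y, where
  \<open>a\<close> and \<open>b\<close> are its values at the positions 1 and 15.\<close>

lemma zval_const:
  assumes "config i I" "j < 6" "k \<in> {1..14}"
  shows "zval (I j) i (\<delta> k) = zval (I j) i (\<delta> 1)"
    and "zval (I j) i (\<delta> (k + 14)) = zval (I j) i (\<delta> 15)"
  using zval_const_2[OF assms] zval_const_2[OF assms(1,2), of 1] by simp_all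

lemma zval_products:
  assumes "config i I"
  shows "c i * (\<Prod>j<6. zval (I j) i (\<delta> 1)) = 1" "c i * (\<Prod>j<6. zval (I j) i (\<delta> 15)) = -3"
proof -
  have "(\<Prod>j<6. zval (I j) i (\<delta> (odds j))) = (\<Prod>j<6. zval (I j) i (\<delta> 1))"
    "(\<Prod>j<6. zval (I j) i (\<delta> (odds j + 14))) = (\<Prod>j<6. zval (I j) i (\<delta> 15))"
    using odds_spread(1) by (intro prod.cong refl zval_const[OF assms]; simp)+
  then show "c i * (\<Prod>j<6. zval (I j) i (\<delta> 1)) = 1" "c i * (\<Prod>j<6. zval (I j) i (\<delta> 15)) = -3"
    using config_spread[OF assms odds_spread] by simp_all
qed

lemma prod_transpose:
  fixes f :: "'b \<Rightarrow> real"
  assumes "p \<in> A" "q \<in> A"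
  shows "(\<Prod>h\<in>A. f (\<kappa> (transpose p q h))) = (\<Prod>h\<in>A. f (\<kappa> h))"
proof (rule prod.reindex_bij_betw[where g = "\<lambda>h. f (\<kappa> h)"])
  show "bij_betw (transpose p q) A A" using assms by simp
qed

text \<open>Antisymmetrising over two disjoint pairs of slots kills both the symmetric part and every
  modification \<open>x \<otimes>\<^sub>j w\<close>, as \<open>j\<close> lies in at most one of the pairs.\<close>

lemma zval_minors:
  assumes conf: "config i I" and lt: "p < 6" "q < 6" "s < 6" "t < 6"
    and ne: "p \<noteq> q" "p \<noteq> s" "p \<noteq> t" "q \<noteq> s" "q \<noteq> t" "s \<noteq> t"
  defines "a \<equiv> \<lambda>j. zval (I j) i (\<delta> 1)" and "b \<equiv> \<lambda>j. zval (I j) i (\<delta> 15)"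
  shows "(a p * b q - a q * b p) * (a s * b t - a t * b s) = 0"
proof -
  define G where "G \<kappa> = c i * (\<Prod>j<6. zval (I j) i (\<delta> (\<kappa> j)))" for \<kappa>
  define A where "A \<kappa> = (\<Prod>j<6. X1 (\<delta> (\<kappa> j))) - 3 * (\<Prod>j<6. X2 (\<delta> (\<kappa> j)))" for \<kappa> :: "nat \<Rightarrow> nat"
  define g where "g h \<kappa> = (\<Sum>w\<in>W. fit (I h) (\<delta> (\<kappa> h)) w * (\<Prod>h'\<in>{..<6} - {h}. U w (\<delta> (\<kappa> h'))))"
    for h and \<kappa> :: "nat \<Rightarrow> nat"
  have G: "G \<kappa> = A \<kappa> + (\<Sum>h<6. g h \<kappa>)" for \<kappa>
    unfolding G_def A_def g_def by (rule config_form[OF conf])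
  have A: "A (\<lambda>h. \<kappa> (transpose p' q' h)) = A \<kappa>" if "p' < 6" "q' < 6" for p' q' \<kappa>
    unfolding A_def using that
    by (simp add: prod_transpose[where f = "\<lambda>k. X1 (\<delta> k)"] prod_transpose[where f = "\<lambda>k. X2 (\<delta> k)"])
  have g: "g h (\<lambda>h. \<kappa> (transpose p' q' h)) = g h \<kappa>" if "p' < 6" "q' < 6" "h \<noteq> p'" "h \<noteq> q'" for h p' q' \<kappa>
    unfolding g_def using that
    by (simp add: prod_transpose[where f = "\<lambda>k. U _ (\<delta> k)"])
  let ?\<sigma> = "transpose p q" and ?\<tau> = "transpose s t"
  have comm: "?\<tau> (?\<sigma> h) = ?\<sigma> (?\<tau> h)" for h using ne by (auto simp: transpose_def)
  \<comment> \<open>With 15 in one slot of each pair and 1 everywhere else, the four arrangements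
    obtained from the two transpositions multiply out to a product of two 2 by 2 minors.\<close>
  define \<kappa> where "\<kappa> h = (if h = q \<or> h = t then 15 else 1 :: nat)" for h
  have alt: "G \<kappa> - G (\<lambda>h. \<kappa> (?\<sigma> h)) - G (\<lambda>h. \<kappa> (?\<tau> h)) + G (\<lambda>h. \<kappa> (?\<tau> (?\<sigma> h))) = 0"
  proof -
    have "g h \<kappa> - g h (\<lambda>h. \<kappa> (?\<sigma> h)) - g h (\<lambda>h. \<kappa> (?\<tau> h)) + g h (\<lambda>h. \<kappa> (?\<tau> (?\<sigma> h))) = 0" for h
    proof (cases "h = p \<or> h = q")
      case True
      then have "h \<noteq> s" "h \<noteq> t" using ne by auto
      then show ?thesis using g[of s t h \<kappa>] g[of s t h "\<lambda>h. \<kappa> (?\<sigma> h)"] lt by (simp add: comm)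
    next
      case False
      then show ?thesis using g[of p q h \<kappa>] g[of p q h "\<lambda>h. \<kappa> (?\<tau> h)"] lt by simp
    qed
    then have "(\<Sum>h<6. g h \<kappa> - g h (\<lambda>h. \<kappa> (?\<sigma> h)) - g h (\<lambda>h. \<kappa> (?\<tau> h)) + g h (\<lambda>h. \<kappa> (?\<tau> (?\<sigma> h)))) = 0"
      by simp
    then show ?thesis
      unfolding G sum.distrib sum_subtractf
      using A[of p q \<kappa>] A[of s t \<kappa>] A[of p q "\<lambda>h. \<kappa> (?\<tau> h)"] lt by simp
  qed
  define R where "R = c i * (\<Prod>h\<in>{..<6} - {p, q, s, t}. a h)"
  have set6: "{..<6} = insert p (insert q (insert s (insert t ({..<6} - {p, q, s, t}))))" using lt by auto
  have split: "(\<Prod>h<6. f h) = f p * f q * f s * f t * (\<Prod>h\<in>{..<6} - {p, q, s, t}. f h)"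
    for f :: "nat \<Rightarrow> real"
    using ne by (subst set6) (simp add: mult_ac)
  have rest: "(\<Prod>h\<in>{..<6} - {p, q, s, t}. zval (I h) i (\<delta> (\<mu> h))) = (\<Prod>h\<in>{..<6} - {p, q, s, t}. a h)"
    if "\<forall>h. h \<notin> {p, q, s, t} \<longrightarrow> \<mu> h = 1" for \<mu>
    by (intro prod.cong) (use that in \<open>auto simp: a_def\<close>)
  have Gv: "G \<mu> = R * (zval (I p) i (\<delta> (\<mu> p)) * zval (I q) i (\<delta> (\<mu> q)) *
      (zval (I s) i (\<delta> (\<mu> s)) * zval (I t) i (\<delta> (\<mu> t))))"
    if "\<forall>h. h \<notin> {p, q, s, t} \<longrightarrow> \<mu> h = 1" for \<mu>
    unfolding G_def split R_def rest[OF that] by (simp add: mult_ac)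
  have v1: "G \<kappa> = R * (a p * b q * (a s * b t))"
    by (subst Gv) (use ne in \<open>auto simp: \<kappa>_def a_def b_def\<close>)
  have v2: "G (\<lambda>h. \<kappa> (?\<sigma> h)) = R * (b p * a q * (a s * b t))"
    by (subst Gv) (use ne in \<open>auto simp: \<kappa>_def a_def b_def transpose_def\<close>)
  have v3: "G (\<lambda>h. \<kappa> (?\<tau> h)) = R * (a p * b q * (b s * a t))"
    by (subst Gv) (use ne in \<open>auto simp: \<kappa>_def a_def b_def transpose_def\<close>)
  have v4: "G (\<lambda>h. \<kappa> (?\<tau> (?\<sigma> h))) = R * (b p * a q * (b s * a t))"
    by (subst Gv) (use ne in \<open>auto simp: \<kappa>_def a_def b_def transpose_def\<close>)
  have "R * ((a p * b q - a q * b p) * (a s * b t - a t * b s)) = 0"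
    using alt unfolding v1 v2 v3 v4 by (simp add: algebra_simps)
  moreover have "R \<noteq> 0"
  proof
    assume "R = 0"
    have "c i * (\<Prod>j<6. a j) = R * (a p * a q * a s * a t)"
      unfolding split R_def by (simp add: mult_ac)
    then have "c i * (\<Prod>j<6. a j) = 0" using \<open>R = 0\<close> by (simp only: mult_zero_left)
    then show False using zval_products(1)[OF conf] unfolding a_def by linarith
  qed
  ultimately show ?thesis by simp
qed

end

text \<open>Two different values at \<open>p\<close> and \<open>q\<close> force the other four to
  agree. Pairing \<open>p\<close> and \<open>q\<close> each with one of those four then shows that
  one of the two agrees with them as well. All six cannot agree, since a real sixth power is not
  -3.\<close>

lemma odd_slot:
  fixes t :: "nat \<Rightarrow> real"
  assumes minors: "\<And>p q s s'. \<lbrakk>p < 6; q < 6; s < 6; s' < 6; p \<noteq> q; p \<noteq> s; p \<noteq> s'; q \<noteq> s; q \<noteq> s'; s \<noteq> s'\<rbrakk>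
      \<Longrightarrow> (t p - t q) * (t s - t s') = 0"
    and prod: "(\<Prod>j<6. t j) = -3"
  shows "\<exists>p<6. \<exists>\<tau>. t p \<noteq> \<tau> \<and> (\<forall>j<6. j \<noteq> p \<longrightarrow> t j = \<tau>) \<and> t p * \<tau> ^ 5 = -3"
proof -
  have fin: ?thesis if "p < 6" "\<And>j. j < 6 \<Longrightarrow> j \<noteq> p \<Longrightarrow> t j = \<tau>" for p \<tau>
  proof -
    have "(\<Prod>j<6. t j) = t p * (\<Prod>j\<in>{..<6} - {p}. t j)"
      using that(1) by (subst prod.remove[of _ p]) auto
    also have "(\<Prod>j\<in>{..<6} - {p}. t j) = (\<Prod>j\<in>{..<6} - {p}. \<tau>)"
      using that(2) by (intro prod.cong) auto
    also have "\<dots> = \<tau> ^ 5" using that(1) by simp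
    finally have e: "t p * \<tau> ^ 5 = -3" using prod by simp
    have "t p \<noteq> \<tau>"
    proof
      assume "t p = \<tau>"
      then have "(\<tau> ^ 3)\<^sup>2 = -3" using e by (simp add: power_mult[symmetric] power_Suc[symmetric])
      then show False by (metis neg_numeral_le_zero not_numeral_le_zero zero_le_power2 neg_0_le_iff_le)
    qed
    then show ?thesis using that e by blast
  qed
  show ?thesis
  proof (cases "\<exists>p<6. \<exists>q<6. t p \<noteq> t q")
    case False
    have all: "t j = t 0" if "j < 6" for j
    proof (rule ccontr)
      assume "t j \<noteq> t 0"
      then have "\<exists>p<6. \<exists>q<6. t p \<noteq> t q" using that by (intro exI[of _ j] exI[of _ 0] conjI) simp_all
      then show False using False by contradiction
    qed
    show ?thesis by (rule fin[of 0 "t 0"], simp) (rule all)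
  next
    case True
    then obtain p q where pq: "p < 6" "q < 6" "t p \<noteq> t q" by auto
    then have "p \<noteq> q" by auto
    then have "card ({..<6} - {p, q}) = 4" using pq by (simp add: card_Diff_subset)
    then have "\<not> card ({..<6} - {p, q}) \<le> Suc 0" by simp
    then have "\<not> (\<forall>s\<in>{..<6} - {p, q}. \<forall>s'\<in>{..<6} - {p, q}. s = s')"
      by (subst (asm) card_le_Suc0_iff_eq) simp_all
    then obtain s s' where s: "s \<in> {..<6} - {p, q}" "s' \<in> {..<6} - {p, q}" "s \<noteq> s'" by blast
    have eq: "t j = t s" if "j \<in> {..<6} - {p, q}" for j
      using minors[of p q j s] that s pq \<open>p \<noteq> q\<close> by (cases "j = s") auto
    have "t p = t s \<or> t q = t s"
      using minors[of p s q s'] s pq \<open>p \<noteq> q\<close> eq[OF s(2)] by auto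
    then show ?thesis
    proof
      assume "t p = t s"
      then have all: "t j = t s" if "j < 6" "j \<noteq> q" for j using eq[of j] that by (cases "j = p") simp_all
      show ?thesis by (rule fin[of q "t s"], rule pq) (rule all)
    next
      assume "t q = t s"
      then have all: "t j = t s" if "j < 6" "j \<noteq> p" for j using eq[of j] that by (cases "j = q") simp_all
      show ?thesis by (rule fin[of p "t s"], rule pq) (rule all)
    qed
  qed
qed

section \<open>Exchanging the surplus term with a term of a basis\<close>

context sym_adj_decomposition
begin

lemma M_sum: "M j (\<lambda>w. \<Sum>b\<in>B. a b * d b w) i = (\<Sum>b\<in>B. a b * M j (d b) i)"
  unfolding M_def sum_distrib_left sum_distrib_right mult.assoc by (rule sum.swap)

lemma basis_finite: "basis j B \<Longrightarrow> finite B"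
  unfolding basis_def by (auto intro: finite_subset[of _ "{..<r}"])

definition dual :: "nat set \<Rightarrow> nat \<Rightarrow> 'w \<Rightarrow> real" where
  "dual B e = (SOME x. \<forall>b\<in>B. M 0 x b = of_bool (b = e))"

lemma dual: "\<lbrakk>basis 0 B; b \<in> B\<rbrakk> \<Longrightarrow> M 0 (dual B e) b = of_bool (b = e)"
  unfolding dual_def
  using someI_ex[OF basis_interpolate[of 0 B "\<lambda>b. of_bool (b = e)"]] by simp

lemma dual_expand:
  assumes B: "basis 0 B"
  shows "M 0 x i = (\<Sum>b\<in>B. M 0 x b * M 0 (dual B b) i)"
proof -
  have "M 0 x = M 0 (\<lambda>w. \<Sum>b\<in>B. M 0 x b * dual B b w)"
  proof (rule basis_determines[OF B])
    fix i assume i: "i \<in> B"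
    have "(\<Sum>b\<in>B. M 0 x b * M 0 (dual B b) i) = (\<Sum>b\<in>B. if b = i then M 0 x b else 0)"
      by (intro sum.cong refl) (simp add: dual[OF B i])
    also have "\<dots> = M 0 x i" using i basis_finite[OF B] by simp
    finally show "M 0 x i = M 0 (\<lambda>w. \<Sum>b\<in>B. M 0 x b * dual B b w) i" by (simp add: M_sum)
  qed
  then have "M 0 x i = M 0 (\<lambda>w. \<Sum>b\<in>B. M 0 x b * dual B b w) i" by (rule fun_cong)
  then show ?thesis by (simp only: M_sum)
qed

lemma card_exchange:
  assumes "finite B" "e \<in> B" "i \<notin> B"
  shows "card (insert i (B - {e})) = card B"
proof -
  have "card (insert i (B - {e})) = Suc (card (B - {e}))"
    using assms by (intro card_insert_disjoint) auto
  also have "\<dots> = card B" by (rule card_Suc_Diff1[OF assms(1,2)])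
  finally show ?thesis .
qed

text \<open>Steinitz exchange: \<open>M 0 (dual B e) i\<close> is the coordinate of the form of the
  term \<open>i\<close> along that of \<open>e\<close>.\<close>

lemma basis_swap:
  assumes B: "basis 0 B" and e: "e \<in> B" and i: "i < r" "i \<notin> B" and nz: "M 0 (dual B e) i \<noteq> 0"
  shows "basis 0 (insert i (B - {e}))"
proof -
  have "card (insert i (B - {e})) = card B"
    by (rule card_exchange[OF basis_finite[OF B] e i(2)])
  moreover have "\<forall>w\<in>W. x w = 0" if x: "\<forall>b\<in>insert i (B - {e}). M 0 x b = 0" for x
  proof -
    have "0 = M 0 x i" using x by simp
    also have "\<dots> = (\<Sum>b\<in>B. M 0 x b * M 0 (dual B b) i)" by (rule dual_expand[OF B])
    also have "\<dots> = M 0 x e * M 0 (dual B e) i + (\<Sum>b\<in>B - {e}. M 0 x b * M 0 (dual B b) i)"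
      by (rule sum.remove[OF basis_finite[OF B] e])
    also have "(\<Sum>b\<in>B - {e}. M 0 x b * M 0 (dual B b) i) = 0" using x by (intro sum.neutral) simp
    finally have "M 0 x e = 0" using nz by simp
    then have "\<forall>b\<in>B. M 0 x b = 0" using x by (metis Diff_iff insertCI singletonD)
    then show ?thesis using B unfolding basis_def by simp
  qed
  ultimately show ?thesis using B i(1) unfolding basis_def by auto
qed

text \<open>The fit for the new basis subtracts from the old one the multiple of
  \<open>dual B e\<close> that cancels the value at \<open>i\<close>. The resulting factor does not
  depend on \<open>y\<close>, so quotients of values in this slot pass unchanged from
  \<open>i\<close> to \<open>e\<close>.\<close>

lemma zval_swap:
  assumes B: "basis 0 B" and e: "e \<in> B" and i: "i < r" "i \<notin> B" and nz: "M 0 (dual B e) i \<noteq> 0"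
  shows "zval (insert i (B - {e})) e y = - zval B i y / M 0 (dual B e) i"
proof -
  define a where "a = zval B i y / M 0 (dual B e) i"
  have mm: "M 0 (\<lambda>w. fit B y w - a * dual B e w) b = M 0 (fit B y) b - a * M 0 (dual B e) b" for b
    by (simp only: M_diff M_scale)
  have ai: "a * M 0 (dual B e) i = zval B i y" using nz by (simp add: a_def)
  have "zval (insert i (B - {e})) e y = L 0 y e + M 0 (\<lambda>w. fit B y w - a * dual B e w) e"
  proof (rule zval_eq[OF basis_swap[OF assms]])
    fix b assume b: "b \<in> insert i (B - {e})"
    show "L 0 y b + M 0 (\<lambda>w. fit B y w - a * dual B e w) b = 0"
    proof (cases "b = i")
      case True
      then show ?thesis unfolding mm using ai by (simp add: zval_def)
    next
      case False
      then have "b \<in> B" "b \<noteq> e" using b by auto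
      then show ?thesis using zval_zero[OF B, of b y] dual[OF B, of b e]
        unfolding mm by (simp add: zval_def)
    qed
  qed
  also have "\<dots> = - a" using zval_zero[OF B e, of y] dual[OF B e, of e]
    unfolding mm by (simp add: zval_def)
  finally show ?thesis by (simp add: a_def)
qed

lemma config_swap:
  assumes conf: "config i I" and p: "p < 6" "e \<in> I p" and nz: "M 0 (dual (I p) e) i \<noteq> 0"
  shows "config e (I(p := insert i (I p - {e})))"
proof -
  note D = configD[OF conf]
  have e_lt: "e < r" using D(2)[OF p(1)] p(2) unfolding basis_def by auto
  have e_notin: "e \<notin> I j" if "j < 6" "j \<noteq> p" for j using D(3)[of j p] that p by auto
  have "e \<noteq> i" using D(4)[OF p(1)] p(2) by auto
  have union: "insert i (\<Union>j<6. I j) = insert e (\<Union>j<6. (I(p := insert i (I p - {e}))) j)" (is "?l = ?r")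
  proof
    show "?l \<subseteq> ?r"
    proof
      fix x assume "x \<in> ?l"
      then consider "x = i" | j where "j < 6" "x \<in> I j" by auto
      then show "x \<in> ?r"
      proof cases
        case 1
        then show ?thesis using p(1) by (auto intro!: bexI[of _ p])
      next
        case 2
        then show ?thesis by (cases "j = p") (auto intro!: bexI[of _ j])
      qed
    qed
    show "?r \<subseteq> ?l" using p by (auto split: if_splits)
  qed
  show ?thesis
    unfolding config_def
  proof (intro conjI allI impI)
    show "e < r" by (rule e_lt)
    show "basis 0 ((I(p := insert i (I p - {e}))) j)" if "j < 6" for j
      using basis_swap[OF D(2)[OF p(1)] p(2) D(1) D(4)[OF p(1)] nz] D(2)[OF that] by simp
    show "(I(p := insert i (I p - {e}))) j \<inter> (I(p := insert i (I p - {e}))) h = {}"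
      if "j < 6" "h < 6" "j \<noteq> h" for j h
      using D(3)[OF that] D(4)[OF that(1)] D(4)[OF that(2)] that by (auto split: if_splits)
    show "e \<notin> (I(p := insert i (I p - {e}))) j" if "j < 6" for j
      using e_notin[OF that] \<open>e \<noteq> i\<close> by simp
    show "{..<r} = insert e (\<Union>j<6. (I(p := insert i (I p - {e}))) j)"
      using D(5) union by (rule trans)
  qed
qed

end

section \<open>The terms reachable by exchanges\<close>

locale rooted_decomposition = sym_adj_decomposition +
  fixes i0 :: nat and I0 :: "nat \<Rightarrow> nat set"
  assumes root: "config i0 I0"
begin

text \<open>Swaps never leave the span of the set \<open>F\<close> of reachable surplus terms, so each basis meets \<open>F\<close> in a
  basis of that span, and a suitable modification makes the terms outside \<open>F\<close> disappear.\<close>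

inductive reach :: "nat \<Rightarrow> (nat \<Rightarrow> nat set) \<Rightarrow> bool" where
  start: "reach i0 I0"
| swap: "\<lbrakk>reach i I; p < 6; e \<in> I p; M 0 (dual (I p) e) i \<noteq> 0\<rbrakk> \<Longrightarrow>
    reach e (I(p := insert i (I p - {e})))"

definition F :: "nat set" where "F = {i. \<exists>I. reach i I}"

lemma reach_config: "reach i I \<Longrightarrow> config i I"
proof (induction rule: reach.induct)
  case (swap i I p e)
  show ?case by (rule config_swap[OF swap.IH swap.hyps(2-4)])
qed (rule root)

lemma reach_F: "reach i I \<Longrightarrow> i \<in> F"
  unfolding F_def by (rule CollectI) (rule exI)

lemma F_less: "i \<in> F \<Longrightarrow> i < r"
  unfolding F_def by (elim CollectE exE) (rule configD(1)[OF reach_config])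

lemma finite_F: "finite F"
  by (rule finite_subset[of _ "{..<r}"]) (auto simp: F_less)

text \<open>A basis term along which \<open>i\<close> has a nonzero coordinate can be exchanged for
  \<open>i\<close> and therefore lies in F. So the form of \<open>i\<close> is a combination of
  those in \<open>I j \<inter> F\<close>.\<close>

lemma reach_span:
  assumes re: "reach i I" and j: "j < 6" and x: "\<And>b. b \<in> I j \<Longrightarrow> b \<in> F \<Longrightarrow> M 0 x b = 0"
  shows "M 0 x i = 0"
proof -
  have B: "basis 0 (I j)" using configD(2)[OF reach_config[OF re] j] .
  have "M 0 x b * M 0 (dual (I j) b) i = 0" if "b \<in> I j" for b
  proof (cases "M 0 (dual (I j) b) i = 0")
    case False
    then have "b \<in> F" using reach_F[OF reach.swap[OF re j that]] by simp
    then show ?thesis using x[OF that] by simp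
  qed simp
  then have "(\<Sum>b\<in>I j. M 0 x b * M 0 (dual (I j) b) i) = 0" by (intro sum.neutral) simp
  then show ?thesis by (simp only: dual_expand[OF B, of x i])
qed

text \<open>Vanishing on \<open>I j \<inter> F\<close> is inherited along exchanges, because
  \<open>reach_span\<close> supplies the value at the term that enters the basis.\<close>

lemma F_det:
  assumes j: "j < 6" and x: "\<And>b. b \<in> I0 j \<Longrightarrow> b \<in> F \<Longrightarrow> M 0 x b = 0" and i: "i \<in> F"
  shows "M 0 x i = 0"
proof -
  have inv: "\<forall>b\<in>I j \<inter> F. M 0 x b = 0" if "reach i I" for i I
    using that
  proof (induction rule: reach.induct)
    case start
    show ?case using x by simp
  next
    case (swap i I p e)
    have "M 0 x i = 0" using reach_span[OF swap.hyps(1) j] swap.IH by simp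
    then show ?case using swap.IH by (cases "j = p") auto
  qed
  obtain I where re: "reach i I" using i unfolding F_def by (elim CollectE exE)
  show ?thesis using reach_span[OF re j] inv[OF re] by simp
qed

lemma reach_card:
  assumes "reach i I" "j < 6"
  shows "card (I j \<inter> F) = card (I0 j \<inter> F)"
  using assms
proof (induction rule: reach.induct)
  case (swap i I p e)
  show ?case
  proof (cases "j = p")
    case True
    have e: "e \<in> F" using reach_F[OF reach.swap[OF swap.hyps]] .
    have i: "i \<in> F" "i \<notin> I p"
      using reach_F[OF swap.hyps(1)] configD(4)[OF reach_config[OF swap.hyps(1)] swap.hyps(2)] .
    have "insert i (I p - {e}) \<inter> F = insert i (I p \<inter> F - {e})" using i by auto
    moreover have "card (insert i (I p \<inter> F - {e})) = card (I p \<inter> F)"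
      by (rule card_exchange) (use i e swap.hyps(3) finite_F in simp_all)
    ultimately show ?thesis using True swap by simp
  qed (use swap in simp)
qed simp

definition s :: nat where "s = card (I0 0 \<inter> F)"

text \<open>Together with the terms of \<open>I0 j\<close> outside F, the set B determines
  \<open>x\<close> on all of \<open>I0 j\<close> and hence on W, so at least \<open>card W\<close>
  terms are involved.\<close>

lemma det_card:
  assumes B: "finite B" "\<And>x. (\<forall>i\<in>B. M 0 x i = 0) \<Longrightarrow> (\<forall>i\<in>F. M 0 x i = 0)" and j: "j < 6"
  shows "card (I0 j \<inter> F) \<le> card B"
proof -
  have bas: "basis 0 (I0 j)" using configD(2)[OF root j] .
  then have fin: "finite (I0 j)" by (rule basis_finite)
  have "card W \<le> card (B \<union> (I0 j - F))"
  proof (rule card_injective_ge[of _ W "\<lambda>i w. V i (Inr w)"])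
    show "\<forall>x. (\<forall>i\<in>B \<union> (I0 j - F). (\<Sum>w\<in>W. x w * V i (Inr w)) = 0) \<longrightarrow> (\<forall>w\<in>W. x w = 0)"
    proof (intro allI impI)
      fix x assume "\<forall>i\<in>B \<union> (I0 j - F). (\<Sum>w\<in>W. x w * V i (Inr w)) = 0"
      then have x: "\<forall>i\<in>B \<union> (I0 j - F). M 0 x i = 0" by (simp add: M_def)
      then have "\<forall>i\<in>F. M 0 x i = 0" by (intro B(2)) simp
      then have "\<forall>i\<in>I0 j. M 0 x i = 0" using x by (metis DiffI UnI2)
      then show "\<forall>w\<in>W. x w = 0" using bas unfolding basis_def by simp
    qed
  qed (use B(1) fin finW in simp_all)
  also have "\<dots> \<le> card B + card (I0 j - F)" by (rule card_Un_le)
  finally have "card (I0 j) \<le> card B + card (I0 j - F)" using bas by (simp add: basis_def)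
  moreover have "card (I0 j) = card (I0 j \<inter> F) + card (I0 j - F)"
    using fin by (metis card_Int_Diff)
  ultimately show ?thesis by simp
qed

lemma card_part: "j < 6 \<Longrightarrow> card (I0 j \<inter> F) = s"
proof -
  have le: "card (I0 h \<inter> F) \<le> card (I0 k \<inter> F)" if "h < 6" "k < 6" for h k
  proof (rule det_card[OF _ _ that(1)])
    show "finite (I0 k \<inter> F)" using finite_F by simp
    show "\<forall>i\<in>F. M 0 x i = 0" if "\<forall>i\<in>I0 k \<inter> F. M 0 x i = 0" for x
      using F_det[OF \<open>k < 6\<close>, of x] that by simp
  qed
  assume "j < 6"
  then show ?thesis unfolding s_def using le[of j 0] le[of 0 j] by simp
qed

lemma F_partition: "F = insert i0 (\<Union>j<6. I0 j \<inter> F)"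
proof
  show "F \<subseteq> insert i0 (\<Union>j<6. I0 j \<inter> F)"
  proof
    fix i assume i: "i \<in> F"
    then have "i \<in> insert i0 (\<Union>j<6. I0 j)" using F_less configD(5)[OF root] by auto
    then show "i \<in> insert i0 (\<Union>j<6. I0 j \<inter> F)" using i by simp
  qed
  show "insert i0 (\<Union>j<6. I0 j \<inter> F) \<subseteq> F" using reach_F[OF reach.start] by auto
qed

lemma card_F: "card F = 6 * s + 1"
proof -
  have "card (\<Union>j<6. I0 j \<inter> F) = (\<Sum>j<6. card (I0 j \<inter> F))"
    by (rule card_UN_disjoint) (use finite_F configD(3)[OF root] in auto)
  also have "\<dots> = (\<Sum>j<6::nat. s)" by (intro sum.cong refl card_part) simp
  finally have "card (\<Union>j<6. I0 j \<inter> F) = 6 * s" by simp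
  moreover have "i0 \<notin> (\<Union>j<6. I0 j \<inter> F)" using configD(4)[OF root] by auto
  moreover have "finite (\<Union>j<6. I0 j \<inter> F)" using finite_F by simp
  ultimately have "card (insert i0 (\<Union>j<6. I0 j \<inter> F)) = 6 * s + 1" by simp
  then show ?thesis by (simp only: F_partition[symmetric])
qed

lemma lift_outside:
  assumes "j < 6"
  shows "\<exists>\<rho>. (\<forall>i\<in>F. M 0 \<rho> i = 0) \<and> (\<forall>i\<in>I0 j - F. M 0 \<rho> i = g i)"
proof -
  obtain \<rho> where \<rho>: "\<forall>i\<in>I0 j. M 0 \<rho> i = (if i \<in> F then 0 else g i)"
    using basis_interpolate[OF configD(2)[OF root assms]] by (rule exE)
  have "M 0 \<rho> i = 0" if "i \<in> F" for i by (rule F_det[OF assms _ that]) (use \<rho> in simp)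
  then show ?thesis using \<rho> by (intro exI[of _ \<rho>]) simp
qed

text \<open>The corrections \<open>\<rho> j\<close> annihilate the terms outside F in the slots 1 to
  5 and are invisible on F; in slot 0 the hypothesis on \<open>x\<close> does the same. As slot 0
  has no part on the original indices, every modification in another slot has a zero factor, so
  neither \<open>z\<close> nor \<open>\<rho>\<close> leaves a trace on the right.\<close>

lemma F_form:
  fixes y :: "nat \<Rightarrow> nat \<Rightarrow> real" and z :: "nat \<Rightarrow> 'a \<Rightarrow> real"
  assumes x: "\<And>i. i \<in> I0 0 - F \<Longrightarrow> M 0 x i = 0"
  shows "(\<Sum>i\<in>F. c i * (M 0 x i * (\<Prod>j\<in>{..<6} - {0}. L 0 (y j) i + M 0 (z j) i))) =
     (\<Sum>w\<in>W. x w * (\<Prod>j\<in>{..<6} - {0}. U w (y j)))"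
proof -
  have "\<forall>j\<in>{..<6}. \<exists>\<rho>. (\<forall>i\<in>F. M 0 \<rho> i = 0) \<and>
      (\<forall>i\<in>I0 j - F. M 0 \<rho> i = - (L 0 (y j) i + M 0 (z j) i))"
    using lift_outside by simp
  from bchoice[OF this] obtain \<rho> where \<rho>:
    "\<forall>j\<in>{..<6}. (\<forall>i\<in>F. M 0 (\<rho> j) i = 0) \<and> (\<forall>i\<in>I0 j - F. M 0 (\<rho> j) i = - (L 0 (y j) i + M 0 (z j) i))" ..
  define y' where "y' j = (if j = 0 then (\<lambda>_. 0) else y j)" for j
  define x' where "x' j = (if j = 0 then x else (\<lambda>w. z j w + \<rho> j w))" for j
  let ?P = "\<lambda>i. \<Prod>j<6. L j (y' j) i + M j (x' j) i"
  have row: "L j (y' j) i + M j (x' j) i = (if j = 0 then M 0 x i else L 0 (y j) i + M 0 (z j) i + M 0 (\<rho> j) i)"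
    for i j
    by (simp add: L_slot[of j] M_slot[of j] x'_def y'_def M_add) (simp add: L_def)
  have split: "?P i = M 0 x i * (\<Prod>j\<in>{..<6} - {0}. L 0 (y j) i + M 0 (z j) i + M 0 (\<rho> j) i)" for i
    unfolding row by (subst prod.remove[of _ 0]) simp_all
  have out: "?P i = 0" if i: "i \<in> {..<r} - F" for i
  proof -
    have "i \<in> (\<Union>j<6. I0 j)" using i configD(5)[OF root] reach_F[OF reach.start] by auto
    then obtain j where j: "j \<in> {..<6}" "i \<in> I0 j" by (rule UN_E)
    have "L j (y' j) i + M j (x' j) i = 0"
    proof (cases "j = 0")
      case True
      then show ?thesis unfolding row using x i j by simp
    next
      case False
      then show ?thesis unfolding row using \<rho> i j by simp
    qed
    then show ?thesis using j(1) by (intro prod_zero) auto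
  qed
  have ins: "?P i = M 0 x i * (\<Prod>j\<in>{..<6} - {0}. L 0 (y j) i + M 0 (z j) i)" if "i \<in> F" for i
    unfolding split using \<rho> that by (intro arg_cong2[of _ _ _ _ "(*)"] prod.cong refl) simp
  have "(\<Sum>i\<in>F. c i * (M 0 x i * (\<Prod>j\<in>{..<6} - {0}. L 0 (y j) i + M 0 (z j) i))) = (\<Sum>i\<in>F. c i * ?P i)"
    by (intro sum.cong refl) (simp only: ins)
  also have "\<dots> = (\<Sum>i<r. c i * ?P i)"
  proof (rule sum.mono_neutral_left)
    show "\<forall>i\<in>{..<r} - F. c i * ?P i = 0" by (intro ballI) (simp only: out mult_zero_right)
    show "F \<subseteq> {..<r}" using F_less by auto
  qed simp
  also have "\<dots> = (\<Sum>j<6. \<Sum>w\<in>W. x' j w * (\<Prod>h\<in>{..<6} - {j}. U w (y' h)))"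
  proof -
    have p1: "(\<Prod>j<6. X1 (y' j)) = 0"
      by (rule prod_zero, simp, rule bexI[of _ 0]) (simp_all add: y'_def X_zero)
    have p2: "(\<Prod>j<6. X2 (y' j)) = 0"
      by (rule prod_zero, simp, rule bexI[of _ 0]) (simp_all add: y'_def X_zero)
    show ?thesis unfolding multilinear p1 p2 by simp
  qed
  also have "\<dots> = (\<Sum>j<6::nat. if j = 0 then \<Sum>w\<in>W. x w * (\<Prod>j\<in>{..<6} - {0}. U w (y j)) else 0)"
  proof (intro sum.cong refl)
    fix j :: nat assume "j \<in> {..<6}"
    show "(\<Sum>w\<in>W. x' j w * (\<Prod>h\<in>{..<6} - {j}. U w (y' h))) =
      (if j = 0 then \<Sum>w\<in>W. x w * (\<Prod>j\<in>{..<6} - {0}. U w (y j)) else 0)"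
    proof (cases "j = 0")
      case True
      have "(\<Prod>h\<in>{..<6} - {0}. U w (y' h)) = (\<Prod>h\<in>{..<6} - {0}. U w (y h))" for w
        by (intro prod.cong) (auto simp: y'_def)
      then show ?thesis using True by (simp add: x'_def)
    next
      case False
      have "(\<Prod>h\<in>{..<6} - {j}. U w (y' h)) = 0" for w
        by (rule prod_zero, simp, rule bexI[of _ 0]) (use False in \<open>simp_all add: y'_def U_zero\<close>)
      then show ?thesis using False by (simp only: mult_zero_right sum.neutral_const if_False)
    qed
  qed
  also have "\<dots> = (\<Sum>w\<in>W. x w * (\<Prod>j\<in>{..<6} - {0}. U w (y j)))" by simp
  finally show ?thesis .
qed

text \<open>One fit, made for the initial basis, works everywhere. If the modified difference
  vanishes on the current basis of slot 0, then by \<open>zval_const\<close> it also vanishes at the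
  surplus term, hence on the basis after an exchange.\<close>

lemma difference_vanishes:
  assumes k: "k \<in> {1..14} \<and> k' \<in> {1..14} \<or> k \<in> {15..28} \<and> k' \<in> {15..28}"
  shows "\<exists>z. \<forall>i\<in>F. L 0 (\<lambda>a. \<delta> k a - \<delta> k' a) i + M 0 z i = 0"
proof -
  let ?y = "\<lambda>a. \<delta> k a - \<delta> k' a"
  have eq: "zval (I 0) i (\<delta> k) = zval (I 0) i (\<delta> k')" if conf: "config i I" for i I
    using k
  proof
    assume "k \<in> {1..14} \<and> k' \<in> {1..14}"
    then show ?thesis using zval_const(1)[OF conf, of 0 k] zval_const(1)[OF conf, of 0 k'] by simp
  next
    assume "k \<in> {15..28} \<and> k' \<in> {15..28}"
    then have "k - 14 \<in> {1..14}" "k' - 14 \<in> {1..14}" "k - 14 + 14 = k" "k' - 14 + 14 = k'" by auto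
    then show ?thesis
      using zval_const(2)[OF conf, of 0 "k - 14"] zval_const(2)[OF conf, of 0 "k' - 14"] by simp
  qed
  define \<phi> where "\<phi> i = L 0 ?y i + M 0 (fit (I0 0) ?y) i" for i
  have last: "\<phi> i = 0" if conf: "config i I" and b: "\<And>b. b \<in> I 0 \<Longrightarrow> \<phi> b = 0" for i I
  proof -
    have bas: "basis 0 (I 0)" using configD(2)[OF conf, of 0] by simp
    have "zval (I 0) i ?y = L 0 ?y i + M 0 (fit (I0 0) ?y) i"
      by (rule zval_eq[OF bas]) (use b in \<open>simp add: \<phi>_def\<close>)
    then have "\<phi> i = zval (I 0) i ?y" by (simp add: \<phi>_def)
    then show ?thesis using eq[OF conf] by (simp add: zval_diff[OF bas])
  qed
  have "\<forall>b\<in>I 0. \<phi> b = 0" if "reach i I" for i I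
    using that
  proof (induction rule: reach.induct)
    case start
    have "basis 0 (I0 0)" using configD(2)[OF root, of 0] by simp
    then show ?case using zval_zero[of "I0 0" _ ?y] by (simp add: \<phi>_def zval_def)
  next
    case (swap i I p e)
    have "\<phi> i = 0" by (rule last[OF reach_config[OF swap.hyps(1)]]) (use swap.IH in simp)
    then show ?case using swap.IH by (cases "p = 0") auto
  qed
  then have "\<phi> i = 0" if "reach i I" for i I
    using last[OF reach_config[OF that]] that by simp
  then have "\<forall>i\<in>F. \<phi> i = 0" unfolding F_def by (intro ballI, elim CollectE exE)
  then show ?thesis unfolding \<phi>_def by (intro exI[of _ "fit (I0 0) ?y"])
qed

definition omega :: "('a \<Rightarrow> real) \<Rightarrow> (nat \<Rightarrow> nat) \<Rightarrow> real" where
  "omega x \<kappa> = (\<Sum>w\<in>W. x w * (\<Prod>j\<in>{..<6} - {0}. u w (\<kappa> j)))"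

lemma omega_cong: "(\<And>j. j \<in> {..<6} - {0} \<Longrightarrow> \<kappa> j = \<kappa>' j) \<Longrightarrow> omega x \<kappa> = omega x \<kappa>'"
  unfolding omega_def by (intro sum.cong prod.cong arg_cong2[of _ _ _ _ "(*)"] refl) simp

text \<open>This is \<open>F_form\<close> with \<open>\<delta> k - t \<delta> k'\<close> in slot
  \<open>j\<close>. The hypothesis \<open>van\<close> says that every term of F is annihilated by
  slot 0, by slot \<open>j\<close>, or by one of the other four slots.\<close>

lemma omega_contract:
  fixes z :: "nat \<Rightarrow> 'a \<Rightarrow> real"
  assumes x: "\<And>i. i \<in> I0 0 - F \<Longrightarrow> M 0 x i = 0"
    and j: "j \<in> {..<6} - {0}" and \<kappa>: "\<And>h. h \<in> {..<6} - {0} \<Longrightarrow> \<kappa> h \<in> {1..28}"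
    and k: "k \<in> {1..28}" "k' \<in> {1..28}"
    and van: "\<And>i. i \<in> F \<Longrightarrow> M 0 x i = 0 \<or> L 0 (\<lambda>a. \<delta> k a - t * \<delta> k' a) i + M 0 (z j) i = 0 \<or>
      (\<exists>h\<in>{..<6} - {0} - {j}. L 0 (\<delta> (\<kappa> h)) i + M 0 (z h) i = 0)"
  shows "omega x (\<kappa>(j := k)) = t * omega x (\<kappa>(j := k'))"
proof -
  let ?A = "{..<6} - {0::nat}"
  define y where "y h = (if h = j then (\<lambda>a. \<delta> k a - t * \<delta> k' a) else \<delta> (\<kappa> h))" for h
  have "M 0 x i * (\<Prod>h\<in>?A. L 0 (y h) i + M 0 (z h) i) = 0" if iF: "i \<in> F" for i
  proof (cases "M 0 x i = 0")
    case False
    then have "L 0 (\<lambda>a. \<delta> k a - t * \<delta> k' a) i + M 0 (z j) i = 0 \<or>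
      (\<exists>h\<in>?A - {j}. L 0 (\<delta> (\<kappa> h)) i + M 0 (z h) i = 0)" using van[OF iF] by simp
    then have "\<exists>h\<in>?A. L 0 (y h) i + M 0 (z h) i = 0"
    proof
      assume "L 0 (\<lambda>a. \<delta> k a - t * \<delta> k' a) i + M 0 (z j) i = 0"
      then show ?thesis by (intro bexI[OF _ j]) (simp add: y_def)
    next
      assume "\<exists>h\<in>?A - {j}. L 0 (\<delta> (\<kappa> h)) i + M 0 (z h) i = 0"
      then obtain h where h: "h \<in> ?A - {j}" "L 0 (\<delta> (\<kappa> h)) i + M 0 (z h) i = 0" by (rule bexE)
      then show ?thesis by (intro bexI[of _ h]) (simp_all add: y_def)
    qed
    then have "(\<Prod>h\<in>?A. L 0 (y h) i + M 0 (z h) i) = 0" by (intro prod_zero) simp_all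
    then show ?thesis by (simp only: mult_zero_right)
  qed (simp only: mult_zero_left)
  then have "(\<Sum>i\<in>F. c i * (M 0 x i * (\<Prod>h\<in>?A. L 0 (y h) i + M 0 (z h) i))) = 0"
    by (intro sum.neutral ballI) (simp only: mult_zero_right)
  then have "(\<Sum>w\<in>W. x w * (\<Prod>h\<in>?A. U w (y h))) = 0" using F_form[OF x] by simp
  moreover have "(\<Prod>h\<in>?A. U w (y h)) =
      (\<Prod>h\<in>?A. u w ((\<kappa>(j := k)) h)) - t * (\<Prod>h\<in>?A. u w ((\<kappa>(j := k')) h))" for w
  proof -
    have sp: "(\<Prod>h\<in>?A. f h) = f j * (\<Prod>h\<in>?A - {j}. f h)" for f :: "nat \<Rightarrow> real"
      using j by (intro prod.remove) simp_all
    have r1: "(\<Prod>h\<in>?A - {j}. U w (y h)) = (\<Prod>h\<in>?A - {j}. u w (\<kappa> h))"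
      by (intro prod.cong refl) (use \<kappa> in \<open>simp add: y_def U_delta\<close>)
    have r2: "(\<Prod>h\<in>?A - {j}. u w ((\<kappa>(j := a)) h)) = (\<Prod>h\<in>?A - {j}. u w (\<kappa> h))" for a
      by (intro prod.cong refl) simp
    have uj: "U w (y j) = u w k - t * u w k'" using k by (simp add: y_def U_diff U_scale U_delta)
    show ?thesis unfolding sp r1 r2 uj by (simp add: left_diff_distrib mult.assoc)
  qed
  ultimately have "(\<Sum>w\<in>W. x w * ((\<Prod>h\<in>?A. u w ((\<kappa>(j := k)) h)) - t * (\<Prod>h\<in>?A. u w ((\<kappa>(j := k')) h)))) = 0"
    by (simp only:)
  then show ?thesis unfolding omega_def
    by (simp only: right_diff_distrib sum_subtractf sum_distrib_left mult.left_commute[of t])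
qed

lemma omega_odds: "omega x odds = 0"
proof -
  have "(\<Prod>j\<in>{..<6} - {0}. u w (odds j)) = 0" if "w \<in> W" for w
  proof -
    let ?P = "odds ` ({..<6} - {0})"
    have i: "inj_on (pair_cls \<circ> odds) ({..<6} - {0})" "inj_on (shift_cls \<circ> odds) ({..<6} - {0})"
      unfolding comp_def
      by (rule inj_on_subset[OF odds_spread(2) Diff_subset], rule inj_on_subset[OF odds_spread(3) Diff_subset])
    have "card ?P = 5" by (subst card_image[OF inj_on_imageI2[OF i(1)]]) simp
    moreover have "?P \<subseteq> {1..14}" using odds_spread(1) by auto
    ultimately have "\<exists>p\<in>?P. u w p = 0"
      using sparse[OF that, of ?P] inj_on_imageI[OF i(1)] inj_on_imageI[OF i(2)] by simp
    then have "\<exists>j\<in>{..<6} - {0}. u w (odds j) = 0" by (elim bexE imageE) auto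
    then show ?thesis by (intro prod_zero) simp_all
  qed
  then show ?thesis unfolding omega_def by (intro sum.neutral ballI) (simp only: mult_zero_right)
qed

text \<open>By \<open>step\<close> the quintic tensor is a multiple of the fifth power of X + t Y.
  The multiple is its entry at \<open>odds\<close>, which vanishes because each element of W
  does.\<close>

lemma omega_zero:
  assumes step: "\<And>\<kappa> j k. \<lbrakk>j \<in> {..<6} - {0}; \<And>h. h \<in> {..<6} - {0} \<Longrightarrow> \<kappa> h \<in> {1..28}; k \<in> {1..28}\<rbrakk> \<Longrightarrow>
      omega x (\<kappa>(j := k)) = (if k \<le> 14 then 1 else t) * omega x (\<kappa>(j := 1))"
    and \<kappa>: "\<And>h. h \<in> {..<6} - {0} \<Longrightarrow> \<kappa> h \<in> {1..28}"
  shows "omega x \<kappa> = 0"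
proof -
  define \<theta> where "\<theta> k = (if k \<le> (14::nat) then 1 else t)" for k
  have gen: "omega x \<kappa> = (\<Prod>j\<in>T. \<theta> (\<kappa> j)) * omega x (\<lambda>h. if h \<in> T then 1 else \<kappa> h)"
    if "finite T" "T \<subseteq> {..<6} - {0}" and \<kappa>: "\<And>h. h \<in> {..<6} - {0} \<Longrightarrow> \<kappa> h \<in> {1..28}" for T \<kappa>
    using that(1,2)
  proof (induction T rule: finite_induct)
    case (insert j T)
    let ?\<mu> = "\<lambda>h. if h \<in> T then 1 else \<kappa> h"
    have "omega x (?\<mu>(j := \<kappa> j)) = (if \<kappa> j \<le> 14 then 1 else t) * omega x (?\<mu>(j := 1))"
      using insert.prems \<kappa> by (intro step) auto
    moreover have "?\<mu>(j := \<kappa> j) = ?\<mu>" using insert.hyps by auto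
    moreover have "?\<mu>(j := 1) = (\<lambda>h. if h \<in> insert j T then 1 else \<kappa> h)" by auto
    ultimately have "omega x ?\<mu> = \<theta> (\<kappa> j) * omega x (\<lambda>h. if h \<in> insert j T then 1 else \<kappa> h)"
      by (simp only: \<theta>_def)
    then show ?case using insert by (simp add: mult.assoc mult.left_commute)
  qed simp
  have one: "omega x \<kappa> = (\<Prod>j\<in>{..<6} - {0}. \<theta> (\<kappa> j)) * omega x (\<lambda>h. 1)"
    if \<kappa>: "\<And>h. h \<in> {..<6} - {0} \<Longrightarrow> \<kappa> h \<in> {1..28}" for \<kappa>
  proof -
    have "omega x (\<lambda>h. if h \<in> {..<6} - {0} then 1 else \<kappa> h) = omega x (\<lambda>h. 1)"
      by (rule omega_cong) simp
    then show ?thesis using gen[of "{..<6} - {0}" \<kappa>] \<kappa> by simp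
  qed
  have "(\<Prod>j\<in>{..<6} - {0}. \<theta> (odds j)) = 1"
    using odds_spread(1) by (intro prod.neutral) (simp add: \<theta>_def)
  moreover have "odds h \<in> {1..28}" if "h \<in> {..<6} - {0}" for h
    using odds_spread(1)[of h] that by simp
  ultimately have "omega x (\<lambda>h. 1) = 0" using one[of odds] omega_odds by simp
  then show ?thesis using one[of \<kappa>] \<kappa> by simp
qed

text \<open>Contraction with \<open>y\<^sub>1\<^sub>5 - t y\<^sub>1\<close> is injective on the part of the span of \<open>W\<close> seen by \<open>F\<close>, so
  the terms of \<open>F\<close> on which a modified row does not vanish still contain five disjoint bases.\<close>

lemma zero_bound:
  "card {i \<in> F. L 0 (\<lambda>a. \<delta> 15 a - t * \<delta> 1 a) i + M 0 \<rho> i = 0} \<le> s + 1"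
proof -
  let ?f = "\<lambda>a. \<delta> 15 a - t * \<delta> 1 a"
  let ?A = "{..<6} - {0::nat}"
  define Z where "Z = {i \<in> F. L 0 ?f i + M 0 \<rho> i = 0}"
  define Q where "Q = F - Z"
  define good where "good B \<longleftrightarrow> finite B \<and> (\<forall>x. (\<forall>i\<in>B. M 0 x i = 0) \<longrightarrow> (\<forall>i\<in>F. M 0 x i = 0)) \<and>
     (\<forall>g. \<exists>x. \<forall>i\<in>B. M 0 x i = g i)" for B
  have finQ: "finite Q" using finite_F by (simp add: Q_def)
  have "\<exists>B. (\<forall>j<5::nat. B j \<subseteq> Q \<and> good (B j)) \<and> (\<forall>j<5. \<forall>h<5. j \<noteq> h \<longrightarrow> B j \<inter> B h = {})"
  proof (rule greedy_disjoint)
    fix h :: nat and B assume h: "h < 5" and B: "\<And>j. j < h \<Longrightarrow> good (B j)"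
    let ?R = "Q - (\<Union>j<h. B j)"
    have det: "\<forall>i\<in>F. M 0 x' i = 0" if x': "\<forall>i\<in>?R. M 0 x' i = 0" for x'
    proof -
      \<comment> \<open>\<open>F_form\<close> requires a vanishing form on \<open>I0 0 - F\<close>;
        the correction achieves this and leaves the values on F unchanged.\<close>
      obtain \<rho>' where \<rho>': "\<forall>i\<in>F. M 0 \<rho>' i = 0" "\<forall>i\<in>I0 0 - F. M 0 \<rho>' i = - M 0 x' i"
        using lift_outside[of 0 "\<lambda>i. - M 0 x' i"] by auto
      define x where "x w = x' w + \<rho>' w" for w
      have xF: "M 0 x i = M 0 x' i" if "i \<in> F" for i
        using \<rho>'(1) that by (simp add: x_def[abs_def] M_add)
      have xo: "M 0 x i = 0" if "i \<in> I0 0 - F" for i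
        using \<rho>'(2) that by (simp add: x_def[abs_def] M_add)
      have contr: "omega x (\<kappa>(j := 15)) = t * omega x (\<kappa>(j := 1))"
        if j: "j \<in> ?A" and \<kappa>: "\<And>h. h \<in> ?A \<Longrightarrow> \<kappa> h \<in> {1..28}" for j \<kappa>
      proof -
        \<comment> \<open>Slot 0 carries \<open>x\<close> and slot \<open>j\<close> the contraction.
          Four slots remain, just enough to switch off the at most four sets chosen so far;
          \<open>e\<close> assigns slots to sets.\<close>
        have "card (?A - {j}) = card {..<4::nat}" using j by simp
        then obtain e where e: "bij_betw e (?A - {j}) {..<4::nat}"
          using finite_same_card_bij[of "?A - {j}" "{..<4::nat}"] by auto
        have "\<forall>h'\<in>?A. \<exists>z. e h' < h \<longrightarrow> (\<forall>i\<in>B (e h'). M 0 z i = - L 0 (\<delta> (\<kappa> h')) i)"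
          using B unfolding good_def by simp
        from bchoice[OF this] obtain z where
          z: "\<forall>h'\<in>?A. e h' < h \<longrightarrow> (\<forall>i\<in>B (e h'). M 0 (z h') i = - L 0 (\<delta> (\<kappa> h')) i)" ..
        show ?thesis
        proof (rule omega_contract[where z = "z(j := \<rho>)"])
          fix i assume i: "i \<in> F"
          consider "i \<in> Z" | "i \<in> ?R" | j' where "j' < h" "i \<in> B j'"
            using i by (auto simp: Q_def)
          then show "M 0 x i = 0 \<or> L 0 ?f i + M 0 ((z(j := \<rho>)) j) i = 0 \<or>
            (\<exists>h\<in>?A - {j}. L 0 (\<delta> (\<kappa> h)) i + M 0 ((z(j := \<rho>)) h) i = 0)"
          proof cases
            case 1
            then show ?thesis by (simp add: Z_def)
          next
            case 2
            then show ?thesis using x' xF[OF i] by simp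
          next
            case 3
            then have "j' \<in> {..<4}" using h by simp
            then have "j' \<in> e ` (?A - {j})" using bij_betw_imp_surj_on[OF e] by simp
            then obtain h' where h': "j' = e h'" "h' \<in> ?A - {j}" by (rule imageE)
            then have "L 0 (\<delta> (\<kappa> h')) i + M 0 ((z(j := \<rho>)) h') i = 0" using z 3 by simp
            then show ?thesis using h'(2) by (intro disjI2 bexI)
          qed
        qed (use xo j \<kappa> in simp_all)
      qed
      have same: "omega x (\<kappa>(j := k)) = omega x (\<kappa>(j := k'))"
        if j: "j \<in> ?A" and \<kappa>: "\<And>h. h \<in> ?A \<Longrightarrow> \<kappa> h \<in> {1..28}"
          and k: "k \<in> {1..14} \<and> k' \<in> {1..14} \<or> k \<in> {15..28} \<and> k' \<in> {15..28}" for j \<kappa> k k'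
      proof -
        obtain z where z: "\<forall>i\<in>F. L 0 (\<lambda>a. \<delta> k a - \<delta> k' a) i + M 0 z i = 0"
          using difference_vanishes[OF k] by (rule exE)
        have "omega x (\<kappa>(j := k)) = 1 * omega x (\<kappa>(j := k'))"
          by (rule omega_contract[where z = "\<lambda>_. z"]) (use xo j \<kappa> k z in auto)
        then show ?thesis by simp
      qed
      have "omega x \<kappa> = 0" if \<kappa>: "\<And>h. h \<in> ?A \<Longrightarrow> \<kappa> h \<in> {1..28}" for \<kappa>
      proof (rule omega_zero[where t = t])
        fix \<kappa> :: "nat \<Rightarrow> nat" and j k :: nat
        assume j: "j \<in> ?A" and \<kappa>: "\<And>h. h \<in> ?A \<Longrightarrow> \<kappa> h \<in> {1..28}" and k: "k \<in> {1..28}"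
        show "omega x (\<kappa>(j := k)) = (if k \<le> 14 then 1 else t) * omega x (\<kappa>(j := 1))"
        proof (cases "k \<le> 14")
          case True
          then show ?thesis using same[OF j \<kappa>, where k = k and k' = 1] k by simp
        next
          case False
          then show ?thesis using same[OF j \<kappa>, where k = k and k' = 15] contr[OF j \<kappa>] k by simp
        qed
      qed (rule that)
      then have "\<forall>w\<in>W. x w = 0"
        by (intro indep_slot[of 0]) (simp_all only: omega_def zero_less_numeral)
      then have "M 0 x i = 0" for i by (rule M_zero)
      then show ?thesis using xF by simp
    qed
    then have "\<forall>x. (\<forall>i\<in>?R. (\<Sum>w\<in>W. x w * V i (Inr w)) = 0) \<longrightarrow> (\<forall>i\<in>F. M 0 x i = 0)"
      by (simp add: M_def)
    from interpolating_subset[OF _ this] finQ obtain B' where B': "B' \<subseteq> ?R"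
      "\<forall>x. (\<forall>i\<in>B'. (\<Sum>w\<in>W. x w * V i (Inr w)) = 0) \<longrightarrow> (\<forall>i\<in>F. M 0 x i = 0)"
      "\<forall>g. \<exists>x. \<forall>i\<in>B'. (\<Sum>w\<in>W. x w * V i (Inr w)) = g i" by auto
    have "finite B'" using B'(1) finQ by (meson finite_Diff finite_subset)
    then have "good B'" using B'(2,3) by (simp add: good_def M_def)
    then show "\<exists>B'\<subseteq>?R. good B'" using B'(1) by (intro exI conjI)
  qed
  then obtain B where B: "\<forall>j<5::nat. B j \<subseteq> Q \<and> good (B j)"
    and dis: "\<forall>j<5. \<forall>h<5. j \<noteq> h \<longrightarrow> B j \<inter> B h = {}" by (elim exE conjE)
  have cB: "s \<le> card (B j)" if "j < 5" for j
  proof -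
    have g: "good (B j)" using B that by simp
    show ?thesis unfolding s_def
      by (rule det_card[where B = "B j" and j = 0]) (use g in \<open>simp_all add: good_def\<close>)
  qed
  have "5 * s = (\<Sum>j<5::nat. s)" by simp
  also have "\<dots> \<le> (\<Sum>j<5. card (B j))" by (intro sum_mono cB) simp
  also have "\<dots> = card (\<Union>j<5. B j)"
    by (rule card_UN_disjoint[symmetric]) (use B dis in \<open>simp_all add: good_def\<close>)
  also have "\<dots> \<le> card Q" by (intro card_mono finQ UN_least) (use B in simp)
  finally have "5 * s \<le> card Q" .
  moreover have "card Q = card F - card Z" unfolding Q_def
    by (rule card_Diff_subset) (auto simp: Z_def finite_F)
  moreover have "card Z \<le> card F" by (rule card_mono[OF finite_F]) (auto simp: Z_def)
  ultimately have "card Z \<le> s + 1" using card_F by simp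
  then show ?thesis by (simp only: Z_def)
qed

section \<open>Ratios of the reduced factors\<close>

definition ratio :: "nat \<Rightarrow> nat set \<Rightarrow> real" where
  "ratio i B = zval B i (\<delta> 15) / zval B i (\<delta> 1)"

definition common :: "nat \<Rightarrow> (nat \<Rightarrow> nat set) \<Rightarrow> nat \<Rightarrow> real \<Rightarrow> bool" where
  "common i I p \<tau> \<longleftrightarrow> p < 6 \<and> ratio i (I p) \<noteq> \<tau> \<and> (\<forall>j<6. j \<noteq> p \<longrightarrow> ratio i (I j) = \<tau>) \<and>
     ratio i (I p) * \<tau> ^ 5 = -3"

lemma zval_nonzero:
  assumes "config i I" "j < 6"
  shows "zval (I j) i (\<delta> 1) \<noteq> 0"
proof
  assume "zval (I j) i (\<delta> 1) = 0"
  then have "(\<Prod>j<6. zval (I j) i (\<delta> 1)) = 0" using assms(2) by (intro prod_zero) auto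
  then have "c i * (\<Prod>j<6. zval (I j) i (\<delta> 1)) = 0" by (simp only: mult_zero_right)
  then show False using zval_products(1)[OF assms(1)] by linarith
qed

lemma common_exists:
  assumes conf: "config i I"
  shows "\<exists>p \<tau>. common i I p \<tau>"
proof -
  have "(\<Prod>j<6. ratio i (I j)) = (\<Prod>j<6. zval (I j) i (\<delta> 15)) / (\<Prod>j<6. zval (I j) i (\<delta> 1))"
    unfolding ratio_def by (rule prod_dividef)
  also have "\<dots> = -3"
  proof -
    let ?a = "\<Prod>j<6. zval (I j) i (\<delta> 1)" and ?b = "\<Prod>j<6. zval (I j) i (\<delta> 15)"
    have ab: "c i * ?a = 1" "c i * ?b = -3" using zval_products[OF conf] .
    then have nz: "c i \<noteq> 0" "?a \<noteq> 0" by (metis mult_zero_left zero_neq_one, metis mult_zero_right zero_neq_one)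
    have "c i * ?b = c i * (-3 * ?a)" using ab by linarith
    then have "?b = -3 * ?a" using nz(1) by (metis mult_cancel_left)
    then show ?thesis using nz(2) by (metis nonzero_mult_div_cancel_right)
  qed
  finally have prod: "(\<Prod>j<6. ratio i (I j)) = -3" .
  have minors: "(ratio i (I p) - ratio i (I q)) * (ratio i (I k) - ratio i (I k')) = 0"
    if lt: "p < 6" "q < 6" "k < 6" "k' < 6"
      and ne: "p \<noteq> q" "p \<noteq> k" "p \<noteq> k'" "q \<noteq> k" "q \<noteq> k'" "k \<noteq> k'" for p q k k'
  proof -
    note nz = zval_nonzero[OF conf lt(1)] zval_nonzero[OF conf lt(2)]
      zval_nonzero[OF conf lt(3)] zval_nonzero[OF conf lt(4)]
    have cross: "b / a = b' / a'" if "a \<noteq> 0" "a' \<noteq> 0" "a * b' = a' * b" for a b a' b' :: real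
      using that by (simp add: frac_eq_eq mult.commute)
    have "zval (I p) i (\<delta> 1) * zval (I q) i (\<delta> 15) = zval (I q) i (\<delta> 1) * zval (I p) i (\<delta> 15) \<or>
      zval (I k) i (\<delta> 1) * zval (I k') i (\<delta> 15) = zval (I k') i (\<delta> 1) * zval (I k) i (\<delta> 15)"
      using zval_minors[OF conf lt ne] by simp
    then have "ratio i (I p) = ratio i (I q) \<or> ratio i (I k) = ratio i (I k')"
      unfolding ratio_def
      by (elim disjE) (rule disjI1, rule cross[OF nz(1,2)], assumption, rule disjI2, rule cross[OF nz(3,4)])
    then show ?thesis by (elim disjE) simp_all
  qed
  have "\<exists>p<6. \<exists>\<tau>. ratio i (I p) \<noteq> \<tau> \<and> (\<forall>j<6. j \<noteq> p \<longrightarrow> ratio i (I j) = \<tau>) \<and>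
      ratio i (I p) * \<tau> ^ 5 = -3"
    by (rule odd_slot[OF _ prod]) (rule minors)
  then obtain p \<tau> where "p < 6" "ratio i (I p) \<noteq> \<tau>" "\<forall>j<6. j \<noteq> p \<longrightarrow> ratio i (I j) = \<tau>"
    "ratio i (I p) * \<tau> ^ 5 = -3"
    by (elim exE conjE)
  then show ?thesis unfolding common_def by (intro exI conjI)
qed

text \<open>Otherwise the form of \<open>i\<close> on W is zero, and it is the same form in all
  slots. Then no row can be modified at \<open>i\<close>, all six factors coincide, and 1 and -3
  would be multiples of sixth powers by the one scalar \<open>c i\<close>.\<close>

lemma exchange_exists:
  assumes conf: "config i I" and p: "p < 6"
  shows "\<exists>e\<in>I p. M 0 (dual (I p) e) i \<noteq> 0"
proof (rule ccontr)
  assume "\<not> ?thesis"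
  then have "M 0 x i = 0" for x
    unfolding dual_expand[OF configD(2)[OF conf p], of x i] by (intro sum.neutral) simp
  then have z: "zval (I j) i y = L 0 y i" for j y by (simp add: zval_def)
  have "c i * L 0 (\<delta> 1) i ^ 6 = 1" "c i * L 0 (\<delta> 15) i ^ 6 = -3"
    using zval_products[OF conf] unfolding z by simp_all
  moreover have nonneg: "0 \<le> L 0 (\<delta> 1) i ^ 6" "0 \<le> L 0 (\<delta> 15) i ^ 6" by simp_all
  moreover have "0 \<le> c i"
  proof (rule ccontr)
    assume "\<not> 0 \<le> c i"
    then have "c i * L 0 (\<delta> 1) i ^ 6 \<le> 0" using nonneg(1) by (intro mult_nonpos_nonneg) simp_all
    then show False using \<open>c i * L 0 (\<delta> 1) i ^ 6 = 1\<close> by linarith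
  qed
  ultimately have "0 \<le> c i * L 0 (\<delta> 15) i ^ 6" by (intro mult_nonneg_nonneg)
  then show False using \<open>c i * L 0 (\<delta> 15) i ^ 6 = -3\<close> by linarith
qed

text \<open>Exchange in the exceptional slot, whose ratio is kept by \<open>zval_swap\<close>. If
  another slot \<open>j\<close> kept the ratio \<tau>, the row
  \<open>\<delta> 15 - \<tau> \<delta> 1\<close> fitted to \<open>I j\<close> would vanish on
  \<open>I j \<inter> F\<close>, at \<open>i\<close> and at \<open>e\<close>, against
  \<open>zero_bound\<close>. So the old exceptional ratio becomes the common one. The last clause
  says that a second step does not lead back to \<tau>.\<close>

lemma common_step:
  assumes re: "reach i I" and com: "common i I p \<tau>"
  shows "\<exists>i' I' p' \<tau>'. reach i' I' \<and> common i' I' p' \<tau>' \<and> \<tau>' * \<tau> ^ 5 = -3 \<and>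
     (\<forall>\<sigma>. \<sigma> * \<tau>' ^ 5 = -3 \<longrightarrow> \<sigma> \<noteq> \<tau>)"
proof -
  have conf: "config i I" by (rule reach_config[OF re])
  have p: "p < 6" and odd: "ratio i (I p) \<noteq> \<tau>" and rest: "\<And>j. j < 6 \<Longrightarrow> j \<noteq> p \<Longrightarrow> ratio i (I j) = \<tau>"
    and pr: "ratio i (I p) * \<tau> ^ 5 = -3"
    using com unfolding common_def by simp_all
  obtain e where e: "e \<in> I p" and nz: "M 0 (dual (I p) e) i \<noteq> 0"
    using exchange_exists[OF conf p] by (rule bexE)
  let ?I = "I(p := insert i (I p - {e}))"
  have re': "reach e ?I" by (rule reach.swap[OF re p e nz])
  have conf': "config e ?I" by (rule reach_config[OF re'])
  have rp: "ratio e (?I p) = ratio i (I p)"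
    using zval_swap[OF configD(2)[OF conf p] e configD(1)[OF conf] configD(4)[OF conf p] nz] nz
    by (simp add: ratio_def)
  have change: "ratio e (I j) \<noteq> \<tau>" if j: "j < 6" "j \<noteq> p" for j
  proof
    assume eq: "ratio e (I j) = \<tau>"
    let ?f = "\<lambda>a. \<delta> 15 a - \<tau> * \<delta> 1 a"
    have bas: "basis 0 (I j)" by (rule configD(2)[OF conf j(1)])
    have f: "zval (I j) k ?f = zval (I j) k (\<delta> 15) - \<tau> * zval (I j) k (\<delta> 1)" for k
      by (simp only: zval_diff[OF bas] zval_scale[OF bas])
    have "zval (I j) i ?f = 0"
      unfolding f using rest[OF j] zval_nonzero[OF conf j(1)] by (simp add: ratio_def field_simps)
    moreover have "zval (I j) e ?f = 0"
      unfolding f using eq zval_nonzero[OF conf' j(1)] j(2) by (simp add: ratio_def field_simps)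
    moreover have "zval (I j) b ?f = 0" if "b \<in> I j" for b by (rule zval_zero[OF bas that])
    ultimately have "insert i (insert e (I j \<inter> F)) \<subseteq> {k \<in> F. L 0 ?f k + M 0 (fit (I j) ?f) k = 0}"
      using reach_F[OF re] reach_F[OF re'] unfolding zval_def by auto
    then have "card (insert i (insert e (I j \<inter> F))) \<le> card {k \<in> F. L 0 ?f k + M 0 (fit (I j) ?f) k = 0}"
      by (intro card_mono) (simp add: finite_F)
    also have "\<dots> \<le> s + 1" by (rule zero_bound)
    finally have le: "card (insert i (insert e (I j \<inter> F))) \<le> s + 1" .
    have "i \<notin> I j" "i \<notin> I p" using configD(4)[OF conf] j(1) p by simp_all
    moreover have "e \<notin> I j" using configD(3)[OF conf j(1) p j(2)] e by auto
    ultimately have "card (insert i (insert e (I j \<inter> F))) = s + 2"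
      using finite_F e reach_card[OF re j(1)] card_part[OF j(1)] by (subst card_insert_disjoint) auto
    then show False using le by simp
  qed
  obtain p' \<tau>' where com': "common e ?I p' \<tau>'" using common_exists[OF conf'] by (elim exE)
  then have p': "p' < 6" and rest': "\<And>j. j < 6 \<Longrightarrow> j \<noteq> p' \<Longrightarrow> ratio e (?I j) = \<tau>'"
    and pr': "ratio e (?I p') * \<tau>' ^ 5 = -3"
    unfolding common_def by simp_all
  \<comment> \<open>If \<open>p\<close> stayed exceptional, its unchanged ratio and the product
    condition would fix the fifth power of the common ratio, hence the ratio itself, contradicting
    \<open>change\<close>.\<close>
  have "p' \<noteq> p"
  proof
    assume "p' = p"
    then have "ratio i (I p) * \<tau>' ^ 5 = ratio i (I p) * \<tau> ^ 5" using pr pr' rp by simp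
    moreover have "ratio i (I p) \<noteq> 0" using pr by auto
    ultimately have "\<tau>' ^ 5 = \<tau> ^ 5" by simp
    moreover have "root 5 (x ^ 5) = x" for x :: real by (rule odd_real_root_power_cancel) simp
    ultimately have "\<tau>' = \<tau>" by metis
    define j where "j = (if p = 0 then 1 else 0 :: nat)"
    have j: "j < 6" "j \<noteq> p" by (auto simp: j_def)
    then show False using rest'[of j] change[OF j] \<open>p' = p\<close> \<open>\<tau>' = \<tau>\<close> by simp
  qed
  then have t': "\<tau>' = ratio i (I p)" using rest'[OF p] rp by simp
  have "ratio e (I p') \<noteq> \<tau>" by (rule change[OF p' \<open>p' \<noteq> p\<close>])
  then have "\<sigma> \<noteq> \<tau>" if "\<sigma> * \<tau>' ^ 5 = -3" for \<sigma>
  proof -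
    have "\<sigma> * \<tau>' ^ 5 = ratio e (I p') * \<tau>' ^ 5" using that pr' \<open>p' \<noteq> p\<close> by simp
    moreover have "\<tau>' ^ 5 \<noteq> 0" using that by auto
    ultimately have "\<sigma> = ratio e (I p')" by simp
    then show ?thesis using \<open>ratio e (I p') \<noteq> \<tau>\<close> by simp
  qed
  then show ?thesis using re' com' pr t' by (intro exI[of _ e] exI[of _ ?I] exI[of _ p'] exI[of _ \<tau>']) simp
qed

lemma rooted_impossible: False
proof -
  define \<Theta> where "\<Theta> = {\<tau>. \<exists>i I p. reach i I \<and> common i I p \<tau>}"
  have fin: "finite \<Theta>"
  proof (rule finite_subset)
    show "\<Theta> \<subseteq> (\<lambda>(i, B). ratio i B) ` ({..<r} \<times> Pow {..<r})"
    proof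
      fix \<tau> assume "\<tau> \<in> \<Theta>"
      then obtain i I p where re: "reach i I" and com: "common i I p \<tau>"
        unfolding \<Theta>_def by (elim CollectE exE conjE)
      define j where "j = (if p = 0 then 1 else 0 :: nat)"
      have j: "j < 6" "j \<noteq> p" by (auto simp: j_def)
      then have "ratio i (I j) = \<tau>" using com unfolding common_def by simp
      moreover have "I j \<subseteq> {..<r}"
        using configD(2)[OF reach_config[OF re] j(1)] unfolding basis_def by simp
      moreover have "i < r" by (rule configD(1)[OF reach_config[OF re]])
      ultimately show "\<tau> \<in> (\<lambda>(i, B). ratio i B) ` ({..<r} \<times> Pow {..<r})"
        by (intro image_eqI[of _ _ "(i, I j)"]) simp_all
    qed
  qed simp
  have ne: "\<Theta> \<noteq> {}"
  proof -
    obtain p \<tau> where "common i0 I0 p \<tau>" using common_exists[OF root] by (elim exE)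
    then have "\<tau> \<in> \<Theta>" unfolding \<Theta>_def using reach.start by (intro CollectI exI conjI)
    then show ?thesis by auto
  qed
  have step: "\<exists>\<tau>'\<in>\<Theta>. \<tau>' * \<tau> ^ 5 = -3 \<and> (\<forall>\<sigma>. \<sigma> * \<tau>' ^ 5 = -3 \<longrightarrow> \<sigma> \<noteq> \<tau>)" if mem: "\<tau> \<in> \<Theta>" for \<tau>
  proof -
    obtain i I p where "reach i I" "common i I p \<tau>"
      using mem unfolding \<Theta>_def by (elim CollectE exE conjE)
    from common_step[OF this] obtain i' I' p' \<tau>' where
      a: "reach i' I'" "common i' I' p' \<tau>'" and b: "\<tau>' * \<tau> ^ 5 = -3" "\<forall>\<sigma>. \<sigma> * \<tau>' ^ 5 = -3 \<longrightarrow> \<sigma> \<noteq> \<tau>"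
      by (elim exE conjE)
    have "\<tau>' \<in> \<Theta>" unfolding \<Theta>_def using a by (intro CollectI exI conjI)
    then show ?thesis using b by (intro bexI[of _ \<tau>'] conjI)
  qed
  \<comment> \<open>Two steps send \<open>\<tau>\<close> to \<open>\<tau>\<^sup>2\<^sup>5 / 81\<close>, which moves \<open>\<bar>\<tau>\<bar>\<close> strictly away from the fixed point.\<close>
  have two: "\<tau> ^ 25 / 81 \<in> \<Theta> \<and> \<tau> ^ 25 / 81 \<noteq> \<tau>" if mem: "\<tau> \<in> \<Theta>" for \<tau>
  proof -
    obtain \<tau>' where t': "\<tau>' \<in> \<Theta>" "\<tau>' * \<tau> ^ 5 = -3" "\<forall>\<sigma>. \<sigma> * \<tau>' ^ 5 = -3 \<longrightarrow> \<sigma> \<noteq> \<tau>"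
      using step[OF mem] by (elim bexE conjE)
    obtain \<sigma> where \<sigma>: "\<sigma> \<in> \<Theta>" "\<sigma> * \<tau>' ^ 5 = -3" using step[OF t'(1)] by (elim bexE conjE)
    have "\<sigma> * (\<tau>' * \<tau> ^ 5) ^ 5 = -3 * \<tau> ^ 25"
      using \<sigma>(2) by (simp add: power_mult_distrib power_mult[symmetric] mult.assoc[symmetric])
    then have eq: "\<sigma> = \<tau> ^ 25 / 81" unfolding t'(2) by simp
    show ?thesis unfolding eq[symmetric] using \<sigma> t'(3) by simp
  qed
  have nz: "\<tau> \<noteq> 0" if "\<tau> \<in> \<Theta>" for \<tau> using step[OF that] by auto
  have abs: "\<bar>\<tau> ^ 25 / 81\<bar> = \<bar>\<tau>\<bar> * (\<tau> ^ 24 / 81)" for \<tau> :: real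
  proof -
    have "\<tau> ^ 25 = \<tau> * \<tau> ^ 24" by (simp flip: power_Suc)
    then show ?thesis by (simp add: abs_mult)
  qed
  have n81: "\<tau> ^ 24 \<noteq> 81" if "\<tau> \<in> \<Theta>" for \<tau>
  proof
    assume "\<tau> ^ 24 = 81"
    moreover have "\<tau> ^ 25 = \<tau> * \<tau> ^ 24" by (simp flip: power_Suc)
    ultimately have "\<tau> ^ 25 / 81 = \<tau>" by simp
    then show False using two[OF that] by simp
  qed
  have "Max (abs ` \<Theta>) \<in> abs ` \<Theta>" "Min (abs ` \<Theta>) \<in> abs ` \<Theta>"
    using fin ne by (intro Max_in Min_in; simp)+
  then obtain a b where a: "a \<in> \<Theta>" "Max (abs ` \<Theta>) = \<bar>a\<bar>" and b: "b \<in> \<Theta>" "Min (abs ` \<Theta>) = \<bar>b\<bar>"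
    by (elim imageE)
  \<comment> \<open>Two steps from the element of largest modulus cannot enlarge the modulus, and
    two steps from the one of smallest modulus cannot reduce it. This places the largest modulus
    below the smallest.\<close>
  have "\<bar>a ^ 25 / 81\<bar> \<le> \<bar>a\<bar>" unfolding a(2)[symmetric] using fin two[OF a(1)] by (intro Max_ge imageI finite_imageI) simp_all
  then have "a ^ 24 / 81 \<le> 1" unfolding abs using nz[OF a(1)] by simp
  then have a81: "a ^ 24 < 81" using n81[OF a(1)] by simp
  have "\<bar>b\<bar> \<le> \<bar>b ^ 25 / 81\<bar>" unfolding b(2)[symmetric] using fin two[OF b(1)] by (intro Min_le imageI finite_imageI) simp_all
  then have "1 \<le> b ^ 24 / 81" unfolding abs using nz[OF b(1)] by simp
  then have b81: "81 \<le> b ^ 24" by simp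
  have "\<bar>b\<bar> \<le> \<bar>a\<bar>" unfolding b(2)[symmetric] using fin a(1) by (intro Min_le imageI finite_imageI)
  then have "\<bar>b\<bar> ^ 24 \<le> \<bar>a\<bar> ^ 24" by (intro power_mono) simp_all
  then have "b ^ 24 \<le> a ^ 24" by (simp add: power_even_abs)
  then show False using a81 b81 by simp
qed

end

context sym_adj_decomposition
begin

lemma no_decomposition: False
proof -
  obtain i0 I0 where "config i0 I0" using config_exists by (elim exE)
  then interpret rooted_decomposition W u c V r i0 I0 by unfold_locales
  show False by (rule rooted_impossible)
qed

end

section \<open>The set \<open>W\<close> for \<open>n = 7\<close>\<close>

definition subsets :: "nat \<Rightarrow> nat set set" where
  "subsets k = {S. S \<subseteq> {1..7} \<and> card S = k}"

definition agree :: "(nat \<Rightarrow> real) \<Rightarrow> nat set \<Rightarrow> bool" where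
  "agree a S \<longleftrightarrow> (\<forall>p\<in>{1..14}. a p = of_bool (pair_cls p \<in> S))"

text \<open>Families of vectors are matched with families of sets through representatives, not
  through an equation: agreement concerns the positions 1 to 14 only, which are the ones that
  \<open>cat\<close> reads.\<close>

definition represents :: "(nat \<Rightarrow> real) set \<Rightarrow> nat set set \<Rightarrow> bool" where
  "represents A \<S> \<longleftrightarrow> (\<forall>a\<in>A. \<exists>S\<in>\<S>. agree a S) \<and> (\<forall>S\<in>\<S>. \<exists>a\<in>A. agree a S)"

lemma agree_alpha: "1 \<le> i \<Longrightarrow> agree (alpha i) {i}"
  by (auto simp: agree_def alpha_def pair_cls_def)

lemma agree_vadd: "\<lbrakk>agree a S; agree b T; S \<inter> T = {}\<rbrakk> \<Longrightarrow> agree (vadd a b) (S \<union> T)"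
  by (auto simp: agree_def vadd_def)

text \<open>Splitting off the minimum repeatedly turns k-subsets into strictly increasing index
  tuples, the form in which \<open>Uset\<close> lists them.\<close>

lemma subset_insert_iff_Min:
  fixes a n :: nat
  shows "S \<subseteq> {a..n} \<and> card S = Suc k \<longleftrightarrow>
    (\<exists>i. a \<le> i \<and> i \<le> n \<and> (\<exists>T. (T \<subseteq> {Suc i..n} \<and> card T = k) \<and> S = insert i T))"
proof
  assume S: "S \<subseteq> {a..n} \<and> card S = Suc k"
  then have fin: "finite S" and ne: "S \<noteq> {}" by (auto intro: finite_subset)
  have m: "Min S \<in> S" using fin ne by (rule Min_in)
  have "S - {Min S} \<subseteq> {Suc (Min S)..n}"
  proof
    fix x assume x: "x \<in> S - {Min S}"
    then have "Min S \<le> x" using fin by simp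
    then show "x \<in> {Suc (Min S)..n}" using x S by auto
  qed
  moreover have "card (S - {Min S}) = k" using S m fin by simp
  moreover have "S = insert (Min S) (S - {Min S})" using m by auto
  ultimately show "\<exists>i. a \<le> i \<and> i \<le> n \<and> (\<exists>T. (T \<subseteq> {Suc i..n} \<and> card T = k) \<and> S = insert i T)"
    using m S by (intro exI[of _ "Min S"] conjI exI[of _ "S - {Min S}"]) auto
next
  assume "\<exists>i. a \<le> i \<and> i \<le> n \<and> (\<exists>T. (T \<subseteq> {Suc i..n} \<and> card T = k) \<and> S = insert i T)"
  then obtain i T where T: "a \<le> i" "i \<le> n" "T \<subseteq> {Suc i..n}" "card T = k" "S = insert i T" by auto
  then have "finite T" "i \<notin> T" by (auto intro: finite_subset)
  then show "S \<subseteq> {a..n} \<and> card S = Suc k" using T by auto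
qed

lemma subset_card_0_iff: "S \<subseteq> {a..n::nat} \<and> card S = 0 \<longleftrightarrow> S = {}"
  by (auto simp: finite_subset)

lemma subsets_iff:
  "S \<in> subsets 0 \<longleftrightarrow> S = {}"
  "S \<in> subsets 1 \<longleftrightarrow> (\<exists>i1. 1 \<le> i1 \<and> i1 \<le> 7 \<and> S = {i1})"
  "S \<in> subsets 2 \<longleftrightarrow> (\<exists>i1 i2. 1 \<le> i1 \<and> i1 < i2 \<and> i2 \<le> 7 \<and> S = {i1, i2})"
  "S \<in> subsets 3 \<longleftrightarrow> (\<exists>i1 i2 i3. 1 \<le> i1 \<and> i1 < i2 \<and> i2 < i3 \<and> i3 \<le> 7 \<and> S = {i1, i2, i3})"
  "S \<in> subsets 4 \<longleftrightarrow> (\<exists>i1 i2 i3 i4. 1 \<le> i1 \<and> i1 < i2 \<and> i2 < i3 \<and> i3 < i4 \<and> i4 \<le> 7 \<and> S = {i1, i2, i3, i4})"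
proof -
  have num: "(1::nat) = Suc 0" "(2::nat) = Suc (Suc 0)" "(3::nat) = Suc (Suc (Suc 0))"
    "(4::nat) = Suc (Suc (Suc (Suc 0)))" by simp_all
  show "S \<in> subsets 0 \<longleftrightarrow> S = {}" by (simp add: subsets_def subset_card_0_iff)
  show "S \<in> subsets 1 \<longleftrightarrow> (\<exists>i1. 1 \<le> i1 \<and> i1 \<le> 7 \<and> S = {i1})" (is "?l \<longleftrightarrow> ?r")
  proof
    assume ?l
    then show ?r
      unfolding subsets_def mem_Collect_eq num(1) subset_insert_iff_Min subset_card_0_iff
      by (auto simp: Suc_le_eq)
  next
    assume ?r
    then show ?l by (auto simp: subsets_def)
  qed
  show "S \<in> subsets 2 \<longleftrightarrow> (\<exists>i1 i2. 1 \<le> i1 \<and> i1 < i2 \<and> i2 \<le> 7 \<and> S = {i1, i2})" (is "?l \<longleftrightarrow> ?r")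
  proof
    assume ?l
    then show ?r
      unfolding subsets_def mem_Collect_eq num(2) subset_insert_iff_Min subset_card_0_iff
      by (auto simp: Suc_le_eq)
  next
    assume ?r
    then show ?l by (auto simp: subsets_def)
  qed
  show "S \<in> subsets 3 \<longleftrightarrow> (\<exists>i1 i2 i3. 1 \<le> i1 \<and> i1 < i2 \<and> i2 < i3 \<and> i3 \<le> 7 \<and> S = {i1, i2, i3})" (is "?l \<longleftrightarrow> ?r")
  proof
    assume ?l
    then show ?r
      unfolding subsets_def mem_Collect_eq num(3) subset_insert_iff_Min subset_card_0_iff
      by (auto simp: Suc_le_eq)
  next
    assume ?r
    then show ?l by (auto simp: subsets_def)
  qed
  show "S \<in> subsets 4 \<longleftrightarrow> (\<exists>i1 i2 i3 i4. 1 \<le> i1 \<and> i1 < i2 \<and> i2 < i3 \<and> i3 < i4 \<and> i4 \<le> 7 \<and> S = {i1, i2, i3, i4})" (is "?l \<longleftrightarrow> ?r")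
  proof
    assume ?l
    then show ?r
      unfolding subsets_def mem_Collect_eq num(4) subset_insert_iff_Min subset_card_0_iff
      by (auto simp: Suc_le_eq)
  next
    assume ?r
    then show ?l by (auto simp: subsets_def)
  qed
qed

definition vecs0 where "vecs0 = {vzero}"
definition vecs1 where "vecs1 = {alpha i1 | i1. 1 \<le> i1 \<and> i1 \<le> 7}"
definition vecs2 where "vecs2 = {a2 i1 i2 | i1 i2. 1 \<le> i1 \<and> i1 < i2 \<and> i2 \<le> 7}"
definition vecs3 where "vecs3 = {a3 i1 i2 i3 | i1 i2 i3. 1 \<le> i1 \<and> i1 < i2 \<and> i2 < i3 \<and> i3 \<le> 7}"
definition vecs4 where "vecs4 = {a4 i1 i2 i3 i4 | i1 i2 i3 i4. 1 \<le> i1 \<and> i1 < i2 \<and> i2 < i3 \<and> i3 < i4 \<and> i4 \<le> 7}"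

lemma agree_a2: "\<lbrakk>1 \<le> i1; i1 < i2\<rbrakk> \<Longrightarrow> agree (a2 i1 i2) {i1, i2}"
  using agree_vadd[OF agree_alpha[of i1] agree_alpha[of i2]] by (simp add: insert_commute)

lemma agree_a3: "\<lbrakk>1 \<le> i1; i1 < i2; i2 < i3\<rbrakk> \<Longrightarrow> agree (a3 i1 i2 i3) {i1, i2, i3}"
  using agree_vadd[OF agree_a2[of i1 i2] agree_alpha[of i3]] by (simp add: insert_commute)

lemma agree_a4: "\<lbrakk>1 \<le> i1; i1 < i2; i2 < i3; i3 < i4\<rbrakk> \<Longrightarrow> agree (a4 i1 i2 i3 i4) {i1, i2, i3, i4}"
  using agree_vadd[OF agree_a3[of i1 i2 i3] agree_alpha[of i4]] by (simp add: insert_commute)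

lemma represents_vecs:
  "represents vecs0 (subsets 0)" "represents vecs1 (subsets 1)" "represents vecs2 (subsets 2)"
  "represents vecs3 (subsets 3)" "represents vecs4 (subsets 4)"
proof -
  have "agree vzero {}" by (simp add: agree_def vzero_def)
  then show "represents vecs0 (subsets 0)" by (simp add: represents_def vecs0_def subsets_iff)
  show "represents vecs1 (subsets 1)"
    unfolding represents_def
  proof (intro conjI ballI)
    fix a assume "a \<in> vecs1"
    then obtain i1 where i: "1 \<le> i1" "i1 \<le> 7" and a: "a = alpha i1"
      unfolding vecs1_def by (elim CollectE exE conjE)
    have "{i1} \<in> subsets 1" unfolding subsets_iff using i by (intro exI conjI) (assumption | rule refl)+
    then show "\<exists>S\<in>subsets 1. agree a S" unfolding a using agree_alpha[OF i(1)] by (intro bexI)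
  next
    fix S assume "S \<in> subsets 1"
    then obtain i1 where i: "1 \<le> i1" "i1 \<le> 7" and S: "S = {i1}"
      unfolding subsets_iff by (elim exE conjE)
    have "alpha i1 \<in> vecs1" unfolding vecs1_def using i by (intro CollectI exI conjI) (rule refl | assumption)+
    then show "\<exists>a\<in>vecs1. agree a S" unfolding S using agree_alpha[OF i(1)] by (intro bexI)
  qed
  show "represents vecs2 (subsets 2)"
    unfolding represents_def
  proof (intro conjI ballI)
    fix a assume "a \<in> vecs2"
    then obtain i1 i2 where i: "1 \<le> i1" "i1 < i2" "i2 \<le> 7" and a: "a = a2 i1 i2"
      unfolding vecs2_def by (elim CollectE exE conjE)
    have "{i1, i2} \<in> subsets 2" unfolding subsets_iff using i by (intro exI conjI) (assumption | rule refl)+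
    then show "\<exists>S\<in>subsets 2. agree a S" unfolding a using agree_a2[OF i(1-2)] by (intro bexI)
  next
    fix S assume "S \<in> subsets 2"
    then obtain i1 i2 where i: "1 \<le> i1" "i1 < i2" "i2 \<le> 7" and S: "S = {i1, i2}"
      unfolding subsets_iff by (elim exE conjE)
    have "a2 i1 i2 \<in> vecs2" unfolding vecs2_def using i by (intro CollectI exI conjI) (rule refl | assumption)+
    then show "\<exists>a\<in>vecs2. agree a S" unfolding S using agree_a2[OF i(1-2)] by (intro bexI)
  qed
  show "represents vecs3 (subsets 3)"
    unfolding represents_def
  proof (intro conjI ballI)
    fix a assume "a \<in> vecs3"
    then obtain i1 i2 i3 where i: "1 \<le> i1" "i1 < i2" "i2 < i3" "i3 \<le> 7" and a: "a = a3 i1 i2 i3"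
      unfolding vecs3_def by (elim CollectE exE conjE)
    have "{i1, i2, i3} \<in> subsets 3" unfolding subsets_iff using i by (intro exI conjI) (assumption | rule refl)+
    then show "\<exists>S\<in>subsets 3. agree a S" unfolding a using agree_a3[OF i(1-3)] by (intro bexI)
  next
    fix S assume "S \<in> subsets 3"
    then obtain i1 i2 i3 where i: "1 \<le> i1" "i1 < i2" "i2 < i3" "i3 \<le> 7" and S: "S = {i1, i2, i3}"
      unfolding subsets_iff by (elim exE conjE)
    have "a3 i1 i2 i3 \<in> vecs3" unfolding vecs3_def using i by (intro CollectI exI conjI) (rule refl | assumption)+
    then show "\<exists>a\<in>vecs3. agree a S" unfolding S using agree_a3[OF i(1-3)] by (intro bexI)
  qed
  show "represents vecs4 (subsets 4)"
    unfolding represents_def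
  proof (intro conjI ballI)
    fix a assume "a \<in> vecs4"
    then obtain i1 i2 i3 i4 where i: "1 \<le> i1" "i1 < i2" "i2 < i3" "i3 < i4" "i4 \<le> 7" and a: "a = a4 i1 i2 i3 i4"
      unfolding vecs4_def by (elim CollectE exE conjE)
    have "{i1, i2, i3, i4} \<in> subsets 4" unfolding subsets_iff using i by (intro exI conjI) (assumption | rule refl)+
    then show "\<exists>S\<in>subsets 4. agree a S" unfolding a using agree_a4[OF i(1-4)] by (intro bexI)
  next
    fix S assume "S \<in> subsets 4"
    then obtain i1 i2 i3 i4 where i: "1 \<le> i1" "i1 < i2" "i2 < i3" "i3 < i4" "i4 \<le> 7" and S: "S = {i1, i2, i3, i4}"
      unfolding subsets_iff by (elim exE conjE)
    have "a4 i1 i2 i3 i4 \<in> vecs4" unfolding vecs4_def using i by (intro CollectI exI conjI) (rule refl | assumption)+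
    then show "\<exists>a\<in>vecs4. agree a S" unfolding S using agree_a4[OF i(1-4)] by (intro bexI)
  qed
qed

lemma cat_uvec:
  assumes "agree a S" "agree b K"
  shows "cat 7 a (vscale t b) = uvec False (S, K, t)"
proof
  fix p :: nat
  consider "p \<in> {1..14}" | "p \<in> {15..28}" | "p = 0 \<or> 28 < p" by force
  then show "cat 7 a (vscale t b) p = uvec False (S, K, t) p"
  proof cases
    case 2
    then have "p - 14 \<in> {1..14}" by auto
    then have "b (p - 14) = of_bool (pair_cls (p - 14) \<in> K)" using assms(2) by (simp add: agree_def)
    then show ?thesis using 2 by (simp add: cat_def vscale_def uvec.simps cls_def)
  qed (use assms in \<open>auto simp: cat_def uvec.simps cls_def agree_def\<close>)
qed

lemma cat_image:
  assumes "represents A \<S>" "represents B \<K>"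
  shows "{cat 7 a (vscale t b) | a b. a \<in> A \<and> b \<in> B} = (\<lambda>(S, K). uvec False (S, K, t)) ` (\<S> \<times> \<K>)"
    (is "?l = ?r")
proof
  show "?l \<subseteq> ?r"
  proof
    fix x assume "x \<in> ?l"
    then obtain a b where ab: "a \<in> A" "b \<in> B" "x = cat 7 a (vscale t b)" by auto
    obtain S where S: "S \<in> \<S>" "agree a S" using assms(1) ab(1) unfolding represents_def by auto
    obtain K where K: "K \<in> \<K>" "agree b K" using assms(2) ab(2) unfolding represents_def by auto
    show "x \<in> ?r" using S K cat_uvec[OF S(2) K(2), of t] ab(3) by (intro image_eqI[of _ _ "(S, K)"]) simp_all
  qed
  show "?r \<subseteq> ?l"
  proof
    fix x assume "x \<in> ?r"
    then obtain S K where SK: "S \<in> \<S>" "K \<in> \<K>" "x = uvec False (S, K, t)" by auto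
    obtain a where a: "a \<in> A" "agree a S" using assms(1) SK(1) unfolding represents_def by auto
    obtain b where b: "b \<in> B" "agree b K" using assms(2) SK(2) unfolding represents_def by auto
    show "x \<in> ?l" using a b cat_uvec[OF a(2) b(2), of t] SK(3)
      by (intro CollectI exI[of _ a] exI[of _ b]) simp
  qed
qed

definition block :: "nat \<times> nat \<times> real \<Rightarrow> (nat set \<times> nat set \<times> real) set" where
  "block = (\<lambda>(s, k, t). (\<lambda>(S, K). (S, K, t)) ` (subsets s \<times> subsets k))"

lemma params_blocks: "params = (\<Union>\<tau>\<in>types. block \<tau>)"
  unfolding params_def block_def subsets_def by force

lemma vscale_simps: "vscale t vzero = vzero" "vscale 1 a = a"
  by (simp_all add: vscale_def vzero_def)

lemma uvec_block: "uvec b ` block (s, k, t) = (\<lambda>(S, K). uvec b (S, K, t)) ` (subsets s \<times> subsets k)"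
  by (auto simp: block_def image_iff)

lemma Uset_7: "Uset 7 = uvec False ` params"
proof -
  note R = represents_vecs
  have b: "{cat 7 a (vscale t b) | a b. a \<in> A \<and> b \<in> B} = uvec False ` block (s, k, t)"
    if "represents A (subsets s)" "represents B (subsets k)" for A B s k t
    unfolding uvec_block by (rule cat_image[OF that])
  have params_un: "uvec False ` params =
     uvec False ` block (4,0,1) \<union> uvec False ` block (3,0,1) \<union> uvec False ` block (2,0,1)
   \<union> uvec False ` block (1,0,1) \<union> uvec False ` block (4,1,1) \<union> uvec False ` block (2,1,25/24)
   \<union> uvec False ` block (1,1,5/4) \<union> uvec False ` block (1,1,2) \<union> uvec False ` block (3,2,1)
   \<union> uvec False ` block (2,2,5/4) \<union> uvec False ` block (2,1,5/3) \<union> uvec False ` block (0,1,1)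
   \<union> uvec False ` block (3,1,4/3) \<union> uvec False ` block (3,1,5/6) \<union> uvec False ` block (1,2,3/2)
   \<union> uvec False ` block (0,2,1)"
    unfolding params_blocks types_def by (simp only: UN_insert UN_empty image_Un Un_empty_right Un_assoc)
  have c: "(7 - 2)^2 / ((7 - 3) * (7 - 1)) = (25/24::real)" "(7 - 2) / (7 - 3) = (5/4::real)"
    "(7 - 1) / (7 - 4) = (2::real)" "(7 - 2) / (7 - 4) = (5/3::real)" "(7 - 3) / (7 - 4) = (4/3::real)"
    "(7 - 2) / (7 - 1) = (5/6::real)" "(7 - 1) / (7 - 3) = (3/2::real)" "real 7 = 7"
    by (simp_all add: power2_eq_square)
  show ?thesis
    unfolding Uset_def Let_def c params_un
    by (intro arg_cong2[of _ _ _ _ "(\<union>)"];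
        (subst b[OF R(1) R(2), symmetric] | subst b[OF R(1) R(3), symmetric] |
         subst b[OF R(2) R(1), symmetric] | subst b[OF R(2) R(2), symmetric] |
         subst b[OF R(2) R(3), symmetric] | subst b[OF R(3) R(1), symmetric] |
         subst b[OF R(3) R(2), symmetric] | subst b[OF R(3) R(3), symmetric] |
         subst b[OF R(4) R(1), symmetric] | subst b[OF R(4) R(2), symmetric] |
         subst b[OF R(4) R(3), symmetric] | subst b[OF R(5) R(1), symmetric] |
         subst b[OF R(5) R(2), symmetric]),
        unfold vecs0_def vecs1_def vecs2_def vecs3_def vecs4_def vscale_simps, (auto simp: vscale_simps; blast))
qed

lemma piv_uvec: "piv 7 (uvec False P) = uvec True P"
proof
  fix p :: nat
  obtain S K t where P: "P = (S, K, t)" by (metis surj_pair)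
  consider "p = 0" | "1 \<le> p" "p \<le> 13" | "p = 14" | "15 \<le> p" "p \<le> 27" | "p = 28" | "28 < p" by linarith
  then show "piv 7 (uvec False P) p = uvec True P p"
  proof cases
    case 2
    then have "p div 2 < 7" by auto
    then have "pair_cls (p + 1) = shift_cls p" by (simp add: pair_cls_def shift_cls_def)
    then show ?thesis using 2 by (simp add: P piv_def uvec.simps cls_def)
  next
    case 4
    then have "(p - 14) div 2 < 7" by auto
    then have "pair_cls (Suc (p - 14)) = shift_cls (p - 14)" by (simp add: pair_cls_def shift_cls_def)
    moreover have "p - 14 \<le> 13" using 4 by simp
    ultimately show ?thesis using 4 by (simp add: P piv_def uvec.simps cls_def)
  qed (simp_all add: P piv_def uvec.simps cls_def pair_cls_def shift_cls_def)
qed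

lemma finite_subsets: "finite (subsets k)"
  unfolding subsets_def by (rule finite_subset[of _ "Pow {1..7}"]) auto

lemma finite_block: "finite (block \<tau>)"
  by (simp add: block_def finite_subsets split: prod.split)

lemma block_disjoint: "\<tau> \<noteq> \<tau>' \<Longrightarrow> block \<tau> \<inter> block \<tau>' = {}"
  by (auto simp: block_def subsets_def split: prod.splits)

lemma card_params: "card params = 2576"
proof -
  have cs: "card (subsets k) = 7 choose k" for k
    unfolding subsets_def by (simp add: n_subsets)
  have cb: "card (block (s, k, t)) = (7 choose s) * (7 choose k)" for s k t
    unfolding block_def prod.case
    by (subst card_image) (auto simp: inj_on_def card_cartesian_product cs)
  have "card params = (\<Sum>\<tau>\<in>types. card (block \<tau>))"
    unfolding params_blocks by (rule card_UN_disjoint) (simp_all add: finite_types finite_block block_disjoint)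
  also have "\<dots> = (\<Sum>(s, k, t)\<in>types. (7 choose s) * (7 choose k))"
    by (intro sum.cong refl) (auto simp: cb)
  also have "\<dots> = 2576" by (simp add: types_def numeral_eq_Suc)
  finally show ?thesis .
qed

definition wvec :: "(nat set \<times> nat set \<times> real) \<times> bool \<Rightarrow> nat \<Rightarrow> real" where
  "wvec q = uvec (snd q) (fst q)"

abbreviation indices :: "((nat set \<times> nat set \<times> real) \<times> bool) set" where
  "indices \<equiv> params \<times> UNIV"

definition wten :: "(nat set \<times> nat set \<times> real) \<times> bool \<Rightarrow> nat list \<Rightarrow> real" where
  "wten q = tpow 5 28 (wvec q)"

lemma prod_nth: "(\<Prod>j<length ks. f (ks ! j)) = prod_list (map f ks)"
  by (induction ks) (simp_all add: prod.lessThan_Suc_shift del: prod.lessThan_Suc)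

lemma wten_eq: "\<lbrakk>length ks = 5; set ks \<subseteq> {1..28}\<rbrakk> \<Longrightarrow> wten q ks = prod_list (map (wvec q) ks)"
  using prod_nth[of "wvec q" ks] by (simp add: wten_def tpow_def)

lemma Wset_7: "Wset 7 = wten ` indices"
proof -
  have "Wset 7 = (\<lambda>P. wten (P, False)) ` params \<union> (\<lambda>P. wten (P, True)) ` params"
    unfolding Wset_def Uset_7 image_image piv_uvec wten_def wvec_def by simp
  also have "\<dots> = wten ` indices"
  proof (rule equalityI)
    show "wten ` indices \<subseteq> (\<lambda>P. wten (P, False)) ` params \<union> (\<lambda>P. wten (P, True)) ` params"
    proof
      fix y assume "y \<in> wten ` indices"
      then obtain P b where "P \<in> params" "y = wten (P, b)" by auto
      then show "y \<in> (\<lambda>P. wten (P, False)) ` params \<union> (\<lambda>P. wten (P, True)) ` params"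
        by (cases b) simp_all
    qed
  qed auto
  finally show ?thesis .
qed

lemma finite_indices: "finite indices"
  by (simp add: finite_params)

lemma wvec_independent:
  assumes "\<And>ks. \<lbrakk>length ks = 5; set ks \<subseteq> {1..28}\<rbrakk> \<Longrightarrow>
      (\<Sum>q\<in>indices. x q * prod_list (map (wvec q) ks)) = 0" "q \<in> indices"
  shows "x q = 0"
proof (rule uvec_powers_independent[OF _ assms(2)])
  fix ks :: "nat list" assume "length ks = 5" "set ks \<subseteq> {1..28}"
  then show "(\<Sum>q\<in>indices. x q * prod_list (map (uvec (snd q) (fst q)) ks)) = 0"
    using assms(1)[of ks] by (simp add: wvec_def[abs_def])
qed

text \<open>Equal tensors with different indices would give the relation with coefficients 1 and -1,
  against independence. This is also what makes the count of W exact.\<close>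

lemma inj_wten: "inj_on wten indices"
proof (rule inj_onI, rule ccontr)
  fix q q' assume q: "q \<in> indices" "q' \<in> indices" "wten q = wten q'" "q \<noteq> q'"
  define x where "x a = of_bool (a = q) - (of_bool (a = q') :: real)" for a
  have "x q = 0"
  proof (rule wvec_independent[OF _ q(1)])
    fix ks :: "nat list" assume ks: "length ks = 5" "set ks \<subseteq> {1..28}"
    have "(\<Sum>a\<in>indices. x a * prod_list (map (wvec a) ks)) =
        (\<Sum>a\<in>indices. (if a = q then prod_list (map (wvec a) ks) else 0)) -
        (\<Sum>a\<in>indices. (if a = q' then prod_list (map (wvec a) ks) else 0))"
      unfolding sum_subtractf[symmetric] by (intro sum.cong refl) (simp add: x_def)
    also have "\<dots> = wten q ks - wten q' ks"
      using q(1,2) finite_indices by (simp add: wten_eq[OF ks])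
    finally show "(\<Sum>a\<in>indices. x a * prod_list (map (wvec a) ks)) = 0" using q(3) by simp
  qed
  then show False using q(4) by (simp add: x_def)
qed

lemma card_Wset_7: "card (Wset 7) = 5152"
  unfolding Wset_7 card_image[OF inj_wten] by (simp add: card_cartesian_product card_params)

definition vec_of :: "(nat list \<Rightarrow> real) \<Rightarrow> nat \<Rightarrow> real" where
  "vec_of w = wvec (inv_into indices wten w)"

lemma vec_of_wten: "q \<in> indices \<Longrightarrow> vec_of (wten q) = wvec q"
  by (simp only: vec_of_def inv_into_f_f[OF inj_wten])

lemma Wset_entry:
  assumes "w \<in> Wset 7" "length ks = 5" "set ks \<subseteq> {1..28}"
  shows "w ks = prod_list (map (vec_of w) ks)"
proof -
  obtain q where "q \<in> indices" "w = wten q" using assms(1) unfolding Wset_7 by (elim imageE)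
  then show ?thesis using wten_eq[OF assms(2,3)] by (simp only: vec_of_wten)
qed

lemma sum_Wset: "(\<Sum>w\<in>Wset 7. f w) = (\<Sum>q\<in>indices. f (wten q))"
  unfolding Wset_7 by (simp only: sum.reindex[OF inj_wten] comp_def)

lemma Wset_independent:
  assumes rel: "\<And>\<kappa> :: nat \<Rightarrow> nat. (\<forall>j<5. \<kappa> j \<in> {1..28}) \<Longrightarrow>
      (\<Sum>w\<in>Wset 7. x w * (\<Prod>j<5. vec_of w (\<kappa> j))) = 0"
  shows "\<forall>w\<in>Wset 7. x w = 0"
proof
  fix w assume "w \<in> Wset 7"
  then obtain q where q: "q \<in> indices" "w = wten q" unfolding Wset_7 by (elim imageE)
  have "x (wten q) = 0"
  proof (rule wvec_independent[where x = "\<lambda>q. x (wten q)", OF _ q(1)])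
    fix ks :: "nat list" assume ks: "length ks = 5" "set ks \<subseteq> {1..28}"
    have "\<forall>j<5. ks ! j \<in> {1..28}"
    proof (intro allI impI)
      fix j :: nat assume "j < 5"
      then have "ks ! j \<in> set ks" using ks(1) by simp
      then show "ks ! j \<in> {1..28}" using ks(2) by (rule subsetD[rotated])
    qed
    then have "(\<Sum>w\<in>Wset 7. x w * (\<Prod>j<5. vec_of w (ks ! j))) = 0" by (rule rel)
    moreover have "(\<Prod>j<5. vec_of w (ks ! j)) = prod_list (map (vec_of w) ks)" for w
      using prod_nth[of "vec_of w" ks] ks(1) by simp
    ultimately have "(\<Sum>q\<in>indices. x (wten q) * prod_list (map (vec_of (wten q)) ks)) = 0"
      by (simp only: sum_Wset)
    moreover have "(\<Sum>q\<in>indices. x (wten q) * prod_list (map (vec_of (wten q)) ks)) =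
        (\<Sum>q\<in>indices. x (wten q) * prod_list (map (wvec q) ks))"
      by (intro sum.cong refl) (simp only: vec_of_wten)
    ultimately show "(\<Sum>q\<in>indices. x (wten q) * prod_list (map (wvec q) ks)) = 0" by simp
  qed
  then show "x w = 0" using q(2) by simp
qed

text \<open>Five distinct classes fit neither into S, which has at most four elements, nor into K,
  which has at most two.\<close>

lemma Wset_sparse:
  assumes w: "w \<in> Wset 7" and P: "P \<subseteq> {1..14}" "card P = 5" "inj_on pair_cls P" "inj_on shift_cls P"
  shows "(\<exists>p\<in>P. vec_of w p = 0) \<and> (\<exists>p\<in>P. vec_of w (p + 14) = 0)"
proof -
  obtain q where q: "q \<in> indices" "w = wten q" using w unfolding Wset_7 by (elim imageE)
  obtain S K t b where qe: "q = ((S, K, t), b)" by (metis surj_pair)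
  have S: "finite S" "card S \<le> 4" and K: "finite K" "card K \<le> 2"
    using q(1) types_bounds[of "card S" "card K" t] by (auto simp: qe params_def intro: finite_subset)
  have "inj_on (cls b) P" using P(3,4) by (simp add: cls_def)
  then have "card (cls b ` P) = 5" using P(2) by (simp add: card_image)
  then have nS: "\<not> cls b ` P \<subseteq> S" "\<not> cls b ` P \<subseteq> K"
    using S K card_mono[of S "cls b ` P"] card_mono[of K "cls b ` P"] by auto
  then obtain p p' where p: "p \<in> P" "cls b p \<notin> S" and p': "p' \<in> P" "cls b p' \<notin> K" by auto
  have vw: "vec_of w = uvec b (S, K, t)"
  proof -
    have "vec_of w = wvec q" by (simp only: q(2) vec_of_wten[OF q(1)])
    then show ?thesis by (simp add: wvec_def qe)
  qed
  have "vec_of w (pos1 b p) = 0" "vec_of w (pos2 b p') = 0"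
    unfolding vw using uvec_own(1)[of p b S K t] uvec_own(2)[of p' b S K t] p p' P(1) by auto
  then show ?thesis using p(1) p'(1) by (cases b) (auto simp: pos1_def pos2_def)
qed

section \<open>The entries of the adjoined tensor\<close>

text \<open>An iterated Pascal rule: the value is the sum of \<open>(n choose c) * G c\<close> over
  \<open>c \<le> n\<close>, in a shape that unfolds completely for a fixed \<open>n\<close>.\<close>

fun sum_counts :: "nat \<Rightarrow> (nat \<Rightarrow> real) \<Rightarrow> real" where
  "sum_counts 0 G = G 0"
| "sum_counts (Suc n) G = sum_counts n (\<lambda>c. G c + G (Suc c))"

lemma finite_lists12: "finite {ks :: nat list. length ks = n \<and> set ks \<subseteq> {1..2}}"
  using finite_lists_length_eq[of "{1..2::nat}" n] by (simp add: conj_commute)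

lemma sum_lists12:
  "(\<Sum>ks\<in>{ks. length ks = n \<and> set ks \<subseteq> {1..2::nat}}. G (count_list ks 2)) = sum_counts n G"
proof (induction n arbitrary: G)
  case 0
  have "{ks. length ks = 0 \<and> set ks \<subseteq> {1..2::nat}} = {[]}" by auto
  then show ?case by simp
next
  case (Suc n)
  let ?A = "\<lambda>n. {ks. length ks = n \<and> set ks \<subseteq> {1..2::nat}}"
  have "?A (Suc n) = (#) 1 ` ?A n \<union> (#) 2 ` ?A n"
  proof (rule equalityI; rule subsetI)
    fix ks assume "ks \<in> ?A (Suc n)"
    then obtain k l where "ks = k # l" "length l = n" "set l \<subseteq> {1..2}" "k \<in> {1..2}"
      by (cases ks) auto
    moreover have "{1..2} = {1, 2::nat}" by auto
    ultimately have "ks = k # l" "length l = n" "set l \<subseteq> {1..2}" "k = 1 \<or> k = 2" by auto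
    then show "ks \<in> (#) 1 ` ?A n \<union> (#) 2 ` ?A n" by auto
  next
    fix ks assume "ks \<in> (#) 1 ` ?A n \<union> (#) 2 ` ?A n"
    then obtain l where "length l = n" "set l \<subseteq> {1..2}" "ks = 1 # l \<or> ks = 2 # l" by auto
    then show "ks \<in> ?A (Suc n)" by (elim disjE) simp_all
  qed
  then have "(\<Sum>ks\<in>?A (Suc n). G (count_list ks 2)) =
      (\<Sum>ks\<in>(#) 1 ` ?A n. G (count_list ks 2)) + (\<Sum>ks\<in>(#) 2 ` ?A n. G (count_list ks 2))"
    by (simp only:) (rule sum.union_disjoint, (rule finite_imageI finite_lists12)+, auto)
  also have "\<dots> = (\<Sum>ks\<in>?A n. G (count_list ks 2) + G (Suc (count_list ks 2)))"
    by (simp add: sum.reindex sum.distrib)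
  also have "\<dots> = sum_counts n (\<lambda>c. G c + G (Suc c))" by (rule Suc.IH)
  finally show ?case by simp
qed

lemma mset_list12:
  assumes "set ks \<subseteq> {1, 2::nat}" "length ks = n"
  shows "mset ks = replicate_mset (n - count_list ks 2) 1 + replicate_mset (count_list ks 2) 2"
  using assms
proof (induction ks arbitrary: n)
  case (Cons k ks)
  have "count_list ks 2 \<le> length ks" by (rule count_le_length)
  then have "Suc (length ks) - count_list ks 2 = Suc (length ks - count_list ks 2)" by simp
  then show ?case using Cons.IH[of "length ks"] Cons.prems by auto
qed simp

text \<open>By symmetry an entry depends only on the number k of indices 2, and setting the first
  variable to 1 turns the form into a polynomial in y with coefficients
  \<open>(6 choose k) * d k\<close>. Its degree is at most six, so the seven values at 0, 1, -1, 2,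
  -2, 3, -3 determine all \<open>d k\<close>.\<close>

lemma form_entries:
  fixes C :: "nat list \<Rightarrow> real"
  assumes sym: "symmetric_tensor {1, 2} 6 C"
    and form: "\<forall>x. form_of 2 6 C x = x 1 ^ 6 - 3 * x 2 ^ 6"
    and ks: "length ks = 6" "set ks \<subseteq> {1, 2}"
  shows "C ks = (if count_list ks 2 = 0 then 1 else if count_list ks 2 = 6 then -3 else 0)"
proof -
  define d where "d k = C (replicate (6 - k) 1 @ replicate k 2)" for k
  have Cd: "C ks = d (count_list ks 2)" if "length ks = 6" "set ks \<subseteq> {1, 2}" for ks
  proof -
    have "mset (replicate (6 - count_list ks 2) 1 @ replicate (count_list ks 2) 2) = mset ks"
      unfolding mset_append mset_replicate mset_list12[OF that(2,1)] ..
    then show ?thesis unfolding d_def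
      by (intro sym[unfolded symmetric_tensor_def, rule_format] conjI that)
  qed
  have poly: "d 0 + 6 * d 1 * y + 15 * d 2 * y ^ 2 + 20 * d 3 * y ^ 3 + 15 * d 4 * y ^ 4 +
      6 * d 5 * y ^ 5 + d 6 * y ^ 6 = 1 - 3 * y ^ 6" for y :: real
  proof -
    define x where "x k = (if k = 2 then y else 1)" for k :: nat
    have px: "(\<Prod>j<6. x (ks ! j)) = y ^ count_list ks 2" if "length ks = 6" for ks
    proof -
      have "prod_list (map x ks) = y ^ count_list ks 2" by (induction ks) (auto simp: x_def)
      then show ?thesis using prod_nth[of x ks] that by simp
    qed
    have s12: "{1, 2} = {1..2::nat}" by auto
    have "form_of 2 6 C x = (\<Sum>ks\<in>{ks. length ks = 6 \<and> set ks \<subseteq> {1..2::nat}}.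
        d (count_list ks 2) * y ^ count_list ks 2)"
      unfolding form_of_def
    proof (intro sum.cong refl)
      fix ks assume "ks \<in> {ks. length ks = 6 \<and> set ks \<subseteq> {1..2::nat}}"
      then have "length ks = 6" "set ks \<subseteq> {1, 2}" unfolding s12 by auto
      then show "C ks * (\<Prod>j<6. x (ks ! j)) = d (count_list ks 2) * y ^ count_list ks 2"
        using Cd px by simp
    qed
    also have "\<dots> = sum_counts 6 (\<lambda>c. d c * y ^ c)" by (rule sum_lists12)
    also have "\<dots> = d 0 + 6 * d 1 * y + 15 * d 2 * y ^ 2 + 20 * d 3 * y ^ 3 + 15 * d 4 * y ^ 4 +
      6 * d 5 * y ^ 5 + d 6 * y ^ 6"
      by (simp add: numeral_eq_Suc algebra_simps)
    finally show ?thesis using form by (simp add: x_def)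
  qed
  note e = poly[of 0] poly[of 1] poly[of "-1"] poly[of 2] poly[of "-2"] poly[of 3] poly[of "-3"]
  have d: "d 0 = 1" "d 6 = -3" "d 1 = 0" "d 2 = 0" "d 3 = 0" "d 4 = 0" "d 5 = 0"
    using e by simp_all
  have "count_list ks 2 \<le> 6" using count_le_length[of ks 2] ks(1) by simp
  then have "count_list ks 2 \<in> {0, 1, 2, 3, 4, 5, 6}" by auto
  then show ?thesis using Cd[OF ks] d by auto
qed

lemma prod_delete_nth:
  fixes f :: "'b \<Rightarrow> real"
  shows "(\<Prod>h\<in>{..<length xs + Suc (length ys)} - {length xs}. f ((xs @ x # ys) ! h)) =
    prod_list (map f (xs @ ys))"
proof -
  have split: "{..<length xs + Suc (length ys)} - {length xs} =
      {..<length xs} \<union> (\<lambda>i. i + Suc (length xs)) ` {..<length ys}" (is "?l = ?r")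
  proof (rule equalityI; rule subsetI)
    fix h assume h: "h \<in> ?l"
    show "h \<in> ?r"
    proof (cases "h < length xs")
      case False
      then have "h = (h - Suc (length xs)) + Suc (length xs)" "h - Suc (length xs) < length ys"
        using h by auto
      then show ?thesis by (intro UnI2 image_eqI[of _ _ "h - Suc (length xs)"]) simp_all
    qed simp
  qed auto
  have "(\<Prod>h\<in>?l. f ((xs @ x # ys) ! h)) = (\<Prod>h<length xs. f ((xs @ x # ys) ! h)) *
      (\<Prod>h\<in>(\<lambda>i. i + Suc (length xs)) ` {..<length ys}. f ((xs @ x # ys) ! h))"
    unfolding split by (rule prod.union_disjoint) auto
  also have "(\<Prod>h<length xs. f ((xs @ x # ys) ! h)) = (\<Prod>h<length xs. f (xs ! h))"
    by (intro prod.cong refl) (simp add: nth_append)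
  also have "(\<Prod>h\<in>(\<lambda>i. i + Suc (length xs)) ` {..<length ys}. f ((xs @ x # ys) ! h)) =
      (\<Prod>h<length ys. f (ys ! h))"
    by (subst prod.reindex) (auto simp: nth_append inj_on_def)
  finally show ?thesis by (simp add: prod_nth)
qed

lemma not_isl_Inr: "\<not> isl s \<Longrightarrow> s = Inr (projr s)"
  by (cases s) auto

text \<open>The closed formula needs no distinction of cases: the indicator of \<open>Inr w\<close>
  finds the slot of an adjoined index, and \<open>ext0\<close> makes the summand vanish as soon as
  there is a second one.\<close>

lemma SAdj_eq_adjT:
  assumes C: "\<And>ks. \<lbrakk>length ks = 6; set ks \<subseteq> {1, 2}\<rbrakk> \<Longrightarrow>
       C ks = (if count_list ks 2 = 0 then 1 else if count_list ks 2 = 6 then -3 else 0)"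
    and ks: "length ks = 6" "set ks \<subseteq> adj_index 28 (Wset 7)"
  shows "SAdj (clone 7 C) (Wset 7) ks = adjT (Wset 7) vec_of (\<lambda>j. ks ! j)"
proof -
  let ?W = "Wset 7" and ?N = "filter (\<lambda>k. \<not> isl k) ks"
  have finW: "finite ?W" unfolding Wset_7 by (intro finite_imageI finite_indices)
  have head_prod: "(\<Prod>j<6. f (ks ! j)) = prod_list (map f ks)" for f :: "nat + (nat list \<Rightarrow> real) \<Rightarrow> real"
    using prod_nth[of f ks] ks(1) by simp
  have W_mem: "w \<in> ?W" if "Inr w \<in> set ks" for w
    using that ks(2) unfolding adj_index_def by auto
  have I_mem: "k \<in> {1..28}" if "Inl k \<in> set ks" for k
    using that ks(2) unfolding adj_index_def by auto
  show ?thesis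
  proof (cases "list_all isl ks")
    case True
    have noInr: "ks ! j \<noteq> Inr w" if "j < 6" for j w
      using True that ks(1) unfolding list_all_length by (metis sum.disc(2))
    have "(\<Sum>j<6. \<Sum>w\<in>?W. of_bool (ks ! j = Inr w) * (\<Prod>h\<in>{..<6} - {j}. ext0 (vec_of w) (ks ! h))) = 0"
      using noInr by (intro sum.neutral ballI) simp
    moreover have "prod_list (map head1 ks) - 3 * prod_list (map head2 ks) = clone 7 C (map projl ks)"
    proof -
      let ?f = "\<lambda>k::nat. if k \<le> 2 * 7 then 1 else 2 :: nat"
      let ?l = "map ?f (map projl ks)"
      have "count_list (map ?f (map projl xs)) 2 \<le> length xs \<and>
          prod_list (map head1 xs) = of_bool (count_list (map ?f (map projl xs)) 2 = 0) \<and>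
          prod_list (map head2 xs) = of_bool (count_list (map ?f (map projl xs)) 2 = length xs)"
        if "list_all isl xs" for xs :: "(nat + (nat list \<Rightarrow> real)) list"
        using that
      proof (induction xs)
        case (Cons a xs)
        then obtain k where "a = Inl k" by (cases a) auto
        then show ?case using Cons by (auto simp: head1_def head2_def)
      qed simp
      from this[OF True] have h: "prod_list (map head1 ks) = of_bool (count_list ?l 2 = 0)"
        "prod_list (map head2 ks) = of_bool (count_list ?l 2 = 6)" using ks(1) by simp_all
      have "C ?l = (if count_list ?l 2 = 0 then 1 else if count_list ?l 2 = 6 then -3 else 0)"
        by (rule C) (use ks(1) in auto)
      then show ?thesis unfolding clone_def h by auto
    qed
    ultimately show ?thesis using True unfolding SAdj_def adjT_def head_prod by simp
  next
    case False
    then obtain s where s: "s \<in> set ks" "\<not> isl s" unfolding list_all_iff by auto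
    then have hz: "prod_list (map head1 ks) = 0" "prod_list (map head2 ks) = 0"
      by (auto simp: prod_list_eq_0_real image_iff head1_def head2_def split: sum.split intro!: bexI[of _ s])
    obtain xs ys where xy: "ks = xs @ s # ys" using s(1) by (meson split_list)
    define w where "w = projr s"
    have sw: "s = Inr w" using not_isl_Inr[OF s(2)] by (simp add: w_def)
    have w: "w \<in> ?W" using W_mem s(1) sw by simp
    let ?t = "\<lambda>j. \<Sum>w\<in>?W. of_bool (ks ! j = Inr w) * (\<Prod>h\<in>{..<6} - {j}. ext0 (vec_of w) (ks ! h))"
    have t: "adjT ?W vec_of (\<lambda>j. ks ! j) = (\<Sum>j<6. ?t j)" unfolding adjT_def head_prod hz by simp
    have len: "length xs + Suc (length ys) = 6" using ks(1) xy by simp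
    have other: "?t j = 0" if j: "j \<in> {..<6} - {length xs}" for j
    proof -
      have "ext0 (vec_of w') (ks ! length xs) = 0" for w' by (simp add: xy sw ext0_def)
      then have "(\<Prod>h\<in>{..<6} - {j}. ext0 (vec_of w') (ks ! h)) = 0" for w'
        by (intro prod_zero bexI[of _ "length xs"]) (use j len in auto)
      then show ?thesis by (simp only: mult_zero_right sum.neutral_const)
    qed
    have "(\<Sum>j<6. ?t j) = ?t (length xs) + (\<Sum>j\<in>{..<6} - {length xs}. ?t j)"
      by (rule sum.remove) (use len in auto)
    also have "(\<Sum>j\<in>{..<6} - {length xs}. ?t j) = 0" by (rule sum.neutral) (use other in simp)
    also have "?t (length xs) = (\<Sum>w'\<in>?W. if w' = w then prod_list (map (ext0 (vec_of w)) (xs @ ys)) else 0)"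
    proof (intro sum.cong refl)
      fix w' assume "w' \<in> ?W"
      show "of_bool (ks ! length xs = Inr w') * (\<Prod>h\<in>{..<6} - {length xs}. ext0 (vec_of w') (ks ! h)) =
        (if w' = w then prod_list (map (ext0 (vec_of w)) (xs @ ys)) else 0)"
        using prod_delete_nth[where f = "ext0 (vec_of w)" and xs = xs and ys = ys and x = s] len by (auto simp: xy sw)
    qed
    also have "\<dots> = prod_list (map (ext0 (vec_of w)) (xs @ ys))" using finW w by simp
    finally have T: "adjT ?W vec_of (\<lambda>j. ks ! j) = prod_list (map (ext0 (vec_of w)) (xs @ ys))"
      using t by simp
    show ?thesis
    proof (cases "list_all isl (xs @ ys)")
      case True
      have fil: "?N = [s]" "filter isl ks = xs @ ys"
        using True s(2) by (auto simp: xy filter_empty_conv list_all_iff intro!: filter_True)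
      have "length (map projl (xs @ ys)) = 5" using len by simp
      moreover have "set (map projl (xs @ ys)) \<subseteq> {1..28}"
      proof
        fix k assume "k \<in> set (map projl (xs @ ys))"
        then obtain a where a: "a \<in> set (xs @ ys)" "k = projl a" by auto
        then have "a = Inl k" using True unfolding list_all_iff by (cases a) auto
        then show "k \<in> {1..28}" using I_mem a(1) xy by auto
      qed
      ultimately have "w (map projl (xs @ ys)) = prod_list (map (vec_of w) (map projl (xs @ ys)))"
        by (rule Wset_entry[OF w])
      also have "map (vec_of w) (map projl (xs @ ys)) = map (ext0 (vec_of w)) (xs @ ys)"
        unfolding map_map
      proof (rule map_cong[OF refl])
        fix a assume "a \<in> set (xs @ ys)"
        then have "isl a" using True unfolding list_all_iff by (rule bspec[rotated])
        then show "(vec_of w \<circ> projl) a = ext0 (vec_of w) a" by (cases a) (simp_all add: ext0_def)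
      qed
      finally show ?thesis unfolding T SAdj_def fil using False w sw by simp
    next
      case nall: False
      then obtain s' where s': "s' \<in> set (xs @ ys)" "\<not> isl s'" unfolding list_all_iff by auto
      have "length ?N \<noteq> 1"
      proof
        assume "length ?N = 1"
        then have "filter (\<lambda>k. \<not> isl k) xs = []" "filter (\<lambda>k. \<not> isl k) ys = []"
          using s(2) by (simp_all add: xy)
        then show False using s' by (auto simp: filter_empty_conv)
      qed
      moreover have "ext0 (vec_of w) s' = 0" using not_isl_Inr[OF s'(2)] by (metis ext0_def sum.simps(6))
      then have "prod_list (map (ext0 (vec_of w)) (xs @ ys)) = 0"
        using s'(1) unfolding prod_list_eq_0_real by (metis image_eqI set_map)
      ultimately show ?thesis unfolding T SAdj_def using False by simp
    qed
  qed
qed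

lemma adjT_permute:
  assumes p: "p permutes {..<6::nat}"
  shows "adjT W u (\<lambda>j. \<kappa> (p j)) = adjT W u \<kappa>"
proof -
  have bij: "bij_betw p {..<6} {..<6}" by (rule permutes_imp_bij[OF p])
  have pr: "(\<Prod>j<6. f (\<kappa> (p j))) = (\<Prod>j<6. f (\<kappa> j))" for f :: "nat + 'a \<Rightarrow> real"
    by (rule prod.reindex_bij_betw[OF bij, where g = "\<lambda>j. f (\<kappa> j)"])
  have del: "(\<Prod>h\<in>{..<6} - {j}. f (\<kappa> (p h))) = (\<Prod>h\<in>{..<6} - {p j}. f (\<kappa> h))"
    if "j < 6" for j and f :: "nat + 'a \<Rightarrow> real"
  proof (rule prod.reindex_bij_betw[where g = "\<lambda>j. f (\<kappa> j)"])
    show "bij_betw p ({..<6} - {j}) ({..<6} - {p j})"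
      using bij_betw_DiffI[OF bij, of "{j}" "{p j}"] that bij_betw_apply[OF bij, of j]
      by (simp add: bij_betw_def)
  qed
  define G where "G j = (\<Sum>w\<in>W. of_bool (\<kappa> j = Inr w) * (\<Prod>h\<in>{..<6} - {j}. ext0 (u w) (\<kappa> h)))" for j
  have "(\<Sum>j<6. \<Sum>w\<in>W. of_bool (\<kappa> (p j) = Inr w) * (\<Prod>h\<in>{..<6} - {j}. ext0 (u w) (\<kappa> (p h)))) =
      (\<Sum>j<6. G (p j))"
    unfolding G_def by (intro sum.cong refl) (simp add: del)
  also have "\<dots> = (\<Sum>j<6. G j)" by (rule sum.reindex_bij_betw[OF bij])
  finally show ?thesis unfolding adjT_def pr G_def by simp
qed

section \<open>Upper bounds\<close>

text \<open>This says whether the position lies in the half that carries K.\<close>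

definition second :: "bool \<Rightarrow> nat \<Rightarrow> bool" where "second b p \<longleftrightarrow> (if b then p \<le> 14 else 14 < p)"
definition loc :: "nat \<Rightarrow> nat" where "loc p = (if p \<le> 14 then p else p - 14)"

lemma uvec_second:
  assumes "p \<in> {1..28}"
  shows "uvec b (S, K, t) p =
    (if second b p then t * of_bool (cls b (loc p) \<in> K) else of_bool (cls b (loc p) \<in> S))"
  using assms by (auto simp: uvec.simps second_def loc_def)

lemma prod_of_bool: "finite A \<Longrightarrow> (\<Prod>h\<in>A. of_bool (P h)) = (of_bool (\<forall>h\<in>A. P h) :: real)"
  by (induction A rule: finite_induct) auto

lemma uvec_prod:
  assumes A: "finite A" and \<kappa>: "\<And>h. h \<in> A \<Longrightarrow> \<kappa> h \<in> {1..28}"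
  shows "(\<Prod>h\<in>A. uvec b (S, K, t) (\<kappa> h)) = t ^ card {h \<in> A. second b (\<kappa> h)} *
     of_bool ((\<lambda>h. cls b (loc (\<kappa> h))) ` {h \<in> A. second b (\<kappa> h)} \<subseteq> K) *
     of_bool ((\<lambda>h. cls b (loc (\<kappa> h))) ` {h \<in> A. \<not> second b (\<kappa> h)} \<subseteq> S)"
proof -
  let ?H = "{h \<in> A. second b (\<kappa> h)}" and ?H' = "{h \<in> A. \<not> second b (\<kappa> h)}"
  let ?c = "\<lambda>h. cls b (loc (\<kappa> h))"
  have eq: "A \<inter> {h. second b (\<kappa> h)} = ?H" "A \<inter> - {h. second b (\<kappa> h)} = ?H'" by auto
  have "(\<Prod>h\<in>A. uvec b (S, K, t) (\<kappa> h)) =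
      (\<Prod>h\<in>A. if second b (\<kappa> h) then t * of_bool (?c h \<in> K) else of_bool (?c h \<in> S))"
    using \<kappa> by (intro prod.cong refl uvec_second)
  also have "\<dots> = (\<Prod>h\<in>?H. t * of_bool (?c h \<in> K)) * (\<Prod>h\<in>?H'. of_bool (?c h \<in> S))"
    unfolding prod.If_cases[OF A] eq ..
  also have "\<dots> = t ^ card ?H * of_bool (\<forall>h\<in>?H. ?c h \<in> K) * of_bool (\<forall>h\<in>?H'. ?c h \<in> S)"
    using A by (simp add: prod.distrib prod_of_bool)
  finally show ?thesis by (simp add: image_subset_iff)
qed

definition cnt :: "nat \<Rightarrow> nat \<Rightarrow> nat" where
  "cnt s p = (if p \<le> s then (7 - p) choose (s - p) else 0)"

lemma card_supersets:
  assumes P: "P \<subseteq> {1..7}"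
  shows "card {S \<in> subsets s. P \<subseteq> S} = cnt s (card P)"
proof (cases "card P \<le> s")
  case True
  have fP: "finite P" using P by (rule finite_subset) simp
  have "bij_betw (\<lambda>T. P \<union> T) {T. T \<subseteq> {1..7} - P \<and> card T = s - card P} {S \<in> subsets s. P \<subseteq> S}"
  proof (rule bij_betwI[where g = "\<lambda>S. S - P"])
    show "(\<lambda>T. P \<union> T) \<in> {T. T \<subseteq> {1..7} - P \<and> card T = s - card P} \<rightarrow> {S \<in> subsets s. P \<subseteq> S}"
    proof
      fix T assume T: "T \<in> {T. T \<subseteq> {1..7} - P \<and> card T = s - card P}"
      then have "finite T" by (intro finite_subset[of T "{1..7} - P"]) simp_all
      moreover have "P \<inter> T = {}" using T by auto
      ultimately have "card (P \<union> T) = s" using T fP True by (simp add: card_Un_disjoint)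
      then show "P \<union> T \<in> {S \<in> subsets s. P \<subseteq> S}" using T P unfolding subsets_def by auto
    qed
    show "(\<lambda>S. S - P) \<in> {S \<in> subsets s. P \<subseteq> S} \<rightarrow> {T. T \<subseteq> {1..7} - P \<and> card T = s - card P}"
      using fP by (auto simp: subsets_def card_Diff_subset)
  qed auto
  from bij_betw_same_card[OF this] show ?thesis
    using P True fP by (simp add: n_subsets card_Diff_subset cnt_def)
next
  case False
  have "{S \<in> subsets s. P \<subseteq> S} = {}"
  proof (rule ccontr)
    assume "{S \<in> subsets s. P \<subseteq> S} \<noteq> {}"
    then obtain S where S: "S \<subseteq> {1..7}" "card S = s" "P \<subseteq> S" by (auto simp: subsets_def)
    then have "card P \<le> card S" by (intro card_mono) (auto intro: finite_subset)
    then show False using S False by simp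
  qed
  then show ?thesis using False by (simp only: card.empty cnt_def if_False)
qed

lemma sum_params:
  "(\<Sum>P\<in>params. f P) = (\<Sum>(s, k, t)\<in>types. \<Sum>S\<in>subsets s. \<Sum>K\<in>subsets k. f (S, K, t))"
proof -
  have b: "sum f (block (s, k, t)) = (\<Sum>S\<in>subsets s. \<Sum>K\<in>subsets k. f (S, K, t))" for s k t
    unfolding block_def prod.case
    by (subst sum.reindex) (auto simp: inj_on_def sum.cartesian_product case_prod_unfold intro!: sum.cong)
  have "sum f params = (\<Sum>\<tau>\<in>types. sum f (block \<tau>))"
    unfolding params_blocks by (rule sum.UNION_disjoint) (simp_all add: finite_types finite_block block_disjoint)
  also have "\<dots> = (\<Sum>(s, k, t)\<in>types. \<Sum>S\<in>subsets s. \<Sum>K\<in>subsets k. f (S, K, t))"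
    by (intro sum.cong refl) (auto simp: b)
  finally show ?thesis .
qed

lemma sum_types:
  "(\<Sum>(s, k, t)\<in>types. f s k t :: real) =
     f 4 0 1 + f 3 0 1 + f 2 0 1 + f 1 0 1 + f 4 1 1 + f 2 1 (25/24) + f 1 1 (5/4) + f 1 1 2
   + f 3 2 1 + f 2 2 (5/4) + f 2 1 (5/3) + f 0 1 1 + f 3 1 (4/3) + f 3 1 (5/6) + f 1 2 (3/2) + f 0 2 1"
  by (simp add: types_def)

text \<open>These coefficients solve the linear system obtained by comparing, for all numbers of distinct
  classes hit, the entries of \<open>\<Sum> \<gamma>\<^sub>u u\<^sup>\<otimes>\<^sup>5\<close> with those of the symmetrisations of \<open>X\<^sup>4 Y\<close>
  (\<open>coef False\<close>) and \<open>X\<^sup>3 Y\<^sup>2\<close> (\<open>coef True\<close>).\<close>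

definition coef :: "bool \<Rightarrow> nat \<Rightarrow> nat \<Rightarrow> real \<Rightarrow> real" where
  "coef e s k t =
    (if k = 0 then
       (if e then (if s = 3 then 147/5 else if s = 2 then -9408/125 else if s = 1 then 392/3 else 0)
        else (if s = 4 then -7 else if s = 3 then 63/4 else if s = 2 then -126/5 else 35))
     else if k = 1 then
       (if s = 4 then (if e then 0 else 1)
        else if s = 3 then (if t = 4/3 then (if e then 0 else -9/4) else (if e then -36/5 else 0))
        else if s = 2 then (if t = 5/3 then (if e then 0 else 18/5) else (if e then 2304/125 else 0))
        else if s = 1 then (if t = 2 then (if e then 0 else -5) else (if e then -32 else 0))
        else (if e then 1071875/3456 else 12005/27))
     else (if e then (if s = 3 then 1 else if s = 2 then -64/25 else if s = 1 then 40/9 else -1715/16)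
           else 0))"

text \<open>This is the entry of the weighted sum of fifth powers at a tuple with \<open>b\<close>
  positions in the half of K that meets \<open>p\<close> distinct classes in the half of S and
  \<open>q\<close> in the half of K.\<close>

definition weighted_count :: "bool \<Rightarrow> nat \<Rightarrow> nat \<Rightarrow> nat \<Rightarrow> real" where
  "weighted_count e b p q = (\<Sum>(s, k, t)\<in>types. coef e s k t * t ^ b * real (cnt s p) * real (cnt k q))"

lemma cnt_table:
  "cnt 0 0 = 1" "cnt 1 0 = 7" "cnt 2 0 = 21" "cnt 3 0 = 35" "cnt 4 0 = 35"
  "cnt 0 1 = 0" "cnt 1 1 = 1" "cnt 2 1 = 6" "cnt 3 1 = 15" "cnt 4 1 = 20"
  "cnt 0 2 = 0" "cnt 1 2 = 0" "cnt 2 2 = 1" "cnt 3 2 = 5" "cnt 4 2 = 10"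
  "cnt 0 3 = 0" "cnt 1 3 = 0" "cnt 2 3 = 0" "cnt 3 3 = 1" "cnt 4 3 = 4"
  "cnt 0 4 = 0" "cnt 1 4 = 0" "cnt 2 4 = 0" "cnt 3 4 = 0" "cnt 4 4 = 1"
  "cnt 0 5 = 0" "cnt 1 5 = 0" "cnt 2 5 = 0" "cnt 3 5 = 0" "cnt 4 5 = 0"
  by code_simp+

text \<open>The side conditions describe the triples that five positions can produce, so this is a
  finite check. Behind it is inclusion-exclusion: for \<open>coef False\<close> the products of
  coefficient and scale at k = 1 and s = 4, 3, 2, 1 are 1, -3, 6, -10; for \<open>coef True\<close>
  the coefficients times squared scales at k = 2 and s = 3, 2, 1 are 1, -4, 10. Summed against
  \<open>cnt s p\<close> they give 1 for every admissible positive \<open>p\<close>.\<close>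

lemma weighted_count_eq:
  assumes "b \<le> 5" "p \<le> 5 - b" "p = 0 \<longleftrightarrow> b = 5" "q \<le> b" "q = 0 \<longleftrightarrow> b = 0"
  shows "weighted_count e b p q = of_bool (b = (if e then 2 else 1))"
proof -
  have "b = 0 \<or> b = 1 \<or> b = 2 \<or> b = 3 \<or> b = 4 \<or> b = 5" using assms(1) by auto
  then show ?thesis
  proof (elim disjE)
    assume b: "b = 0"
    then have "p \<in> {1, 2, 3, 4, 5}" "q \<in> {0}" using assms(2-5) by auto
    then show ?thesis unfolding b weighted_count_def sum_types
      by (cases e; elim insertE emptyE; simp add: cnt_table[simplified] coef_def power_divide)
  next
    assume b: "b = 1"
    then have "p \<in> {1, 2, 3, 4}" "q \<in> {1}" using assms(2-5) by auto
    then show ?thesis unfolding b weighted_count_def sum_types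
      by (cases e; elim insertE emptyE; simp add: cnt_table[simplified] coef_def power_divide)
  next
    assume b: "b = 2"
    then have "p \<in> {1, 2, 3}" "q \<in> {1, 2}" using assms(2-5) by auto
    then show ?thesis unfolding b weighted_count_def sum_types
      by (cases e; elim insertE emptyE; simp add: cnt_table[simplified] coef_def power_divide)
  next
    assume b: "b = 3"
    then have "p \<in> {1, 2}" "q \<in> {1, 2, 3}" using assms(2-5) by auto
    then show ?thesis unfolding b weighted_count_def sum_types
      by (cases e; elim insertE emptyE; simp add: cnt_table[simplified] coef_def power_divide)
  next
    assume b: "b = 4"
    then have "p \<in> {1}" "q \<in> {1, 2, 3, 4}" using assms(2-5) by auto
    then show ?thesis unfolding b weighted_count_def sum_types
      by (cases e; elim insertE emptyE; simp add: cnt_table[simplified] coef_def power_divide)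
  next
    assume b: "b = 5"
    then have "p \<in> {0}" "q \<in> {1, 2, 3, 4, 5}" using assms(2-5) by auto
    then show ?thesis unfolding b weighted_count_def sum_types
      by (cases e; elim insertE emptyE; simp add: cnt_table[simplified] coef_def power_divide)
  qed
qed

text \<open>A vector contributes only through the inclusions of the classes met into S and K, so
  summing over all sets of given sizes leaves nothing but the counts of distinct classes.\<close>

lemma span_uvec:
  assumes A: "finite A" "card A = 5" and \<kappa>: "\<And>h. h \<in> A \<Longrightarrow> \<kappa> h \<in> {1..28}"
  shows "(\<Sum>(S, K, t)\<in>params. coef e (card S) (card K) t * (\<Prod>h\<in>A. uvec b (S, K, t) (\<kappa> h))) =
    of_bool (card {h \<in> A. second b (\<kappa> h)} = (if e then 2 else 1))"
proof -
  define H where "H = {h \<in> A. second b (\<kappa> h)}"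
  define H' where "H' = {h \<in> A. \<not> second b (\<kappa> h)}"
  let ?c = "\<lambda>h. cls b (loc (\<kappa> h))"
  have fin: "finite H" "finite H'" using A by (simp_all add: H_def H'_def)
  have "A = H \<union> H'" "H \<inter> H' = {}" by (auto simp: H_def H'_def)
  then have card: "card H + card H' = 5" using A fin by (simp add: card_Un_disjoint)
  have cl: "?c h \<in> {1..7}" if "h \<in> A" for h
  proof -
    have "loc (\<kappa> h) \<in> {1..14}" using \<kappa>[OF that] by (auto simp: loc_def)
    then show ?thesis by (auto simp: cls_def pair_cls_def shift_cls_def Suc_le_eq)
  qed
  then have sub: "?c ` H \<subseteq> {1..7}" "?c ` H' \<subseteq> {1..7}" by (auto simp: H_def H'_def)
  have cnts: "(\<Sum>S\<in>subsets s. of_bool (P \<subseteq> S)) = real (cnt s (card P))" if "P \<subseteq> {1..7}" for s P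
  proof -
    have "(\<Sum>S\<in>subsets s. of_bool (P \<subseteq> S)) = (\<Sum>S\<in>{S \<in> subsets s. P \<subseteq> S}. 1::real)"
      by (rule sum.mono_neutral_cong_right) (auto simp: finite_subsets)
    then show ?thesis using card_supersets[OF that] by simp
  qed
  have up: "(\<Prod>h\<in>A. uvec b (S, K, t) (\<kappa> h)) =
      t ^ card H * of_bool (?c ` H \<subseteq> K) * of_bool (?c ` H' \<subseteq> S)" for S K t
    unfolding H_def H'_def by (rule uvec_prod[OF A(1)]) (rule \<kappa>)
  have inner: "(\<Sum>S\<in>subsets s. \<Sum>K\<in>subsets k. coef e (card S) (card K) t * (\<Prod>h\<in>A. uvec b (S, K, t) (\<kappa> h))) =
      coef e s k t * t ^ card H * real (cnt s (card (?c ` H'))) * real (cnt k (card (?c ` H)))" for s k t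
  proof -
    have "(\<Sum>S\<in>subsets s. \<Sum>K\<in>subsets k. coef e (card S) (card K) t * (\<Prod>h\<in>A. uvec b (S, K, t) (\<kappa> h))) =
        (\<Sum>S\<in>subsets s. \<Sum>K\<in>subsets k. coef e s k t * t ^ card H * (of_bool (?c ` H' \<subseteq> S) * of_bool (?c ` H \<subseteq> K)))"
    proof (intro sum.cong refl)
      fix S K assume "S \<in> subsets s" "K \<in> subsets k"
      then have "card S = s" "card K = k" by (simp_all add: subsets_def)
      then show "coef e (card S) (card K) t * (\<Prod>h\<in>A. uvec b (S, K, t) (\<kappa> h)) =
          coef e s k t * t ^ card H * (of_bool (?c ` H' \<subseteq> S) * of_bool (?c ` H \<subseteq> K))"
        unfolding up by (simp only: mult_ac)
    qed
    also have "\<dots> = coef e s k t * t ^ card H *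
        ((\<Sum>S\<in>subsets s. of_bool (?c ` H' \<subseteq> S)) * (\<Sum>K\<in>subsets k. of_bool (?c ` H \<subseteq> K)))"
      by (simp only: sum_product) (simp only: sum_distrib_left)
    finally show ?thesis unfolding cnts[OF sub(1)] cnts[OF sub(2)] by (simp only: mult.assoc)
  qed
  have "(\<Sum>(S, K, t)\<in>params. coef e (card S) (card K) t * (\<Prod>h\<in>A. uvec b (S, K, t) (\<kappa> h))) =
      weighted_count e (card H) (card (?c ` H')) (card (?c ` H))"
    unfolding sum_params weighted_count_def by (simp only: prod.case inner)
  also have "\<dots> = of_bool (card H = (if e then 2 else 1))"
  proof (rule weighted_count_eq)
    show "card H \<le> 5" using card by simp
    show "card (?c ` H') \<le> 5 - card H" using card_image_le[OF fin(2), of ?c] card by simp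
    show "card (?c ` H) \<le> card H" by (rule card_image_le[OF fin(1)])
    show "card (?c ` H) = 0 \<longleftrightarrow> card H = 0" using fin by simp
    have "card (?c ` H') = 0 \<longleftrightarrow> card H' = 0" using fin by simp
    then show "card (?c ` H') = 0 \<longleftrightarrow> card H = 5" using card by auto
  qed
  finally show ?thesis by (simp only: H_def)
qed

text \<open>The number m is the number of factors Y in the monomial to be spanned. For m = 1, 2 the
  vectors with K on the second half serve; for m = 3, 4 their images under \<open>\<pi>\<close>,
  where the halves have exchanged roles.\<close>

definition gam :: "nat \<Rightarrow> (nat list \<Rightarrow> real) \<Rightarrow> real" where
  "gam m w = (case inv_into indices wten w of ((S, K, t), b) \<Rightarrow>
     (if b = (3 \<le> m) then coef (m \<in> {2, 3}) (card S) (card K) t else 0))"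

lemma span_W:
  assumes A: "finite A" "card A = 5" and \<kappa>: "\<And>h. h \<in> A \<Longrightarrow> \<kappa> h \<in> {1..28}" and m: "m \<in> {1, 2, 3, 4}"
  shows "(\<Sum>w\<in>Wset 7. gam m w * (\<Prod>h\<in>A. vec_of w (\<kappa> h))) = of_bool (card {h \<in> A. 14 < \<kappa> h} = m)"
proof -
  define f where "f P b = (case P of (S, K, t) \<Rightarrow>
    coef (m \<in> {2, 3}) (card S) (card K) t * (\<Prod>h\<in>A. uvec b (S, K, t) (\<kappa> h)))" for P and b
  have "(\<Sum>w\<in>Wset 7. gam m w * (\<Prod>h\<in>A. vec_of w (\<kappa> h))) =
      (\<Sum>q\<in>indices. if snd q = (3 \<le> m) then f (fst q) (snd q) else 0)"
    unfolding sum_Wset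
  proof (intro sum.cong refl)
    fix q assume q: "q \<in> indices"
    obtain S K t b where qe: "q = ((S, K, t), b)" by (metis surj_pair)
    have inv: "inv_into indices wten (wten q) = ((S, K, t), b)" using inv_into_f_f[OF inj_wten q] qe by simp
    show "gam m (wten q) * (\<Prod>h\<in>A. vec_of (wten q) (\<kappa> h)) =
        (if snd q = (3 \<le> m) then f (fst q) (snd q) else 0)"
      unfolding gam_def inv vec_of_wten[OF q] wvec_def by (simp add: qe f_def)
  qed
  also have "\<dots> = (\<Sum>P\<in>params. \<Sum>b\<in>UNIV. if b = (3 \<le> m) then f P b else 0)"
    unfolding sum.cartesian_product by (simp add: case_prod_unfold)
  also have "\<dots> = (\<Sum>P\<in>params. f P (3 \<le> m))" by (intro sum.cong refl) (simp add: UNIV_bool)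
  also have "\<dots> = of_bool (card {h \<in> A. second (3 \<le> m) (\<kappa> h)} = (if m \<in> {2, 3} then 2 else 1))"
    unfolding f_def by (rule span_uvec[OF A \<kappa>])
  also have "\<dots> = of_bool (card {h \<in> A. 14 < \<kappa> h} = m)"
  proof -
    have "A = {h \<in> A. \<kappa> h \<le> 14} \<union> {h \<in> A. 14 < \<kappa> h}" by auto
    moreover have "{h \<in> A. \<kappa> h \<le> 14} \<inter> {h \<in> A. 14 < \<kappa> h} = {}" by auto
    ultimately have "card A = card {h \<in> A. \<kappa> h \<le> 14} + card {h \<in> A. 14 < \<kappa> h}"
      using A(1) card_Un_disjoint[of "{h \<in> A. \<kappa> h \<le> 14}" "{h \<in> A. 14 < \<kappa> h}"] by simp
    then show ?thesis using m A(2) by (auto simp: second_def)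
  qed
  finally show ?thesis .
qed

text \<open>On index tuples with \<open>n\<close> entries in the second half, \<open>1 \<le> n \<le> 5\<close>, the rank one tensor
  \<open>(X - 3 Y) \<otimes> (X + Y)\<^sup>\<otimes>\<^sup>5\<close> has the entry \<open>1\<close> or \<open>-3\<close>. For \<open>n \<ge> 2\<close> it is recovered
  from \<open>Y \<otimes>\<^sub>j X\<^sup>6\<^sup>-\<^sup>n Y\<^sup>n\<^sup>-\<^sup>1\<close> with weights \<open>1/n - 4[j = 0]\<close>, for \<open>n = 1\<close> from \<open>X \<otimes>\<^sub>j X\<^sup>4 Y\<close>.\<close>

definition xi :: "nat \<Rightarrow> (nat list \<Rightarrow> real) \<Rightarrow> nat \<Rightarrow> real" where
  "xi j w k = - (if k \<le> 14 then (if j = 0 then 17/5 else -3/5) * gam 1 w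
     else (\<Sum>m\<in>{1, 2, 3, 4}. (1 / real (m + 1) - (if j = 0 then 4 else 0)) * gam m w))"

lemma rank_one_modulo_W:
  assumes \<kappa>: "\<And>j. j < 6 \<Longrightarrow> \<kappa> j \<in> {1..28}"
  shows "(\<Prod>j<6. of_bool (\<kappa> j \<le> 14)) - 3 * (\<Prod>j<6. of_bool (14 < \<kappa> j)) =
     (if \<kappa> 0 \<le> 14 then 1 else -3) +
     (\<Sum>j<6. \<Sum>w\<in>Wset 7. xi j w (\<kappa> j) * (\<Prod>h\<in>{..<6} - {j}. vec_of w (\<kappa> h)))"
proof -
  let ?p = "\<lambda>j w. \<Prod>h\<in>{..<6} - {j}. vec_of w (\<kappa> h)"
  define B where "B = {j. j < 6 \<and> 14 < \<kappa> j}"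
  define n where "n = card B"
  have B6: "B \<subseteq> {..<6}" by (auto simp: B_def)
  have finB: "finite B" by (rule finite_subset[OF B6]) simp
  have n6: "n \<le> 6" using card_mono[OF _ B6] by (simp add: n_def)
  have p1: "(\<Prod>j<6. of_bool (\<kappa> j \<le> 14)) = (of_bool (n = 0) :: real)"
  proof -
    have "B = {j \<in> {..<6}. \<not> \<kappa> j \<le> 14}" by (auto simp: B_def)
    then have "(\<forall>j\<in>{..<6}. \<kappa> j \<le> 14) \<longleftrightarrow> B = {}" by auto
    also have "\<dots> \<longleftrightarrow> n = 0" unfolding n_def using finB by simp
    finally show ?thesis by (simp only: prod_of_bool finite_lessThan)
  qed
  have p2: "(\<Prod>j<6. of_bool (14 < \<kappa> j)) = (of_bool (n = 6) :: real)"
  proof -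
    have "(\<forall>j\<in>{..<6}. 14 < \<kappa> j) \<longleftrightarrow> B = {..<6}" by (auto simp: B_def)
    also have "\<dots> \<longleftrightarrow> n = 6" unfolding n_def using card_subset_eq[OF _ B6] by auto
    finally show ?thesis by (simp only: prod_of_bool finite_lessThan)
  qed
  have E: "(\<Sum>w\<in>Wset 7. gam m w * ?p j w) = of_bool (card (B - {j}) = m)"
    if "j < 6" "m \<in> {1, 2, 3, 4}" for j m
  proof -
    have "{h \<in> {..<6} - {j}. 14 < \<kappa> h} = B - {j}" by (auto simp: B_def)
    moreover have "(\<Sum>w\<in>Wset 7. gam m w * ?p j w) =
        of_bool (card {h \<in> {..<6} - {j}. 14 < \<kappa> h} = m)"
      by (rule span_W) (use \<kappa> that in auto)
    ultimately show ?thesis by simp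
  qed
  have T: "(\<Sum>w\<in>Wset 7. xi j w (\<kappa> j) * ?p j w) =
      - (if j \<in> B then of_bool (n \<in> {2, 3, 4, 5}) * (1 / real n - (if j = 0 then 4 else 0))
         else of_bool (n = 1) * (if j = 0 then 17/5 else -3/5))" if j: "j < 6" for j
  proof (cases "j \<in> B")
    case True
    then have k: "\<not> \<kappa> j \<le> 14" by (simp add: B_def)
    have n1: "card (B - {j}) = n - 1" "0 < n" using True finB by (auto simp: n_def card_gt_0_iff)
    let ?q = "\<lambda>m. 1 / real (m + 1) - (if j = 0 then 4 else 0)"
    have "(\<Sum>w\<in>Wset 7. xi j w (\<kappa> j) * ?p j w) =
        (\<Sum>w\<in>Wset 7. \<Sum>m\<in>{1, 2, 3, 4}. - ?q m * (gam m w * ?p j w))"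
      by (intro sum.cong refl) (simp only: xi_def k if_False sum_distrib_right sum_negf[symmetric] mult_minus_left mult.assoc)
    also have "\<dots> = (\<Sum>m\<in>{1, 2, 3, 4}. - ?q m * (\<Sum>w\<in>Wset 7. gam m w * ?p j w))"
      unfolding sum_distrib_left by (rule sum.swap)
    also have "\<dots> = (\<Sum>m\<in>{1, 2, 3, 4}. - ?q m * of_bool (n - 1 = m))"
      by (intro sum.cong refl) (simp only: E[OF j] n1)
    also have "\<dots> = - (of_bool (n \<in> {2, 3, 4, 5}) * (1 / real n - (if j = 0 then 4 else 0)))"
    proof -
      have "n = 1 \<or> n = 2 \<or> n = 3 \<or> n = 4 \<or> n = 5 \<or> n = 6" using n1 n6 by auto
      then show ?thesis by (elim disjE) simp_all
    qed
    finally show ?thesis using True by simp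
  next
    case False
    then have k: "\<kappa> j \<le> 14" using j by (simp add: B_def)
    have "(\<Sum>w\<in>Wset 7. xi j w (\<kappa> j) * ?p j w) =
        - (if j = 0 then 17/5 else -3/5) * (\<Sum>w\<in>Wset 7. gam 1 w * ?p j w)"
      unfolding sum_distrib_left by (intro sum.cong refl) (simp only: xi_def k if_True mult_minus_left mult.assoc)
    also have "(\<Sum>w\<in>Wset 7. gam 1 w * ?p j w) = of_bool (n = 1)"
      using E[OF j, of 1] False by (simp add: n_def)
    finally show ?thesis using False by simp
  qed
  have z: "0 \<in> B \<longleftrightarrow> \<not> \<kappa> 0 \<le> 14" by (auto simp: B_def)
  have sB: "(\<Sum>j\<in>B. 1 / real n - (if j = 0 then 4 else 0)) = of_bool (0 < n) - 4 * of_bool (0 \<in> B)"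
  proof -
    have "(\<Sum>j\<in>B. if j = 0 then 4 else (0::real)) = 4 * of_bool (0 \<in> B)" using finB by simp
    moreover have "(\<Sum>j\<in>B. 1 / real n) = of_bool (0 < n)" by (auto simp: n_def)
    ultimately show ?thesis by (simp only: sum_subtractf)
  qed
  \<comment> \<open>For n = 1 the five slots outside B share the total -3, and slot 0 adds 4 if it
    is one of them. Up to sign these are the entries -3 and 1 to be removed; 17/5 is 4 -
    3/5.\<close>
  have sC: "(\<Sum>j\<in>{..<6} - B. if j = 0 then 17/5 else -3/5) = - 3/5 * (6 - real n) + 4 * of_bool (0 \<notin> B)"
  proof -
    have "(\<Sum>j\<in>{..<6} - B. if j = 0 then 17/5 else -3/5) =
        (\<Sum>j\<in>{..<6} - B. - 3/5 + (if j = 0 then 4 else (0::real)))"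
      by (intro sum.cong refl) simp
    also have "\<dots> = - 3/5 * real (card ({..<6} - B)) + 4 * of_bool (0 \<notin> B)"
      unfolding sum.distrib by simp
    also have "real (card ({..<6} - B)) = 6 - real n"
      using n6 finB B6 by (simp add: card_Diff_subset n_def of_nat_diff)
    finally show ?thesis .
  qed
  have "(\<Sum>j<6. \<Sum>w\<in>Wset 7. xi j w (\<kappa> j) * ?p j w) =
      (\<Sum>j<6. - (if j \<in> B then of_bool (n \<in> {2, 3, 4, 5}) * (1 / real n - (if j = 0 then 4 else 0))
         else of_bool (n = 1) * (if j = 0 then 17/5 else -3/5)))"
    by (intro sum.cong refl T) simp
  also have "\<dots> = - ((\<Sum>j\<in>B. of_bool (n \<in> {2, 3, 4, 5}) * (1 / real n - (if j = 0 then 4 else 0))) +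
      (\<Sum>j\<in>{..<6} - B. of_bool (n = 1) * (if j = 0 then 17/5 else -3/5)))"
  proof -
    have "{..<6} \<inter> {j. j \<in> B} = B" "{..<6} \<inter> - {j. j \<in> B} = {..<6} - B" using B6 by auto
    then show ?thesis unfolding sum_negf by (subst sum.If_cases) simp_all
  qed
  also have "\<dots> = - (of_bool (n \<in> {2, 3, 4, 5}) * (of_bool (0 < n) - 4 * of_bool (0 \<in> B)) +
      of_bool (n = 1) * (- 3/5 * (6 - real n) + 4 * of_bool (0 \<notin> B)))"
    unfolding sum_distrib_left[symmetric] sB sC ..
  finally have S: "(\<Sum>j<6. \<Sum>w\<in>Wset 7. xi j w (\<kappa> j) * ?p j w) = \<dots>" .
  have "n = 0 \<Longrightarrow> 0 \<notin> B" using finB by (auto simp: n_def)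
  moreover have "n = 6 \<Longrightarrow> 0 \<in> B" using card_subset_eq[OF _ B6] by (auto simp: n_def)
  moreover have "n = 0 \<or> n = 1 \<or> n = 2 \<or> n = 3 \<or> n = 4 \<or> n = 5 \<or> n = 6" using n6 by auto
  ultimately show ?thesis unfolding p1 p2 S z
    by (elim disjE) (auto simp: z)
qed

lemma finite_Wset_7: "finite (Wset 7)"
  unfolding Wset_7 by (intro finite_imageI finite_indices)

lemma adjT_rank_one_modulo:
  assumes \<kappa>: "\<And>j. j < 6 \<Longrightarrow> \<kappa> j \<in> adj_index 28 (Wset 7)"
  shows "(\<Prod>j<6. head1 (\<kappa> j)) - 3 * (\<Prod>j<6. head2 (\<kappa> j)) =
     (\<Prod>j<6. head1 (\<kappa> j) + (if j = 0 then -3 else 1) * head2 (\<kappa> j)) +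
     (\<Sum>j<6. \<Sum>w\<in>Wset 7. ext0 (xi j w) (\<kappa> j) * (\<Prod>h\<in>{..<6} - {j}. ext0 (vec_of w) (\<kappa> h)))"
proof (cases "\<exists>j<6. \<not> isl (\<kappa> j)")
  case True
  then obtain j where j: "j < 6" "\<not> isl (\<kappa> j)" by auto
  obtain a where a: "\<kappa> j = Inr a" using not_isl_Inr[OF j(2)] by simp
  have h: "head1 (\<kappa> j) = 0" "head2 (\<kappa> j) = 0" "ext0 f (\<kappa> j) = 0" for f
    by (simp_all add: a head1_def head2_def ext0_def)
  have p: "(\<Prod>j<6. head1 (\<kappa> j)) = 0" "(\<Prod>j<6. head2 (\<kappa> j)) = 0"
    "(\<Prod>j<6. head1 (\<kappa> j) + (if j = 0 then -3 else 1) * head2 (\<kappa> j)) = 0"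
    using j(1) h by (auto intro!: prod_zero bexI[of _ j])
  have "ext0 (xi i w) (\<kappa> i) * (\<Prod>h\<in>{..<6} - {i}. ext0 (vec_of w) (\<kappa> h)) = 0" for i w
  proof (cases "i = j")
    case False
    then have "(\<Prod>h\<in>{..<6} - {i}. ext0 (vec_of w) (\<kappa> h)) = 0"
      using j(1) h(3) by (intro prod_zero bexI[of _ j]) auto
    then show ?thesis by (simp only: mult_zero_right)
  qed (simp add: h)
  then show ?thesis unfolding p by (simp only: sum.neutral_const)
next
  case False
  define k where "k j = projl (\<kappa> j)" for j
  have k: "\<kappa> j = Inl (k j)" "k j \<in> {1..28}" if "j < 6" for j
  proof -
    show "\<kappa> j = Inl (k j)" using False that by (simp add: k_def)
    then show "k j \<in> {1..28}" using \<kappa>[OF that] by (auto simp: adj_index_def)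
  qed
  have p1: "(\<Prod>j<6. head1 (\<kappa> j)) = (\<Prod>j<6. of_bool (k j \<le> 14))"
    "(\<Prod>j<6. head2 (\<kappa> j)) = (\<Prod>j<6. of_bool (14 < k j))"
    by (intro prod.cong refl; simp add: k(1) head1_def head2_def)+
  have "(\<Prod>j<6. head1 (\<kappa> j) + (if j = 0 then -3 else 1) * head2 (\<kappa> j)) =
      (\<Prod>j<6::nat. if j = 0 then (if k 0 \<le> 14 then 1 else -3) else 1)"
    by (intro prod.cong refl) (simp add: k(1) head1_def head2_def)
  then have p2: "(\<Prod>j<6. head1 (\<kappa> j) + (if j = 0 then -3 else 1) * head2 (\<kappa> j)) =
      (if k 0 \<le> 14 then 1 else -3)" by simp
  have p3: "(\<Prod>h\<in>{..<6} - {j}. ext0 (vec_of w) (\<kappa> h)) = (\<Prod>h\<in>{..<6} - {j}. vec_of w (k h))" for w j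
    by (intro prod.cong refl) (simp add: k(1) ext0_def)
  have p4: "(\<Sum>j<6. \<Sum>w\<in>Wset 7. ext0 (xi j w) (\<kappa> j) * (\<Prod>h\<in>{..<6} - {j}. ext0 (vec_of w) (\<kappa> h))) =
      (\<Sum>j<6. \<Sum>w\<in>Wset 7. xi j w (k j) * (\<Prod>h\<in>{..<6} - {j}. vec_of w (k h)))"
    unfolding p3 by (intro sum.cong refl) (simp add: k(1) ext0_def)
  show ?thesis unfolding p1 p2 p4 by (rule rank_one_modulo_W) (rule k(2))
qed

text \<open>A modification by w in slot \<open>i\<close> agrees with the adjoined term of w in slot
  \<open>i\<close> in the five other factors, so it is absorbed into the remaining one at no cost.
  Six terms for each w and one more suffice.\<close>

lemma adjT_as_rank_one_sum:
  fixes \<kappa> :: "nat \<Rightarrow> nat + (nat list \<Rightarrow> real)"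
  defines "g \<equiv> \<lambda>a j s. case a of
      None \<Rightarrow> head1 s + (if j = (0::nat) then -3 else 1) * head2 s
    | Some (i, w) \<Rightarrow> if j = i then of_bool (s = Inr w) + ext0 (xi i w) s else ext0 (vec_of w) s"
  assumes \<kappa>: "\<And>j. j < 6 \<Longrightarrow> \<kappa> j \<in> adj_index 28 (Wset 7)"
  shows "adjT (Wset 7) vec_of \<kappa> =
    (\<Sum>a\<in>insert None (Some ` ({..<6} \<times> Wset 7)). \<Prod>j<6. g a j (\<kappa> j))"
proof -
  have Some: "(\<Prod>j<6. g (Some (i, w)) j (\<kappa> j)) =
      of_bool (\<kappa> i = Inr w) * (\<Prod>h\<in>{..<6} - {i}. ext0 (vec_of w) (\<kappa> h)) +
      ext0 (xi i w) (\<kappa> i) * (\<Prod>h\<in>{..<6} - {i}. ext0 (vec_of w) (\<kappa> h))" if "i < 6" for i w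
  proof -
    have "(\<Prod>j<6. g (Some (i, w)) j (\<kappa> j)) =
        g (Some (i, w)) i (\<kappa> i) * (\<Prod>j\<in>{..<6} - {i}. g (Some (i, w)) j (\<kappa> j))"
      by (rule prod.remove) (use that in simp_all)
    also have "(\<Prod>j\<in>{..<6} - {i}. g (Some (i, w)) j (\<kappa> j)) = (\<Prod>h\<in>{..<6} - {i}. ext0 (vec_of w) (\<kappa> h))"
      by (intro prod.cong refl) (simp add: g_def)
    finally show ?thesis by (simp add: g_def distrib_right)
  qed
  have "(\<Sum>a\<in>insert None (Some ` ({..<6} \<times> Wset 7)). \<Prod>j<6. g a j (\<kappa> j)) =
      (\<Prod>j<6. g None j (\<kappa> j)) + (\<Sum>a\<in>Some ` ({..<6} \<times> Wset 7). \<Prod>j<6. g a j (\<kappa> j))"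
    by (rule sum.insert) (auto simp: finite_Wset_7)
  also have "(\<Sum>a\<in>Some ` ({..<6} \<times> Wset 7). \<Prod>j<6. g a j (\<kappa> j)) =
      (\<Sum>i<6. \<Sum>w\<in>Wset 7. \<Prod>j<6. g (Some (i, w)) j (\<kappa> j))"
    unfolding sum.cartesian_product by (subst sum.reindex) (simp_all add: case_prod_unfold)
  also have "\<dots> = (\<Sum>i<6. \<Sum>w\<in>Wset 7.
      of_bool (\<kappa> i = Inr w) * (\<Prod>h\<in>{..<6} - {i}. ext0 (vec_of w) (\<kappa> h)) +
      ext0 (xi i w) (\<kappa> i) * (\<Prod>h\<in>{..<6} - {i}. ext0 (vec_of w) (\<kappa> h)))"
    by (intro sum.cong refl Some) simp
  also have "(\<Prod>j<6. g None j (\<kappa> j)) = (\<Prod>j<6. head1 (\<kappa> j) + (if j = 0 then -3 else 1) * head2 (\<kappa> j))"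
    by (simp add: g_def)
  finally have sum_eq: "(\<Sum>a\<in>insert None (Some ` ({..<6} \<times> Wset 7)). \<Prod>j<6. g a j (\<kappa> j)) =
      (\<Prod>j<6. head1 (\<kappa> j) + (if j = 0 then -3 else 1) * head2 (\<kappa> j)) + (\<Sum>i<6. \<Sum>w\<in>Wset 7.
      of_bool (\<kappa> i = Inr w) * (\<Prod>h\<in>{..<6} - {i}. ext0 (vec_of w) (\<kappa> h)) +
      ext0 (xi i w) (\<kappa> i) * (\<Prod>h\<in>{..<6} - {i}. ext0 (vec_of w) (\<kappa> h)))" .
  have modulo: "(\<Prod>j<6. head1 (\<kappa> j)) - 3 * (\<Prod>j<6. head2 (\<kappa> j)) =
     (\<Prod>j<6. head1 (\<kappa> j) + (if j = 0 then -3 else 1) * head2 (\<kappa> j)) +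
     (\<Sum>j<6. \<Sum>w\<in>Wset 7. ext0 (xi j w) (\<kappa> j) * (\<Prod>h\<in>{..<6} - {j}. ext0 (vec_of w) (\<kappa> h)))"
    by (rule adjT_rank_one_modulo) (rule \<kappa>)
  show ?thesis unfolding sum_eq adjT_def modulo sum.distrib by (simp only: add_ac)
qed

text \<open>The nodes \<open>\<plusminus>1, \<plusminus>2, \<plusminus>3\<close> and weights satisfy \<open>\<Sum> c\<^sub>i \<tau>\<^sub>i\<^sup>k = [k = 1]\<close> for \<open>k \<le> 6\<close>.\<close>

definition node :: "nat \<Rightarrow> real" where "node i = [1, -1, 2, -2, 3, -3] ! i"
definition weight :: "nat \<Rightarrow> real" where "weight i = [3/4, -3/4, -3/20, 3/20, 1/60, -1/60] ! i"

lemma sum_less_6: "(\<Sum>i<6. f i) = f 0 + f 1 + f 2 + f 3 + f 4 + (f 5 :: real)" for f :: "nat \<Rightarrow> real"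
  by (simp add: numeral_eq_Suc)

lemma power_sum_linear_part:
  fixes \<alpha> \<beta> :: "nat \<Rightarrow> real"
  shows "(\<Sum>i<6. weight i * (\<Prod>j<6. \<alpha> j + node i * \<beta> j)) = (\<Sum>j<6. \<beta> j * (\<Prod>h\<in>{..<6} - {j}. \<alpha> h))"
proof -
  have prod6: "(\<Prod>j<6. f j) = (f 0 * f 1 * f 2) * (f 3 * f 4 * f 5)" for f :: "nat \<Rightarrow> real"
    by (simp add: numeral_eq_Suc)
  have l6: "{..<6} = {0, 1, 2, 3, 4, 5::nat}" by (auto simp: numeral_eq_Suc)
  have del: "{..<6} - {0} = {1, 2, 3, 4, 5::nat}" "{..<6} - {1} = {0, 2, 3, 4, 5::nat}"
    "{..<6} - {2} = {0, 1, 3, 4, 5::nat}" "{..<6} - {3} = {0, 1, 2, 4, 5::nat}"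
    "{..<6} - {4} = {0, 1, 2, 3, 5::nat}" "{..<6} - {5} = {0, 1, 2, 3, 4::nat}"
    unfolding l6 by auto
  \<comment> \<open>The product is treated as one of two cubics in the node with named coefficients,
    which keeps the expansion small.\<close>
  define p0 where "p0 = \<alpha> 0 * \<alpha> 1 * \<alpha> 2"
  define p1 where "p1 = \<beta> 0 * \<alpha> 1 * \<alpha> 2 + \<alpha> 0 * \<beta> 1 * \<alpha> 2 + \<alpha> 0 * \<alpha> 1 * \<beta> 2"
  define p2 where "p2 = \<beta> 0 * \<beta> 1 * \<alpha> 2 + \<alpha> 0 * \<beta> 1 * \<beta> 2 + \<beta> 0 * \<alpha> 1 * \<beta> 2"
  define p3 where "p3 = \<beta> 0 * \<beta> 1 * \<beta> 2"
  define q0 where "q0 = \<alpha> 3 * \<alpha> 4 * \<alpha> 5"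
  define q1 where "q1 = \<beta> 3 * \<alpha> 4 * \<alpha> 5 + \<alpha> 3 * \<beta> 4 * \<alpha> 5 + \<alpha> 3 * \<alpha> 4 * \<beta> 5"
  define q2 where "q2 = \<beta> 3 * \<beta> 4 * \<alpha> 5 + \<alpha> 3 * \<beta> 4 * \<beta> 5 + \<beta> 3 * \<alpha> 4 * \<beta> 5"
  define q3 where "q3 = \<beta> 3 * \<beta> 4 * \<beta> 5"
  have f1: "(\<alpha> 0 + t * \<beta> 0) * (\<alpha> 1 + t * \<beta> 1) * (\<alpha> 2 + t * \<beta> 2) = p0 + t * p1 + t\<^sup>2 * p2 + t ^ 3 * p3" for t
    unfolding p0_def p1_def p2_def p3_def by algebra
  have f2: "(\<alpha> 3 + t * \<beta> 3) * (\<alpha> 4 + t * \<beta> 4) * (\<alpha> 5 + t * \<beta> 5) = q0 + t * q1 + t\<^sup>2 * q2 + t ^ 3 * q3" for t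
    unfolding q0_def q1_def q2_def q3_def by algebra
  have "(\<Sum>i<6. weight i * (\<Prod>j<6. \<alpha> j + node i * \<beta> j)) = p0 * q1 + p1 * q0"
    unfolding prod6 f1 f2 sum_less_6 by (simp add: weight_def node_def field_simps)
  also have "\<dots> = (\<Sum>j<6. \<beta> j * (\<Prod>h\<in>{..<6} - {j}. \<alpha> h))"
    unfolding sum_less_6 del p0_def p1_def q0_def q1_def by (simp add: algebra_simps)
  finally show ?thesis .
qed

text \<open>The six terms adjoined for one w together form the linear coefficient in
  \<open>t\<close> of the sixth power of u + t e_w, where e_w is the unit vector at w. Six nodes
  extract it, so six powers replace six slots, and the two powers of the head remain.\<close>

lemma adjT_as_power_sum:
  fixes \<kappa> :: "nat \<Rightarrow> nat + 'w" and u :: "'w \<Rightarrow> nat \<Rightarrow> real"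
  assumes W: "finite W"
  defines "v \<equiv> \<lambda>a s. case a of Inl b \<Rightarrow> (if b then head2 s else head1 s)
    | Inr (w, i) \<Rightarrow> ext0 (u w) s + node i * of_bool (s = Inr w)"
    and "d \<equiv> \<lambda>a. case a of Inl b \<Rightarrow> (if b then -3 else 1) | Inr (w, i) \<Rightarrow> weight i"
  shows "adjT W u \<kappa> = (\<Sum>a\<in>Inl ` UNIV \<union> Inr ` (W \<times> {..<6}). d a * (\<Prod>j<6. v a (\<kappa> j)))"
proof -
  let ?f = "\<lambda>a. d a * (\<Prod>j<6. v a (\<kappa> j))"
  have "(\<Sum>a\<in>Inl ` UNIV \<union> Inr ` (W \<times> {..<6}). ?f a) = sum ?f (Inl ` UNIV) + sum ?f (Inr ` (W \<times> {..<6}))"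
    using W by (intro sum.union_disjoint) auto
  also have "sum ?f (Inl ` UNIV) = (\<Prod>j<6. head1 (\<kappa> j)) - 3 * (\<Prod>j<6. head2 (\<kappa> j))"
    by (simp add: sum.reindex UNIV_bool d_def v_def)
  also have "sum ?f (Inr ` (W \<times> {..<6})) = (\<Sum>w\<in>W. \<Sum>i<6. weight i * (\<Prod>j<6. ext0 (u w) (\<kappa> j) + node i * of_bool (\<kappa> j = Inr w)))"
    unfolding sum.cartesian_product by (subst sum.reindex) (simp_all add: d_def v_def case_prod_unfold)
  also have "\<dots> = (\<Sum>w\<in>W. \<Sum>j<6. of_bool (\<kappa> j = Inr w) * (\<Prod>h\<in>{..<6} - {j}. ext0 (u w) (\<kappa> h)))"
    by (intro sum.cong refl power_sum_linear_part)
  also have "\<dots> = (\<Sum>j<6. \<Sum>w\<in>W. of_bool (\<kappa> j = Inr w) * (\<Prod>h\<in>{..<6} - {j}. ext0 (u w) (\<kappa> h)))"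
    by (rule sum.swap)
  finally show ?thesis by (simp only: adjT_def)
qed

lemma adjT_cong: "(\<And>j. j < 6 \<Longrightarrow> \<kappa> j = \<kappa>' j) \<Longrightarrow> adjT W u \<kappa> = adjT W u \<kappa>'"
  unfolding adjT_def
  by (intro arg_cong2[of _ _ _ _ "(+)"] arg_cong2[of _ _ _ _ "(-)"] arg_cong2[of _ _ _ _ "(*)"]
      prod.cong sum.cong refl) simp_all

lemma enumerate_sum:
  assumes "finite A"
  shows "\<exists>h. \<forall>f :: 'a \<Rightarrow> real. (\<Sum>a\<in>A. f a) = (\<Sum>i<card A. f (h i))"
proof -
  obtain h where h: "bij_betw h {0..<card A} A" using ex_bij_betw_nat_finite[OF assms] by (rule exE)
  have "(\<Sum>i<card A. f (h i)) = (\<Sum>a\<in>A. f a)" for f :: "'a \<Rightarrow> real"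
    using sum.reindex_bij_betw[OF h, of f] by (simp only: atLeast0LessThan)
  then show ?thesis by (intro exI[of _ h]) simp
qed

section \<open>The two ranks of the adjoined tensor\<close>

lemma adj_decomposition_Wset:
  assumes dec: "\<And>ks. \<lbrakk>length ks = 6; set ks \<subseteq> adj_index 28 (Wset 7)\<rbrakk> \<Longrightarrow>
      adjT (Wset 7) vec_of (\<lambda>j. ks ! j) = (\<Sum>i<r. c i * (\<Prod>j<6. v i j (ks ! j)))"
  shows "adj_decomposition (Wset 7) vec_of c v r"
proof
  show "finite (Wset 7)" by (rule finite_Wset_7)
  show "adjT (Wset 7) vec_of \<kappa> = (\<Sum>i<r. c i * (\<Prod>j<6. v i j (\<kappa> j)))"
    if \<kappa>: "\<forall>j<6. \<kappa> j \<in> Inl ` {1..28} \<union> Inr ` Wset 7" for \<kappa>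
  proof -
    let ?ks = "map \<kappa> [0..<6]"
    have n: "?ks ! j = \<kappa> j" if "j < 6" for j using that by simp
    have "adjT (Wset 7) vec_of \<kappa> = adjT (Wset 7) vec_of (\<lambda>j. ?ks ! j)" by (rule adjT_cong) (simp add: n)
    also have "\<dots> = (\<Sum>i<r. c i * (\<Prod>j<6. v i j (?ks ! j)))"
      by (rule dec) (use \<kappa> in \<open>auto simp: adj_index_def\<close>)
    also have "\<dots> = (\<Sum>i<r. c i * (\<Prod>j<6. v i j (\<kappa> j)))"
      by (intro sum.cong prod.cong arg_cong2[of _ _ _ _ "(*)"] refl) (simp add: n)
    finally show ?thesis .
  qed
  show "\<forall>w\<in>Wset 7. x w = 0"
    if "\<And>\<kappa> :: nat \<Rightarrow> nat. \<forall>j<5. \<kappa> j \<in> {1..28} \<Longrightarrow> (\<Sum>w\<in>Wset 7. x w * (\<Prod>j<5. vec_of w (\<kappa> j))) = 0" for x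
    by (rule Wset_independent) (rule that)
  show "(\<exists>p\<in>P. vec_of w p = 0) \<and> (\<exists>p\<in>P. vec_of w (p + 14) = 0)"
    if "w \<in> Wset 7" "P \<subseteq> {1..14}" "card P = 5" "inj_on pair_cls P" "inj_on shift_cls P" for w P
    by (rule Wset_sparse[OF that])
qed

theorem theorem5p2:
  fixes C :: "nat list \<Rightarrow> real"
  assumes C_sym: "symmetric_tensor {1, 2} 6 C"
    and C_form: "\<forall>x. form_of 2 6 C x = x 1 ^ 6 - 3 * x 2 ^ 6"
  shows "card (Wset 7) = 5152
       \<and> card (adj_index 28 (Wset 7)) = 5180
       \<and> symmetric_tensor (adj_index 28 (Wset 7)) 6 (SAdj (clone 7 C) (Wset 7))
       \<and> tensor_rank (adj_index 28 (Wset 7)) 6 (SAdj (clone 7 C) (Wset 7)) = 30913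
       \<and> symmetric_rank (adj_index 28 (Wset 7)) 6 (SAdj (clone 7 C) (Wset 7)) = 30914"
proof (intro conjI)
  let ?S = "adj_index 28 (Wset 7)" and ?T = "SAdj (clone 7 C) (Wset 7)"
  have T: "?T ks = adjT (Wset 7) vec_of (\<lambda>j. ks ! j)" if "length ks = 6" "set ks \<subseteq> ?S" for ks
    by (rule SAdj_eq_adjT[OF form_entries[OF C_sym C_form] that])
  have entry: "ks ! j \<in> ?S" if "length ks = 6" "set ks \<subseteq> ?S" "j < 6" for ks j
    using that nth_mem[of j ks] by (auto simp: subset_iff)
  show "card (Wset 7) = 5152" by (rule card_Wset_7)
  have "card ?S = card (Inl ` {1..28::nat} :: (nat + (nat list \<Rightarrow> real)) set) + card (Inr ` Wset 7 :: (nat + (nat list \<Rightarrow> real)) set)"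
    unfolding adj_index_def by (rule card_Un_disjoint) (auto simp: finite_Wset_7)
  also have "\<dots> = 5180" by (simp add: card_image card_Wset_7)
  finally show "card ?S = 5180" .
  show "symmetric_tensor ?S 6 ?T"
    unfolding symmetric_tensor_def
  proof (intro allI impI, elim conjE)
    fix ks ks' assume ks: "length ks = 6" "set ks \<subseteq> ?S" and m: "mset ks' = mset ks"
    have ks': "length ks' = 6" "set ks' \<subseteq> ?S"
      using ks mset_eq_length[OF m] mset_eq_setD[OF m] by simp_all
    obtain p where p: "p permutes {..<length ks}" "permute_list p ks = ks'"
      by (rule mset_eq_permutation[OF m])
    have "adjT (Wset 7) vec_of (\<lambda>j. ks' ! j) = adjT (Wset 7) vec_of (\<lambda>j. ks ! p j)"
      by (rule adjT_cong) (use p(2) ks(1) permute_list_nth[OF p(1)] in auto)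
    also have "\<dots> = adjT (Wset 7) vec_of (\<lambda>j. ks ! j)"
      using adjT_permute[of p "Wset 7" vec_of "\<lambda>j. ks ! j"] p(1) ks(1) by simp
    finally show "?T ks = ?T ks'" using T[OF ks] T[OF ks'] by simp
  qed
  show "tensor_rank ?S 6 ?T = 30913"
    unfolding tensor_rank_def
  proof (rule Least_equality)
    let ?A = "insert None (Some ` ({..<6::nat} \<times> Wset 7))"
    define g where "g = (\<lambda>a j s. case a of
        None \<Rightarrow> head1 s + (if j = (0::nat) then -3 else 1) * head2 s
      | Some (i, w) \<Rightarrow> if j = i then of_bool (s = Inr w) + ext0 (xi i w) s else ext0 (vec_of w) s)"
    have finA: "finite ?A" by (simp add: finite_Wset_7)
    have cardA: "card ?A = 30913"
      by (subst card_insert_disjoint) (auto simp: finite_Wset_7 card_image card_cartesian_product card_Wset_7)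
    obtain h where h: "\<forall>f :: _ \<Rightarrow> real. (\<Sum>a\<in>?A. f a) = (\<Sum>i<card ?A. f (h i))"
      using enumerate_sum[OF finA] by (rule exE)
    have "?T ks = (\<Sum>i<30913. \<Prod>j<6. g (h i) j (ks ! j))" if ks: "length ks = 6 \<and> set ks \<subseteq> ?S" for ks
    proof -
      have "?T ks = (\<Sum>a\<in>?A. \<Prod>j<6. g a j (ks ! j))"
        unfolding T[OF conjunct1[OF ks] conjunct2[OF ks]] g_def
        by (rule adjT_as_rank_one_sum) (rule entry[OF conjunct1[OF ks] conjunct2[OF ks]])
      then show ?thesis using h[rule_format, of "\<lambda>a. \<Prod>j<6. g a j (ks ! j)"] by (simp only: cardA)
    qed
    then show "\<exists>v :: nat \<Rightarrow> _. \<forall>ks. length ks = 6 \<and> set ks \<subseteq> ?S \<longrightarrow> ?T ks = (\<Sum>i<30913. \<Prod>j<6. v i j (ks ! j))"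
      by (intro exI[of _ "\<lambda>i. g (h i)"]) simp
  next
    fix r :: nat assume "\<exists>v. \<forall>ks. length ks = 6 \<and> set ks \<subseteq> ?S \<longrightarrow> ?T ks = (\<Sum>i<r. \<Prod>j<6. v i j (ks ! j))"
    then obtain v where v: "\<forall>ks. length ks = 6 \<and> set ks \<subseteq> ?S \<longrightarrow> ?T ks = (\<Sum>i<r. \<Prod>j<6. v i j (ks ! j))"
      by (rule exE)
    interpret adj_decomposition "Wset 7" vec_of "\<lambda>_. 1" v r
    proof (rule adj_decomposition_Wset)
      fix ks assume ks: "length ks = 6" "set ks \<subseteq> ?S"
      then show "adjT (Wset 7) vec_of (\<lambda>j. ks ! j) = (\<Sum>i<r. 1 * (\<Prod>j<6. v i j (ks ! j)))"
        using v T[OF ks] by simp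
    qed
    show "30913 \<le> r" using num_terms_gt by (simp add: card_Wset_7)
  qed
  show "symmetric_rank ?S 6 ?T = 30914"
    unfolding symmetric_rank_def
  proof (rule Least_equality)
    let ?A = "Inl ` (UNIV :: bool set) \<union> Inr ` (Wset 7 \<times> {..<6::nat})"
    define g where "g = (\<lambda>a s. case a of Inl b \<Rightarrow> (if b then head2 s else head1 s)
      | Inr (w, i) \<Rightarrow> ext0 (vec_of w) s + node i * of_bool (s = Inr w))"
    define d where "d = (\<lambda>a. case a of Inl b \<Rightarrow> (if b then -3 else 1) | Inr (w :: nat list \<Rightarrow> real, i) \<Rightarrow> weight i)"
    have finA: "finite ?A" by (simp add: finite_Wset_7)
    have cardA: "card ?A = 30914"
      by (subst card_Un_disjoint) (auto simp: finite_Wset_7 card_image card_cartesian_product card_Wset_7)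
    obtain h where h: "\<forall>f :: _ \<Rightarrow> real. (\<Sum>a\<in>?A. f a) = (\<Sum>i<card ?A. f (h i))"
      using enumerate_sum[OF finA] by (rule exE)
    have "?T ks = (\<Sum>i<30914. d (h i) * (\<Prod>j<6. g (h i) (ks ! j)))"
      if ks: "length ks = 6 \<and> set ks \<subseteq> ?S" for ks
    proof -
      have "?T ks = (\<Sum>a\<in>?A. d a * (\<Prod>j<6. g a (ks ! j)))"
        unfolding T[OF conjunct1[OF ks] conjunct2[OF ks]] g_def d_def
        by (rule adjT_as_power_sum[OF finite_Wset_7])
      then show ?thesis using h[rule_format, of "\<lambda>a. d a * (\<Prod>j<6. g a (ks ! j))"] by (simp only: cardA)
    qed
    then show "\<exists>(c :: nat \<Rightarrow> _) v. \<forall>ks. length ks = 6 \<and> set ks \<subseteq> ?S \<longrightarrow> ?T ks = (\<Sum>i<30914. c i * (\<Prod>j<6. v i (ks ! j)))"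
      by (intro exI[of _ "\<lambda>i. d (h i)"] exI[of _ "\<lambda>i. g (h i)"]) simp
  next
    fix r :: nat assume "\<exists>c v. \<forall>ks. length ks = 6 \<and> set ks \<subseteq> ?S \<longrightarrow> ?T ks = (\<Sum>i<r. c i * (\<Prod>j<6. v i (ks ! j)))"
    then obtain c v where cv: "\<forall>ks. length ks = 6 \<and> set ks \<subseteq> ?S \<longrightarrow> ?T ks = (\<Sum>i<r. c i * (\<Prod>j<6. v i (ks ! j)))"
      by (elim exE)
    show "30914 \<le> r"
    proof (rule ccontr)
      assume "\<not> 30914 \<le> r"
      then have r: "r \<le> 30913" by simp
      \<comment> \<open>The locale fixes the number of terms, so a shorter decomposition is filled
        up with zero coefficients.\<close>
      define c' where "c' i = (if i < r then c i else 0)" for i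
      interpret sym_adj_decomposition "Wset 7" vec_of c' v "30913"
      proof (rule sym_adj_decomposition.intro)
        show "adj_decomposition (Wset 7) vec_of c' (\<lambda>i j. v i) 30913"
        proof (rule adj_decomposition_Wset)
          fix ks assume ks: "length ks = 6" "set ks \<subseteq> ?S"
          then have "adjT (Wset 7) vec_of (\<lambda>j. ks ! j) = (\<Sum>i<r. c i * (\<Prod>j<6. v i (ks ! j)))"
            using cv T[OF ks] by simp
          also have "\<dots> = (\<Sum>i<30913. c' i * (\<Prod>j<6. v i (ks ! j)))"
            by (rule sum.mono_neutral_cong_left) (use r in \<open>auto simp: c'_def\<close>)
          finally show "adjT (Wset 7) vec_of (\<lambda>j. ks ! j) = (\<Sum>i<30913. c' i * (\<Prod>j<6. v i (ks ! j)))" .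
        qed
        show "sym_adj_decomposition_axioms (Wset 7) 30913"
          by unfold_locales (simp add: card_Wset_7)
      qed
      show False by (rule no_decomposition)
    qed
  qed
qed

end
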